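(* Let $G$ be a simple positively LLY-curved outerplanar graph with minimum degree $\delta(G)\ge 2$. Then $|V(G)|\leq 10$. Moreover, the upper bound is sharp: there exists a simple positively LLY-curved outerplanar graph with minimum degree at least $2$ and exactly $10$ vertices.
   Context: For a graph $G$, $N(x)$ is the neighborhood of a vertex $x$, $d(x)=|N(x)|$ is its degree, and $d(x,y)$ is the graph distance. For $0\le\alpha<1$ the $\alpha$-lazy random walk at $x$ is the probability distribution on $V(G)$ given by $m_x^{\alpha}(x)=\alpha$, $m_x^{\alpha}(v)=(1-\alpha)/d(x)$ for $v\in N(x)$, and $m_x^{\alpha}(v)=0$ otherwise. The Wasserstein-1 distance between finitely supported probability distributions $m_1,m_2$ on $V(G)$ is $W(m_1,m_2)=\inf_A\sum_{u,v\in V(G)}A(u,v)d(u,v)$, where the infimum is over all couplings $A:V(G)\times V(G)\to[0,1]$ with finite support and marginals $m_1$ and $m_2$. For $x\ne y$ let $\kappa_\alpha(x,y)=1-\frac{W(m_x^\alpha,m_y^\alpha)}{d(x,y)}$. The Lin-Lu-Yau (LLY) curvature is $\kappa_{\mathrm{LLY}}(x,y)=\lim_{\alpha\to1}\frac{\kappa_\alpha(x,y)}{1-\alpha}$. $G$ is called positively LLY-curved if $\kappa_{\mathrm{LLY}}(x,y)>0$ for all $x\ne y\in V(G)$. A graph is outerplanar if it can be drawn in the plane without crossings with all vertices on the boundary of the outer face. *)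

theory Defs
  imports "HOL-Analysis.Analysis"
begin

text \<open>
  A graph is given by a vertex set \<open>V\<close> (possibly infinite) and an adjacency relation \<open>E\<close>.
\<close>

definition simple_graph :: "'a set \<Rightarrow> ('a \<Rightarrow> 'a \<Rightarrow> bool) \<Rightarrow> bool" where
  "simple_graph V E \<longleftrightarrow> (\<forall>x y. E x y \<longrightarrow> x \<in> V \<and> y \<in> V) \<and> symp E \<and> irreflp E"

definition nbhd :: "('a \<Rightarrow> 'a \<Rightarrow> bool) \<Rightarrow> 'a \<Rightarrow> 'a set" where
  "nbhd E x = {v. E x v}"

definition deg :: "('a \<Rightarrow> 'a \<Rightarrow> bool) \<Rightarrow> 'a \<Rightarrow> nat" where
  "deg E x = card (nbhd E x)"

definition min_degree :: "'a set \<Rightarrow> ('a \<Rightarrow> 'a \<Rightarrow> bool) \<Rightarrow> nat" where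
  "min_degree V E = (INF x\<in>V. deg E x)"

definition locally_finite :: "'a set \<Rightarrow> ('a \<Rightarrow> 'a \<Rightarrow> bool) \<Rightarrow> bool" where
  "locally_finite V E \<longleftrightarrow> (\<forall>x\<in>V. finite (nbhd E x))"

definition connected_graph :: "'a set \<Rightarrow> ('a \<Rightarrow> 'a \<Rightarrow> bool) \<Rightarrow> bool" where
  "connected_graph V E \<longleftrightarrow> (\<forall>x\<in>V. \<forall>y\<in>V. E\<^sup>*\<^sup>* x y)"

text \<open>
  \<open>(E ^^ n) x y\<close> says that there is a walk of length \<open>n\<close> from \<open>x\<close> to \<open>y\<close>; the distance is
  meaningful only when \<open>x\<close> and \<open>y\<close> lie in the same connected component.
\<close>

definition gdist :: "('a \<Rightarrow> 'a \<Rightarrow> bool) \<Rightarrow> 'a \<Rightarrow> 'a \<Rightarrow> nat" where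
  "gdist E x y = (LEAST n. (E ^^ n) x y)"

definition lazy_walk :: "('a \<Rightarrow> 'a \<Rightarrow> bool) \<Rightarrow> real \<Rightarrow> 'a \<Rightarrow> 'a \<Rightarrow> real" where
  "lazy_walk E \<alpha> x v =
     (if v = x then \<alpha> else if v \<in> nbhd E x then (1 - \<alpha>) / real (deg E x) else 0)"

text \<open>All infinite sums below have finite support, so they are finite sums.\<close>

definition is_coupling ::
  "'a set \<Rightarrow> ('a \<Rightarrow> real) \<Rightarrow> ('a \<Rightarrow> real) \<Rightarrow> ('a \<times> 'a \<Rightarrow> real) \<Rightarrow> bool" where
  "is_coupling V m1 m2 A \<longleftrightarrow>
     (\<forall>u\<in>V. \<forall>v\<in>V. A (u, v) \<in> {0..1}) \<and>
     finite {z \<in> V \<times> V. A z \<noteq> 0} \<and>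
     (\<forall>u\<in>V. (\<Sum>\<^sub>\<infinity>v\<in>V. A (u, v)) = m1 u) \<and>
     (\<forall>v\<in>V. (\<Sum>\<^sub>\<infinity>u\<in>V. A (u, v)) = m2 v)"

definition wasserstein ::
  "'a set \<Rightarrow> ('a \<Rightarrow> 'a \<Rightarrow> bool) \<Rightarrow> ('a \<Rightarrow> real) \<Rightarrow> ('a \<Rightarrow> real) \<Rightarrow> real" where
  "wasserstein V E m1 m2 =
     (INF A\<in>{A. is_coupling V m1 m2 A}. \<Sum>\<^sub>\<infinity>(u, v)\<in>V \<times> V. A (u, v) * real (gdist E u v))"

definition kappa ::
  "'a set \<Rightarrow> ('a \<Rightarrow> 'a \<Rightarrow> bool) \<Rightarrow> real \<Rightarrow> 'a \<Rightarrow> 'a \<Rightarrow> real" where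
  "kappa V E \<alpha> x y =
     1 - wasserstein V E (lazy_walk E \<alpha> x) (lazy_walk E \<alpha> y) / real (gdist E x y)"

definition kappa_LLY :: "'a set \<Rightarrow> ('a \<Rightarrow> 'a \<Rightarrow> bool) \<Rightarrow> 'a \<Rightarrow> 'a \<Rightarrow> real" where
  "kappa_LLY V E x y = Lim (at_left 1) (\<lambda>\<alpha>. kappa V E \<alpha> x y / (1 - \<alpha>))"

definition positively_LLY_curved :: "'a set \<Rightarrow> ('a \<Rightarrow> 'a \<Rightarrow> bool) \<Rightarrow> bool" where
  "positively_LLY_curved V E \<longleftrightarrow> (\<forall>x\<in>V. \<forall>y\<in>V. x \<noteq> y \<longrightarrow> kappa_LLY V E x y > 0)"

text \<open>
  Drawings live in the plane \<open>complex\<close>: \<open>p\<close> places the vertices, and \<open>g u v\<close> is the arc of the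
  edge \<open>uv\<close>, traversed from \<open>u\<close> to \<open>v\<close>. An arc contains no vertices besides its two ends, and two
  arcs of distinct edges meet at most in vertices.
\<close>

definition plane_drawing ::
  "'a set \<Rightarrow> ('a \<Rightarrow> 'a \<Rightarrow> bool) \<Rightarrow> ('a \<Rightarrow> complex) \<Rightarrow> ('a \<Rightarrow> 'a \<Rightarrow> real \<Rightarrow> complex) \<Rightarrow> bool" where
  "plane_drawing V E p g \<longleftrightarrow>
     inj_on p V \<and>
     (\<forall>u v. E u v \<longrightarrow>
        arc (g u v) \<and> pathstart (g u v) = p u \<and> pathfinish (g u v) = p v \<and>
        g v u = reversepath (g u v) \<and>
        path_image (g u v) \<inter> p ` V = {p u, p v}) \<and>
     (\<forall>u v w z. E u v \<longrightarrow> E w z \<longrightarrow> {u, v} \<noteq> {w, z} \<longrightarrow>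
        path_image (g u v) \<inter> path_image (g w z) \<subseteq> p ` V)"

definition drawing_image ::
  "'a set \<Rightarrow> ('a \<Rightarrow> 'a \<Rightarrow> bool) \<Rightarrow> ('a \<Rightarrow> complex) \<Rightarrow> ('a \<Rightarrow> 'a \<Rightarrow> real \<Rightarrow> complex) \<Rightarrow> complex set" where
  "drawing_image V E p g = p ` V \<union> (\<Union>(u, v)\<in>{(u, v). E u v}. path_image (g u v))"

text \<open>
  The faces of a drawing are the components of its complement. The drawing of a finite graph has
  exactly one unbounded face; for infinite graphs, any unbounded face may serve as the outer one.
\<close>

definition outerplanar :: "'a set \<Rightarrow> ('a \<Rightarrow> 'a \<Rightarrow> bool) \<Rightarrow> bool" where
  "outerplanar V E \<longleftrightarrow>
     (\<exists>p g. plane_drawing V E p g \<and>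
        (\<exists>F\<in>components (- drawing_image V E p g). \<not> bounded F \<and> p ` V \<subseteq> frontier F))"

end

theory Submission
  imports Defs "HOL-Complex_Analysis.Complex_Analysis"
begin

text \<open>
  Winding numbers show that an outerplanar drawing contains neither \<open>K\<^sub>4\<close> nor a theta graph all
  of whose arms have inner vertices, so a block is a cycle with non-crossing chords. A one-Lipschitz
  test function turns positive curvature of an edge \<open>xy\<close> into
  \<open>(2 + t) / d(x) + (2 + s) / d(y) > 2\<close>, where \<open>t\<close> counts the common neighbours and \<open>s\<close> is a
  sum over the neighbours of \<open>y\<close> that only depends on the graph within distance two of the edge.
  This inequality excludes inner faces of length at least five, next to a vertex of degree at least
  three, and degrees above nine. What remains is a finite search: the graph unfolds
  from a vertex of maximum degree into a tree of triangles, squares and blocks, partial trees bound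
  degrees from below and \<open>t\<close>, \<open>s\<close> in terms of them, and every branch that violates the inequality
  is cut. No branch survives beyond ten vertices. The fan over a path on nine vertices attains the
  bound; explicit transport plans certify its curvature.
\<close>

section \<open>Theta graphs in the plane\<close>

text \<open>The left side of the curvature inequality falls when a degree grows and rises with
  \<open>t\<close> and \<open>s\<close>. Lower bounds on degrees and upper bounds on
  \<open>t\<close> and \<open>s\<close>, which is all that a partly explored graph offers, therefore
  suffice to refute it. Outerplanarity keeps these bounds small: one side of an edge holds at most
  one common neighbour and adds at most 3 to \<open>s\<close>. The bound 9 on degrees stems from an
  edge with all of its block on one side: \<open>t\<close> is at most 1 and \<open>s\<close> at most
  3, and for end degrees 2 and \<open>d\<close> the condition 3/2 + 5/d > 2 forces d < 10. The
  vertex set may be infinite, so neither induction on its size nor edge counting is available.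
  Finiteness is an outcome of the search, because a fully determined tree describes a finite graph.
  The cycle of length five satisfies the inequality. Long inner faces can therefore be excluded only
  near a vertex of degree at least three, and graphs without such a vertex are treated on their
  own.\<close>

definition conn :: "('a \<Rightarrow> 'a \<Rightarrow> bool) \<Rightarrow> 'a set \<Rightarrow> bool" where
  "conn E D \<longleftrightarrow> D \<noteq> {} \<and> (\<forall>p\<in>D. \<forall>q\<in>D. (\<lambda>u v. u \<in> D \<and> v \<in> D \<and> E u v)\<^sup>*\<^sup>* p q)"

text \<open>The component of \<open>p\<close> in the subgraph induced on \<open>S\<close>. For
  \<open>p\<close> outside \<open>S\<close> it degenerates to \<open>{p}\<close>, hence the premise
  \<open>p \<in> S\<close> in the lemmas below.\<close>

definition gcomp :: "('a \<Rightarrow> 'a \<Rightarrow> bool) \<Rightarrow> 'a set \<Rightarrow> 'a \<Rightarrow> 'a set" where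
  "gcomp E S p = {q. (\<lambda>u v. u \<in> S \<and> v \<in> S \<and> E u v)\<^sup>*\<^sup>* p q}"

definition att :: "('a \<Rightarrow> 'a \<Rightarrow> bool) \<Rightarrow> 'a \<Rightarrow> 'a set \<Rightarrow> bool" where
  "att E c D \<longleftrightarrow> (\<exists>p\<in>D. E c p)"

lemma conn_singleton [simp]: "conn E {a}"
  by (simp add: conn_def)

lemma conn_nonempty: "conn E D \<Longrightarrow> D \<noteq> {}"
  by (simp add: conn_def)

lemma conn_reach: "conn E D \<Longrightarrow> p \<in> D \<Longrightarrow> q \<in> D \<Longrightarrow> (\<lambda>u v. u \<in> D \<and> v \<in> D \<and> E u v)\<^sup>*\<^sup>* p q"
  by (simp add: conn_def)

lemma reach_mono:
  assumes "(\<lambda>u v. u \<in> D \<and> v \<in> D \<and> E u v)\<^sup>*\<^sup>* p q" "D \<subseteq> D'"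
  shows "(\<lambda>u v. u \<in> D' \<and> v \<in> D' \<and> E u v)\<^sup>*\<^sup>* p q"
  using assms(1) by (rule rtranclp_mono[THEN predicate2D, rotated]) (use assms(2) in auto)

lemma reach_sym:
  assumes "symp E" "(\<lambda>u v. u \<in> D \<and> v \<in> D \<and> E u v)\<^sup>*\<^sup>* p q"
  shows "(\<lambda>u v. u \<in> D \<and> v \<in> D \<and> E u v)\<^sup>*\<^sup>* q p"
  using assms(2)
proof (induction rule: rtranclp_induct)
  case (step y z)
  then have "(\<lambda>u v. u \<in> D \<and> v \<in> D \<and> E u v) z y" using assms(1) by (auto dest: sympD)
  from converse_rtranclp_into_rtranclp[of "\<lambda>u v. u \<in> D \<and> v \<in> D \<and> E u v", OF this step.IH] show ?case .
qed simp

lemma conn_Un: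
  assumes sy: "symp E" and A: "conn E A" and B: "conn E B" and ab: "a \<in> A" "b \<in> B" "E a b"
  shows "conn E (A \<union> B)"
proof -
  let ?R = "\<lambda>u v. u \<in> A \<union> B \<and> v \<in> A \<union> B \<and> E u v"
  have toa: "?R\<^sup>*\<^sup>* a q" if "q \<in> A \<union> B" for q
  proof (cases "q \<in> A")
    case True
    then show ?thesis using reach_mono[OF conn_reach[OF A ab(1) True]] by blast
  next
    case False
    then have "?R\<^sup>*\<^sup>* b q" using that reach_mono[OF conn_reach[OF B ab(2)]] by blast
    moreover have "?R a b" using ab by auto
    ultimately show ?thesis using converse_rtranclp_into_rtranclp[of ?R a b q] by blast
  qed
  have "?R\<^sup>*\<^sup>* p q" if "p \<in> A \<union> B" "q \<in> A \<union> B" for p q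
    using reach_sym[OF sy toa[OF that(1)]] toa[OF that(2)] by (rule rtranclp_trans)
  then show ?thesis using conn_nonempty[OF A] unfolding conn_def by auto
qed

lemma conn_insert:
  assumes "symp E" "conn E A" "a \<in> A" "E a b"
  shows "conn E (insert b A)"
  using conn_Un[OF assms(1,2) conn_singleton, of a b] assms(3,4) by simp

lemma conn_pair: "symp E \<Longrightarrow> E a b \<Longrightarrow> conn E {a, b}"
  using conn_insert[of E "{a}" a b] by (simp add: insert_commute)

lemma gcomp_self: "p \<in> gcomp E S p"
  by (simp add: gcomp_def)

lemma gcomp_subset: "p \<in> S \<Longrightarrow> gcomp E S p \<subseteq> S"
proof
  fix q assume p: "p \<in> S" and "q \<in> gcomp E S p"
  then have "(\<lambda>u v. u \<in> S \<and> v \<in> S \<and> E u v)\<^sup>*\<^sup>* p q" by (simp add: gcomp_def)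
  then show "q \<in> S" using p by (induction rule: rtranclp_induct) auto
qed

lemma gcomp_closed: "p \<in> S \<Longrightarrow> q \<in> gcomp E S p \<Longrightarrow> r \<in> S \<Longrightarrow> E q r \<Longrightarrow> r \<in> gcomp E S p"
  using gcomp_subset[of p S E] unfolding gcomp_def
  by (auto intro: rtranclp.rtrancl_into_rtrancl)

lemma gcomp_reach_in:
  assumes "q \<in> gcomp E S p" "p \<in> S"
  shows "(\<lambda>u v. u \<in> gcomp E S p \<and> v \<in> gcomp E S p \<and> E u v)\<^sup>*\<^sup>* p q"
proof -
  have "(\<lambda>u v. u \<in> S \<and> v \<in> S \<and> E u v)\<^sup>*\<^sup>* p q" using assms by (simp add: gcomp_def)
  then show ?thesis
  proof (induction rule: rtranclp_induct)
    case (step y z)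
    have "y \<in> gcomp E S p" using step.hyps(1) by (simp add: gcomp_def)
    moreover from this have "z \<in> gcomp E S p" using gcomp_closed[OF assms(2)] step.hyps(2) by auto
    ultimately show ?case using step by (auto intro: rtranclp.rtrancl_into_rtrancl)
  qed simp
qed

lemma gcomp_conn:
  assumes "symp E" "p \<in> S" shows "conn E (gcomp E S p)"
  unfolding conn_def
proof (intro conjI ballI)
  show "gcomp E S p \<noteq> {}" using gcomp_self[of p E S] by blast
  fix a b assume ab: "a \<in> gcomp E S p" "b \<in> gcomp E S p"
  show "(\<lambda>u v. u \<in> gcomp E S p \<and> v \<in> gcomp E S p \<and> E u v)\<^sup>*\<^sup>* a b"
    using reach_sym[OF assms(1) gcomp_reach_in[OF ab(1) assms(2)]] gcomp_reach_in[OF ab(2) assms(2)]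
    by (rule rtranclp_trans)
qed

lemma gcomp_eq:
  assumes "symp E" "p \<in> S" "q \<in> gcomp E S p" shows "gcomp E S q = gcomp E S p"
proof -
  have "(\<lambda>u v. u \<in> S \<and> v \<in> S \<and> E u v)\<^sup>*\<^sup>* p q" using assms by (simp add: gcomp_def)
  then show ?thesis unfolding gcomp_def
    using reach_sym[OF assms(1)] by (auto intro: rtranclp_trans)
qed

lemma gcomp_disj:
  assumes "symp E" "p \<in> S" "q \<in> S" "gcomp E S p \<noteq> gcomp E S q"
  shows "gcomp E S p \<inter> gcomp E S q = {}"
  using gcomp_eq[OF assms(1,2)] gcomp_eq[OF assms(1,3)] assms(4) by blast

lemma conn_subset_gcomp:
  assumes "conn E A" "A \<subseteq> S" "p \<in> A" shows "A \<subseteq> gcomp E S p"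
  using reach_mono[OF conn_reach[OF assms(1,3)] assms(2)] by (auto simp: gcomp_def)

lemma conn_escape:
  assumes "conn E D" "p \<in> D" "p \<in> A" "\<not> D \<subseteq> A"
  shows "\<exists>a\<in>D \<inter> A. \<exists>b\<in>D - A. E a b"
proof (rule ccontr)
  assume *: "\<not> ?thesis"
  obtain q where q: "q \<in> D" "q \<notin> A" using assms(4) by auto
  have "(\<lambda>u v. u \<in> D \<and> v \<in> D \<and> E u v)\<^sup>*\<^sup>* p q" using conn_reach[OF assms(1,2) q(1)] .
  then have "q \<in> A" using assms(3) by (induction rule: rtranclp_induct) (use * in auto)
  with q show False by simp
qed

text \<open>A component of \<open>D - M\<close> without an edge to \<open>M\<close> would be cut off
  from \<open>M\<close>, against the connectedness of \<open>D\<close>.\<close>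

lemma gcomp_att:
  assumes "conn E D" "M \<subseteq> D" "M \<noteq> {}" "p \<in> D - M" "symp E"
  shows "\<exists>m\<in>M. att E m (gcomp E (D - M) p)"
proof -
  have "\<not> D \<subseteq> gcomp E (D - M) p" using gcomp_subset[OF assms(4), of E] assms(2,3) by auto
  with conn_escape[OF assms(1), of p "gcomp E (D - M) p"] gcomp_self[of p E "D - M"] assms(4)
  obtain a b where ab: "a \<in> gcomp E (D - M) p" "b \<in> D - gcomp E (D - M) p" "E a b" by auto
  then have "b \<in> M" using gcomp_closed[OF assms(4) ab(1)] by auto
  with ab show ?thesis using assms(5) by (auto simp: att_def dest: sympD)
qed

lemma rtranclp_list:
  assumes "R\<^sup>*\<^sup>* p q"
  shows "\<exists>xs. xs \<noteq> [] \<and> hd xs = p \<and> last xs = q \<and> successively R xs \<and> distinct xs"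
  using assms
proof (induction rule: rtranclp_induct)
  case base
  show ?case by (rule exI[of _ "[p]"]) auto
next
  case (step y z)
  then obtain xs where xs: "xs \<noteq> []" "hd xs = p" "last xs = y" "successively R xs" "distinct xs" by blast
  show ?case
  proof (cases "z \<in> set xs")
    \<comment> \<open>The walk returns to a vertex seen before; cutting it off at the first visit
      keeps it free of repetitions.\<close>
    case True
    then obtain ys zs where s: "xs = ys @ z # zs" by (meson split_list)
    show ?thesis
    proof (rule exI[of _ "ys @ [z]"], intro conjI)
      show "hd (ys @ [z]) = p" using xs(2) s by (cases ys) auto
      show "successively R (ys @ [z])" using xs(4) unfolding s
        by (auto simp: successively_append_iff)
    qed (use xs s in auto)
  next
    case False
    show ?thesis
      by (rule exI[of _ "xs @ [z]"]) (use xs step.hyps False in \<open>auto simp: successively_append_iff\<close>)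
  qed
qed

lemma conn_path:
  assumes "conn E D" "p \<in> D" "q \<in> D"
  obtains xs where "xs \<noteq> []" "hd xs = p" "last xs = q" "successively E xs" "distinct xs" "set xs \<subseteq> D"
proof -
  from rtranclp_list[OF conn_reach[OF assms]] obtain xs where xs: "xs \<noteq> []" "hd xs = p" "last xs = q"
    "successively (\<lambda>u v. u \<in> D \<and> v \<in> D \<and> E u v) xs" "distinct xs" by blast
  have "set xs \<subseteq> D" using xs(1,2,4) assms(2)
  proof (induction xs arbitrary: p)
    case (Cons a xs)
    then show ?case by (cases xs) auto
  qed simp
  moreover have "successively E xs" by (rule successively_mono[OF xs(4)]) auto
  ultimately show ?thesis using that xs by blast
qed

lemma conn_set_list:
  assumes "symp E" "successively E xs" "xs \<noteq> []" shows "conn E (set xs)"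
  using assms(2,3)
proof (induction xs)
  case (Cons a xs)
  show ?case
  proof (cases xs)
    case (Cons b ys)
    then have "conn E (set xs)" "E a b" using Cons.IH Cons.prems by auto
    then show ?thesis using conn_insert[OF assms(1), of "set xs" b a] Cons assms(1) by (auto dest: sympD)
  qed simp
qed simp

section \<open>Theta curves and the Jordan curve theorem\<close>

lemma connected_subset_inside:
  assumes "connected S" "S \<inter> K = {}" "z \<in> S" "z \<in> inside K"
  shows "S \<subseteq> inside K"
proof
  fix w assume "w \<in> S"
  then have "connected_component (- K) z w"
    using assms by (auto simp: connected_component_def)
  then show "w \<in> inside K" using assms(4) inside_same_component by blast
qed

definition theta_arc :: "complex \<Rightarrow> complex \<Rightarrow> (real \<Rightarrow> complex) \<Rightarrow> bool" where
  "theta_arc a b c \<longleftrightarrow> arc c \<and> pathstart c = a \<and> pathfinish c = b"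

lemma simple_loop_theta:
  assumes "theta_arc a b c1" "theta_arc a b c2" "path_image c1 \<inter> path_image c2 = {a, b}"
  shows "simple_path (c1 +++ reversepath c2)"
  using assms by (intro simple_path_join_loop) (auto simp: theta_arc_def arc_reversepath)

lemma path_image_loop:
  assumes "theta_arc a b c1" "theta_arc a b c2"
  shows "path_image (c1 +++ reversepath c2) = path_image c1 \<union> path_image c2"
  using assms by (simp add: theta_arc_def path_image_join)

lemma winding_loop:
  assumes "theta_arc a b c1" "theta_arc a b c2" "z \<notin> path_image c1" "z \<notin> path_image c2"
  shows "winding_number (c1 +++ reversepath c2) z = winding_number c1 z - winding_number c2 z"
  using assms by (simp add: theta_arc_def winding_number_join winding_number_reversepath arc_imp_path)

lemma theta_frontier:
  assumes "theta_arc a b c1" "theta_arc a b c2" "path_image c1 \<inter> path_image c2 = {a, b}"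
  shows "inside (path_image c1 \<union> path_image c2) \<noteq> {}"
    "connected (inside (path_image c1 \<union> path_image c2))"
    "frontier (inside (path_image c1 \<union> path_image c2)) = path_image c1 \<union> path_image c2"
  using Jordan_inside_outside[OF simple_loop_theta[OF assms]] path_image_loop[OF assms(1,2)] assms(1,2)
  by (auto simp: theta_arc_def)

text \<open>The inside of the loop \<open>c1\<close>, \<open>c2\<close> is connected, avoids the
  loop \<open>c2\<close>, \<open>c3\<close> and shares \<open>z\<close> with its inside, so it lies
  in there entirely. Its frontier contains \<open>c1\<close>, which is dragged along by taking
  closures.\<close>

lemma theta_nested:
  assumes 1: "theta_arc a b c1" and 2: "theta_arc a b c2" and 3: "theta_arc a b c3"
    and i12: "path_image c1 \<inter> path_image c2 = {a, b}"
    and i13: "path_image c1 \<inter> path_image c3 = {a, b}"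
    and i23: "path_image c2 \<inter> path_image c3 = {a, b}"
    and z: "z \<in> inside (path_image c1 \<union> path_image c2)" "z \<in> inside (path_image c2 \<union> path_image c3)"
    and no: "inside (path_image c1 \<union> path_image c2) \<inter> path_image c3 = {}"
  shows "path_image c1 - {a, b} \<subseteq> inside (path_image c2 \<union> path_image c3)"
proof -
  let ?I = "inside (path_image c1 \<union> path_image c2)" and ?K = "path_image c2 \<union> path_image c3"
  have cl: "closed ?K" using 2 3 by (auto simp: theta_arc_def closed_arc_image)
  have "?I \<inter> ?K = {}" using no inside_no_overlap[of "path_image c1 \<union> path_image c2"] by blast
  then have "?I \<subseteq> inside ?K"
    using connected_subset_inside theta_frontier(2)[OF 1 2 i12] z by blast
  then have "closure ?I \<subseteq> inside ?K \<union> ?K"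
    using closure_inside_subset[OF cl] closure_mono[of ?I "inside ?K"] by blast
  moreover have "path_image c1 \<subseteq> closure ?I"
    using theta_frontier(3)[OF 1 2 i12] by (auto simp: frontier_def)
  ultimately show ?thesis using i12 i13 by blast
qed

text \<open>
  The winding numbers of the three loops of a theta curve add up to zero, so no point lies inside
  exactly one of them.
\<close>

lemma theta_inside:
  assumes 1: "theta_arc a b c1" and 2: "theta_arc a b c2" and 3: "theta_arc a b c3"
    and i12: "path_image c1 \<inter> path_image c2 = {a, b}"
    and i13: "path_image c1 \<inter> path_image c3 = {a, b}"
    and i23: "path_image c2 \<inter> path_image c3 = {a, b}"
  shows "path_image c1 - {a, b} \<subseteq> inside (path_image c2 \<union> path_image c3) \<or>
    path_image c2 - {a, b} \<subseteq> inside (path_image c1 \<union> path_image c3) \<or>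
    path_image c3 - {a, b} \<subseteq> inside (path_image c1 \<union> path_image c2)"
proof (cases "inside (path_image c1 \<union> path_image c2) \<inter> path_image c3 = {}")
  case False
  then obtain z where z: "z \<in> inside (path_image c1 \<union> path_image c2)" "z \<in> path_image c3" by blast
  have "connected (path_image c3 - {a, b})"
    using 3 connected_simple_path_endless[of c3] by (simp add: theta_arc_def arc_imp_simple_path)
  moreover have "(path_image c3 - {a, b}) \<inter> (path_image c1 \<union> path_image c2) = {}"
    using i13 i23 by blast
  moreover have "z \<in> path_image c3 - {a, b}"
    using z inside_no_overlap[of "path_image c1 \<union> path_image c2"] i12 by blast
  ultimately show ?thesis using connected_subset_inside z(1) by blast
next
  case True
  obtain z where z: "z \<in> inside (path_image c1 \<union> path_image c2)"
    using theta_frontier(1)[OF 1 2 i12] by blast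
  then have n: "z \<notin> path_image c1" "z \<notin> path_image c2" "z \<notin> path_image c3"
    using True inside_no_overlap[of "path_image c1 \<union> path_image c2"] by blast+
  have out: "winding_number (c +++ reversepath d) z = 0"
    if "z \<notin> inside (path_image c \<union> path_image d)" "theta_arc a b c" "theta_arc a b d"
      "z \<notin> path_image c" "z \<notin> path_image d" for c d
  proof -
    have "z \<in> outside (path_image c \<union> path_image d)"
      using inside_Un_outside[of "path_image c \<union> path_image d"] that by blast
    then show ?thesis using path_image_loop[OF that(2,3)] that(2,3)
      by (intro winding_number_zero_in_outside) (auto simp: theta_arc_def arc_imp_path)
  qed
  have "winding_number (c1 +++ reversepath c2) z \<noteq> 0"
    using simple_closed_path_norm_winding_number_inside[OF simple_loop_theta[OF 1 2 i12], of z]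
      z path_image_loop[OF 1 2] by auto
  then have "winding_number (c2 +++ reversepath c3) z \<noteq> 0 \<or> winding_number (c1 +++ reversepath c3) z \<noteq> 0"
    using winding_loop[OF 1 2] winding_loop[OF 1 3] winding_loop[OF 2 3] n by auto
  then have "z \<in> inside (path_image c2 \<union> path_image c3) \<or> z \<in> inside (path_image c1 \<union> path_image c3)"
    using out[OF _ 2 3] out[OF _ 1 3] n by blast
  then show ?thesis
  proof
    assume "z \<in> inside (path_image c2 \<union> path_image c3)"
    then show ?thesis using theta_nested[OF 1 2 3 i12 i13 i23 z _ True] by blast
  next
    assume "z \<in> inside (path_image c1 \<union> path_image c3)"
    then show ?thesis using theta_nested[OF 2 1 3 _ i23 i13, of z] i12 z True
      by (auto simp: Un_commute Int_commute)
  qed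
qed

section \<open>Paths of an outerplanar drawing as arcs\<close>

definition pim :: "('a \<Rightarrow> 'a \<Rightarrow> real \<Rightarrow> complex) \<Rightarrow> 'a list \<Rightarrow> complex set" where
  "pim g xs = (\<Union>(u, v)\<in>set (zip xs (tl xs)). path_image (g u v))"

lemma successively_zip: "successively P xs \<Longrightarrow> (u, v) \<in> set (zip xs (tl xs)) \<Longrightarrow> P u v"
  by (induction xs rule: induct_list012) auto

lemma zip_tl_mem: "(u, v) \<in> set (zip xs (tl xs)) \<Longrightarrow> u \<in> set xs \<and> v \<in> set xs"
  by (induction xs rule: induct_list012) auto

text \<open>Two paths with the same ends and no other common vertex can share an edge only if that
  edge joins the ends. This lemma says that such a path is the single edge.\<close>

lemma edge_between_ends:
  assumes "(u, v) \<in> set (zip xs (tl xs))" "distinct xs" "xs \<noteq> []" "{u, v} = {hd xs, last xs}"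
  shows "length xs = 2"
proof -
  have "\<exists>i. Suc i < length xs \<and> u = xs ! i \<and> v = xs ! Suc i"
  proof -
    obtain i where "i < length (tl xs)" "u = xs ! i" "v = tl xs ! i"
      using assms(1) by (auto simp: set_zip)
    then show ?thesis by (intro exI[of _ i]) (auto simp: nth_tl)
  qed
  then obtain i where i: "Suc i < length xs" "u = xs ! i" "v = xs ! Suc i" by blast
  have e: "hd xs = xs ! 0" "last xs = xs ! (length xs - 1)"
    using assms(3) by (auto simp: hd_conv_nth last_conv_nth)
  have "u \<noteq> v" using i assms(2) by (auto simp: nth_eq_iff_index_eq)
  with assms(4) e have "(u = xs ! 0 \<and> v = xs ! (length xs - 1)) \<or> (v = xs ! 0 \<and> u = xs ! (length xs - 1))"
    by (auto simp: doubleton_eq_iff)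
  then show ?thesis
  proof
    assume "u = xs ! 0 \<and> v = xs ! (length xs - 1)"
    then have "i = 0" "Suc i = length xs - 1"
      using i assms(2) nth_eq_iff_index_eq[of xs i 0] nth_eq_iff_index_eq[of xs "Suc i" "length xs - 1"] assms(3) by auto
    then show ?thesis by simp
  next
    assume "v = xs ! 0 \<and> u = xs ! (length xs - 1)"
    then have "Suc i = 0" using i assms(2) nth_eq_iff_index_eq[of xs "Suc i" 0] assms(3) by auto
    then show ?thesis by simp
  qed
qed

locale drawing =
  fixes V :: "'a set" and E and p :: "'a \<Rightarrow> complex" and g F
  assumes sg: "simple_graph V E" and pd: "plane_drawing V E p g"
    and F: "F \<in> components (- drawing_image V E p g)" "\<not> bounded F" "p ` V \<subseteq> frontier F"
begin

lemma E_V: "E u v \<Longrightarrow> u \<in> V \<and> v \<in> V" using sg by (auto simp: simple_graph_def)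
lemma E_ne: "E u v \<Longrightarrow> u \<noteq> v" using sg by (auto simp: simple_graph_def irreflp_def)
lemma p_eq: "u \<in> V \<Longrightarrow> v \<in> V \<Longrightarrow> p u = p v \<longleftrightarrow> u = v"
  using pd by (auto simp: plane_drawing_def inj_on_def)

lemma edge_arc: "E u v \<Longrightarrow> theta_arc (p u) (p v) (g u v)"
  using pd by (auto simp: plane_drawing_def theta_arc_def)

lemma edge_V: "E u v \<Longrightarrow> path_image (g u v) \<inter> p ` V = {p u, p v}"
  using pd by (auto simp: plane_drawing_def)

lemma edge_cross: "E u v \<Longrightarrow> E w z \<Longrightarrow> {u, v} \<noteq> {w, z} \<Longrightarrow> path_image (g u v) \<inter> path_image (g w z) \<subseteq> p ` V"
  using pd by (simp add: plane_drawing_def)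

lemma path_V: "successively E xs \<Longrightarrow> 2 \<le> length xs \<Longrightarrow> set xs \<subseteq> V"
proof (induction xs rule: induct_list012)
  case (3 x y zs)
  then show ?case using E_V[of x y] by (cases zs) auto
qed auto

lemma pim_subset: "successively E xs \<Longrightarrow> pim g xs \<subseteq> drawing_image V E p g"
  by (auto simp: pim_def drawing_image_def dest!: successively_zip[of E])

lemma pim_V: "successively E xs \<Longrightarrow> pim g xs \<inter> p ` V \<subseteq> p ` set xs"
  using edge_V by (fastforce simp: pim_def dest: successively_zip zip_tl_mem)

lemma pim_cross:
  assumes "successively E xs" "successively E ys" "set xs \<subseteq> V" "set ys \<subseteq> V"
    "\<And>u v w z. (u, v) \<in> set (zip xs (tl xs)) \<Longrightarrow> (w, z) \<in> set (zip ys (tl ys)) \<Longrightarrow> {u, v} \<noteq> {w, z}"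
  shows "pim g xs \<inter> pim g ys \<subseteq> p ` (set xs \<inter> set ys)"
proof
  fix q assume q: "q \<in> pim g xs \<inter> pim g ys"
  then obtain u v w z where uv: "(u, v) \<in> set (zip xs (tl xs))" "q \<in> path_image (g u v)"
    "(w, z) \<in> set (zip ys (tl ys))" "q \<in> path_image (g w z)" by (auto simp: pim_def)
  then have "q \<in> p ` V"
    using edge_cross[of u v w z] successively_zip[OF assms(1)] successively_zip[OF assms(2)] assms(5) by blast
  then have "q \<in> p ` set xs" "q \<in> p ` set ys" using q pim_V assms(1,2) by blast+
  then show "q \<in> p ` (set xs \<inter> set ys)" using assms(3,4) p_eq by (auto simp: image_iff) (metis IntI subsetD)
qed

lemma path_arc:
  assumes "successively E xs" "distinct xs" "2 \<le> length xs"
  shows "\<exists>c. theta_arc (p (hd xs)) (p (last xs)) c \<and> path_image c = pim g xs"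
  using assms
proof (induction xs rule: induct_list012)
  case (3 x y zs)
  show ?case
  proof (cases zs)
    case Nil
    then show ?thesis using 3 edge_arc[of x y] by (auto simp: pim_def)
  next
    case (Cons z zs')
    with 3 obtain c where c: "theta_arc (p y) (p (last (y # zs))) c" "path_image c = pim g (y # zs)" by auto
    have e: "E x y" "theta_arc (p x) (p y) (g x y)" using 3 edge_arc by auto
    have V: "set (x # y # zs) \<subseteq> V" using path_V[OF "3.prems"(1,3)] .
    have "pim g [x, y] \<inter> pim g (y # zs) \<subseteq> p ` (set [x, y] \<inter> set (y # zs))"
    proof (rule pim_cross)
      fix u v w z assume "(u, v) \<in> set (zip [x, y] (tl [x, y]))" "(w, z) \<in> set (zip (y # zs) (tl (y # zs)))"
      then show "{u, v} \<noteq> {w, z}" using "3.prems"(2) zip_tl_mem[of w z "y # zs"] by auto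
    qed (use 3 V in auto)
    also have "\<dots> = {p y}" using "3.prems"(2) by auto
    finally have "path_image (g x y) \<inter> path_image c \<subseteq> {p y}" using c(2) by (simp add: pim_def)
    then have "theta_arc (p x) (p (last (y # zs))) (g x y +++ c)"
      using c e by (auto simp: theta_arc_def intro!: arc_join)
    moreover have "path_image (g x y +++ c) = pim g (x # y # zs)"
      using c e by (auto simp: theta_arc_def path_image_join pim_def)
    ultimately show ?thesis by (auto intro!: exI[of _ "g x y +++ c"])
  qed
qed auto

lemma pim_vertex:
  assumes "successively E xs" "2 \<le> length xs" "v \<in> set xs" shows "p v \<in> pim g xs"
  using assms
proof (induction xs rule: induct_list012)
  case (3 x y zs)
  have e: "p x \<in> path_image (g x y)" "p y \<in> path_image (g x y)"
    using edge_V[of x y] "3.prems" by auto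
  show ?case
  proof (cases "v = x \<or> v = y")
    case True
    then show ?thesis using e by (auto simp: pim_def)
  next
    case False
    then have "p v \<in> pim g (y # zs)" using 3 by (cases zs) auto
    then show ?thesis by (auto simp: pim_def)
  qed
qed auto

text \<open>The outer face is connected, unbounded and disjoint from the drawing, so it cannot enter
  the bounded set \<open>inside K\<close>; that set is open, so the frontier stays out as well. All
  vertices lie on this frontier, hence no vertex is enclosed by any closed curve of the
  drawing.\<close>

lemma F_outside:
  assumes "K \<subseteq> drawing_image V E p g" "compact K" shows "frontier F \<inter> inside K = {}"
proof -
  have "F \<inter> inside K = {}"
  proof (rule ccontr)
    assume "F \<inter> inside K \<noteq> {}"
    then obtain z where "z \<in> F" "z \<in> inside K" by blast
    moreover have "connected F" "F \<inter> K = {}" using F(1) assms(1) in_components_connected in_components_subset by blast+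
    ultimately have "F \<subseteq> inside K" using connected_subset_inside by blast
    then show False using F(2) bounded_inside[OF compact_imp_bounded[OF assms(2)]] bounded_subset by blast
  qed
  moreover have "open (inside K)" using assms(2) by (simp add: compact_imp_closed open_inside)
  ultimately show ?thesis using open_Int_closure_eq_empty by (auto simp: frontier_def)
qed

text \<open>One arm of a theta curve runs inside the loop of the other two. An arm with an inner
  vertex cannot, by \<open>F_outside\<close>, and length different from 2 means that there is one.
  So the enclosed arm is \<open>xs1\<close>, and it is a single edge.\<close>

lemma theta_paths:
  assumes ab: "a \<noteq> b" and E: "\<And>xs. xs \<in> {xs1, xs2, xs3} \<Longrightarrow> successively E xs \<and> distinct xs \<and> xs \<noteq> [] \<and> hd xs = a \<and> last xs = b"
    and d: "set xs1 \<inter> set xs2 = {a, b}" "set xs1 \<inter> set xs3 = {a, b}" "set xs2 \<inter> set xs3 = {a, b}"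
    and l: "length xs2 \<noteq> 2" "length xs3 \<noteq> 2"
  shows "length xs1 = 2" "pim g xs1 - {p a, p b} \<subseteq> inside (pim g xs2 \<union> pim g xs3)"
    "pim g xs1 \<inter> pim g xs2 = {p a, p b}" "pim g xs1 \<inter> pim g xs3 = {p a, p b}" "pim g xs2 \<inter> pim g xs3 = {p a, p b}"
proof -
  have len: "2 \<le> length xs" if "xs \<in> {xs1, xs2, xs3}" for xs
    using E[OF that] ab by (cases xs; cases "tl xs") auto
  have V: "set xs \<subseteq> V" if "xs \<in> {xs1, xs2, xs3}" for xs
    using path_V E[OF that] len[OF that] by blast
  have abm: "a \<in> set xs" "b \<in> set xs" if "xs \<in> {xs1, xs2, xs3}" for xs using E[OF that] by auto
  have cr: "pim g xs \<inter> pim g ys = {p a, p b}"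
    if x: "xs \<in> {xs1, xs2, xs3}" and y: "ys \<in> {xs1, xs2, xs3}" and i: "set xs \<inter> set ys = {a, b}" and ly: "length ys \<noteq> 2" for xs ys
  proof
    show "pim g xs \<inter> pim g ys \<subseteq> {p a, p b}"
    proof -
      have "pim g xs \<inter> pim g ys \<subseteq> p ` (set xs \<inter> set ys)"
      proof (rule pim_cross)
        fix u v w z assume uv: "(u, v) \<in> set (zip xs (tl xs))" "(w, z) \<in> set (zip ys (tl ys))"
        \<comment> \<open>A common edge has both ends in \<open>{a, b}\<close>, so it joins the ends
          of \<open>ys\<close>, which then has length 2.\<close>
        show "{u, v} \<noteq> {w, z}"
        proof
          assume eq: "{u, v} = {w, z}"
          then have "{w, z} \<subseteq> {a, b}" using zip_tl_mem[OF uv(1)] zip_tl_mem[OF uv(2)] i by auto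
          moreover have "w \<noteq> z" using successively_zip[OF _ uv(2)] E[OF y] E_ne by blast
          ultimately have "{w, z} = {hd ys, last ys}" using E[OF y] by auto
          then show False using edge_between_ends[OF uv(2)] E[OF y] ly by blast
        qed
      qed (use E x y V in auto)
      then show ?thesis using i by auto
    qed
    show "{p a, p b} \<subseteq> pim g xs \<inter> pim g ys"
      using pim_vertex[of xs] pim_vertex[of ys] E[OF x] E[OF y] len[OF x] len[OF y] abm[OF x] abm[OF y] by auto
  qed
  show i12: "pim g xs1 \<inter> pim g xs2 = {p a, p b}" by (rule cr) (use d l in auto)
  show i13: "pim g xs1 \<inter> pim g xs3 = {p a, p b}" by (rule cr) (use d l in auto)
  show i23: "pim g xs2 \<inter> pim g xs3 = {p a, p b}" by (rule cr) (use d l in auto)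
  have arc: "\<exists>c. theta_arc (p a) (p b) c \<and> path_image c = pim g xs" if "xs \<in> {xs1, xs2, xs3}" for xs
    using path_arc[of xs] E[OF that] len[OF that] by auto
  obtain c1 c2 c3 where c: "theta_arc (p a) (p b) c1" "path_image c1 = pim g xs1"
    "theta_arc (p a) (p b) c2" "path_image c2 = pim g xs2"
    "theta_arc (p a) (p b) c3" "path_image c3 = pim g xs3"
    using arc[of xs1] arc[of xs2] arc[of xs3] by auto
  have cm: "compact (path_image c)" if "theta_arc x y c" for x y c
    using that by (simp add: theta_arc_def compact_path_image arc_imp_path)
  \<comment> \<open>An enclosed arm of length other than 2 would put one of its inner vertices
    inside a loop of the drawing.\<close>
  have bad: False if x: "xs \<in> {xs1, xs2, xs3}" and ly: "length xs \<noteq> 2"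
    and K: "pim g xs - {p a, p b} \<subseteq> inside (path_image d \<union> path_image e)" "path_image d \<union> path_image e \<subseteq> drawing_image V E p g"
      "theta_arc (p a) (p b) d" "theta_arc (p a) (p b) e" for xs d e
  proof -
    obtain v where v: "v \<in> set xs" "v \<noteq> a" "v \<noteq> b"
    proof (rule ccontr)
      assume *: "\<not> thesis"
      then have "set xs \<subseteq> {a, b}" using that by blast
      then have "card (set xs) \<le> 2" using card_mono[of "{a, b}" "set xs"] by (simp add: card_insert_if split: if_splits)
      then show False using len[OF x] ly E[OF x] distinct_card[of xs] by auto
    qed
    then have "p v \<in> pim g xs - {p a, p b}" using pim_vertex[of xs v] E[OF x] len[OF x] V[OF x] abm[OF x] p_eq by auto
    then have "p v \<in> inside (path_image d \<union> path_image e)" using K(1) by blast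
    moreover have "p v \<in> frontier F" using F(3) V[OF x] v by blast
    ultimately show False using F_outside[OF K(2)] cm[OF K(3)] cm[OF K(4)] by blast
  qed
  have sub: "pim g xs \<subseteq> drawing_image V E p g" if "xs \<in> {xs1, xs2, xs3}" for xs using pim_subset E[OF that] by blast
  have "path_image c1 - {p a, p b} \<subseteq> inside (path_image c2 \<union> path_image c3) \<or>
    path_image c2 - {p a, p b} \<subseteq> inside (path_image c1 \<union> path_image c3) \<or>
    path_image c3 - {p a, p b} \<subseteq> inside (path_image c1 \<union> path_image c2)"
    by (rule theta_inside) (use c i12 i13 i23 in auto)
  then have ins: "path_image c1 - {p a, p b} \<subseteq> inside (path_image c2 \<union> path_image c3)"
    using bad[of xs2 c1 c3] bad[of xs3 c1 c2] c l sub[of xs1] sub[of xs2] sub[of xs3] by auto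
  then show "pim g xs1 - {p a, p b} \<subseteq> inside (pim g xs2 \<union> pim g xs3)" using c by simp
  show "length xs1 = 2" using ins bad[of xs1 c2 c3] c sub[of xs2] sub[of xs3] by auto
qed

lemma attached_path:
  assumes "conn E D" "att E a D" "att E b D" "a \<notin> D" "b \<notin> D" "a \<noteq> b"
  obtains xs where "successively E xs" "distinct xs" "xs \<noteq> []" "hd xs = a" "last xs = b" "length xs \<noteq> 2"
    "set xs \<subseteq> insert a (insert b D)" "a \<in> set xs" "b \<in> set xs"
proof -
  obtain q r where qr: "q \<in> D" "E a q" "r \<in> D" "E b r" using assms by (auto simp: att_def)
  obtain xs where xs: "xs \<noteq> []" "hd xs = q" "last xs = r" "successively E xs" "distinct xs" "set xs \<subseteq> D"
    using conn_path[OF assms(1) qr(1,3)] .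
  have "E r b" using qr(4) sg by (auto simp: simple_graph_def dest: sympD)
  then show ?thesis using xs qr assms
    by (intro that[of "a # xs @ [b]"]) (auto simp: successively_Cons successively_append_iff)
qed

text \<open>Contracting the three sets would give a \<open>K\<^sub>2\<^sub>,\<^sub>3\<close>. Each
  set supplies an arm from \<open>a\<close> to \<open>b\<close> with an inner vertex.\<close>

lemma no_theta:
  assumes "a \<noteq> b" "conn E D1" "conn E D2" "conn E D3"
    "D1 \<inter> D2 = {}" "D1 \<inter> D3 = {}" "D2 \<inter> D3 = {}"
    "att E a D1" "att E a D2" "att E a D3" "att E b D1" "att E b D2" "att E b D3"
    "a \<notin> D1 \<union> D2 \<union> D3" "b \<notin> D1 \<union> D2 \<union> D3"
  shows False
proof -
  from attached_path[OF assms(2,8,11)] assms(1,14,15) obtain xs1 where 1: "successively E xs1" "distinct xs1" "xs1 \<noteq> []"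
    "hd xs1 = a" "last xs1 = b" "length xs1 \<noteq> 2" "set xs1 \<subseteq> insert a (insert b D1)" "a \<in> set xs1" "b \<in> set xs1" by auto
  from attached_path[OF assms(3,9,12)] assms(1,14,15) obtain xs2 where 2: "successively E xs2" "distinct xs2" "xs2 \<noteq> []"
    "hd xs2 = a" "last xs2 = b" "length xs2 \<noteq> 2" "set xs2 \<subseteq> insert a (insert b D2)" "a \<in> set xs2" "b \<in> set xs2" by auto
  from attached_path[OF assms(4,10,13)] assms(1,14,15) obtain xs3 where 3: "successively E xs3" "distinct xs3" "xs3 \<noteq> []"
    "hd xs3 = a" "last xs3 = b" "length xs3 \<noteq> 2" "set xs3 \<subseteq> insert a (insert b D3)" "a \<in> set xs3" "b \<in> set xs3" by auto
  have "length xs1 = 2"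
    by (rule theta_paths(1)[of a b xs1 xs2 xs3]) (use assms(1,5,6,7,14,15) 1 2 3 in auto)
  with 1 show False by simp
qed

text \<open>By \<open>theta_paths\<close>, both \<open>ab\<close> and \<open>cd\<close> run inside
  the cycle \<open>a c b d\<close>. The arc of \<open>ab\<close> cuts this inside into two halves,
  and the arc of \<open>cd\<close>, being disjoint from it, stays in one half. But the closure of
  that half would contain both \<open>c\<close> and \<open>d\<close>, while one of them is neither
  on its boundary nor enclosed by it.\<close>

lemma no_K4:
  assumes "E a b" "E a c" "E a d" "E b c" "E b d" "E c d"
  shows False
proof -
  have s: "E v u" if "E u v" for u v using that sg by (auto simp: simple_graph_def dest: sympD)
  have ne: "a \<noteq> b" "a \<noteq> c" "a \<noteq> d" "b \<noteq> c" "b \<noteq> d" "c \<noteq> d" using assms E_ne by blast+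
  have Vd: "a \<in> V" "b \<in> V" "c \<in> V" "d \<in> V" using assms E_V by blast+
  let ?P = "pim g [a, b]" and ?Q = "pim g [a, c, b]" and ?R = "pim g [a, d, b]" and ?S = "pim g [c, d]"
  have E1: "xs \<in> {[a, b], [a, c, b], [a, d, b]} \<Longrightarrow> successively E xs \<and> distinct xs \<and> xs \<noteq> [] \<and> hd xs = a \<and> last xs = b" for xs
    using assms ne s by auto
  have E2: "xs \<in> {[c, d], [c, a, d], [c, b, d]} \<Longrightarrow> successively E xs \<and> distinct xs \<and> xs \<noteq> [] \<and> hd xs = c \<and> last xs = d" for xs
    using assms ne s by auto
  note t1 = theta_paths[of a b "[a, b]" "[a, c, b]" "[a, d, b]", OF ne(1) E1]
  have p1: "?P - {p a, p b} \<subseteq> inside (?Q \<union> ?R)" "?P \<inter> ?Q = {p a, p b}" "?P \<inter> ?R = {p a, p b}" "?Q \<inter> ?R = {p a, p b}"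
    by (rule t1; use ne in auto)+
  note t2 = theta_paths[of c d "[c, d]" "[c, a, d]" "[c, b, d]", OF ne(6) E2]
  have p2: "?S - {p c, p d} \<subseteq> inside (pim g [c, a, d] \<union> pim g [c, b, d])" by (rule t2; use ne in auto)
  have rev: "path_image (g v u) = path_image (g u v)" if "E u v" for u v
    using pd that by (metis path_image_reversepath plane_drawing_def)
  have "path_image (g c a) = path_image (g a c)" "path_image (g d b) = path_image (g b d)" using rev assms by blast+
  then have "pim g [c, a, d] \<union> pim g [c, b, d] = ?Q \<union> ?R"
    using rev[OF assms(4)] by (auto simp: pim_def)
  with p2 have S: "?S - {p c, p d} \<subseteq> inside (?Q \<union> ?R)" by simp
  obtain cP where cP: "theta_arc (p a) (p b) cP" "path_image cP = ?P" using path_arc[of "[a, b]"] E1[of "[a, b]"] by auto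
  obtain cQ where cQ: "theta_arc (p a) (p b) cQ" "path_image cQ = ?Q" using path_arc[of "[a, c, b]"] E1[of "[a, c, b]"] by auto
  obtain cR where cR: "theta_arc (p a) (p b) cR" "path_image cR = ?R" using path_arc[of "[a, d, b]"] E1[of "[a, d, b]"] by auto
  obtain cS where cS: "theta_arc (p c) (p d) cS" "path_image cS = ?S" using path_arc[of "[c, d]"] E2[of "[c, d]"] by auto
  have pab: "p a \<noteq> p b" using p_eq Vd ne by auto
  have ps: "simple_path cP" "simple_path cQ" "simple_path cR" using cP cQ cR by (auto simp: theta_arc_def arc_imp_simple_path)
  have neP: "?P - {p a, p b} \<noteq> {}" using nonempty_simple_path_endless[OF ps(1)] cP by (auto simp: theta_arc_def)
  \<comment> \<open>The two halves of the inside, cut along the edge \<open>ab\<close>.\<close>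
  have sp: "inside (?Q \<union> ?P) \<union> inside (?R \<union> ?P) \<union> (?P - {p a, p b}) = inside (?Q \<union> ?R)"
  proof (rule split_inside_simple_closed_curve[of cQ "p a" "p b" cR cP])
    show "path_image cP \<inter> inside (path_image cQ \<union> path_image cR) \<noteq> {}" using neP p1(1) cP cQ cR by auto
    assume "inside (path_image cQ \<union> path_image cP) \<union> inside (path_image cR \<union> path_image cP) \<union>
           (path_image cP - {p a, p b}) = inside (path_image cQ \<union> path_image cR)"
    then show ?thesis using cP cQ cR by simp
  qed (use ps cP cQ cR pab p1 in \<open>auto simp: theta_arc_def\<close>)
  have PS: "?P \<inter> ?S = {}"
  proof -
    have "?P \<inter> ?S \<subseteq> p ` (set [a, b] \<inter> set [c, d])"
      by (rule pim_cross) (use assms Vd ne in \<open>auto simp: doubleton_eq_iff\<close>)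
    then show ?thesis using ne by auto
  qed
  have con: "connected (?S - {p c, p d})"
    using connected_simple_path_endless[of cS] cS by (simp add: theta_arc_def arc_imp_simple_path)
  have neS: "?S - {p c, p d} \<noteq> {}"
    using nonempty_simple_path_endless[of cS] cS by (auto simp: theta_arc_def arc_imp_simple_path)
  \<comment> \<open>The open arc of \<open>cd\<close> accumulates at both of its ends, so a closed
    set that contains the open arc contains \<open>p c\<close> and \<open>p d\<close>.\<close>
  have clS: "{p c, p d} \<subseteq> closure (?S - {p c, p d})"
  proof -
    have "cS 0 = p c" "cS 1 = p d" using cS by (auto simp: theta_arc_def pathstart_def pathfinish_def)
    have op: "?S - {p c, p d} = cS ` {0<..<1}"
      using simple_path_endless[of cS] cS by (auto simp: theta_arc_def arc_imp_simple_path)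
    have co: "continuous_on {0..1} cS" using cS by (auto simp: theta_arc_def arc_def path_def)
    have "cS ` closure {0<..<1} \<subseteq> closure (cS ` {0<..<1})"
      by (rule image_closure_subset) (use co closure_subset[of "cS ` {0<..<1}"] in auto)
    then have "cS ` {0..1} \<subseteq> closure (cS ` {0<..<1})" by simp
    moreover have "p c \<in> cS ` {0..1}" "p d \<in> cS ` {0..1}" using \<open>cS 0 = p c\<close> \<open>cS 1 = p d\<close> imageI[of 0 "{0..1}" cS] imageI[of 1 "{0..1}" cS] by auto
    ultimately show ?thesis using op by auto
  qed
  have cmp: "compact ?P" "compact ?Q" "compact ?R"
    using compact_arc_image[of cP] compact_arc_image[of cQ] compact_arc_image[of cR] cP cQ cR
    unfolding theta_arc_def by metis+
  then have cl: "closed (?Q \<union> ?P)" "closed (?R \<union> ?P)" by (blast intro: compact_imp_closed compact_Un)+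
  have Sdis: "(?S - {p c, p d}) \<inter> (?Q \<union> ?R \<union> ?P) = {}"
    using S inside_no_overlap[of "?Q \<union> ?R"] PS by blast
  have d1: "(?S - {p c, p d}) \<inter> (?Q \<union> ?P) = {}" and d2: "(?S - {p c, p d}) \<inter> (?R \<union> ?P) = {}"
    using Sdis by blast+
  obtain z where z: "z \<in> ?S - {p c, p d}" using neS by blast
  then have "z \<in> inside (?Q \<union> ?P) \<or> z \<in> inside (?R \<union> ?P)" using S sp PS by blast
  then have "?S - {p c, p d} \<subseteq> inside (?Q \<union> ?P) \<or> ?S - {p c, p d} \<subseteq> inside (?R \<union> ?P)"
    using connected_subset_inside[OF con d1 z] connected_subset_inside[OF con d2 z] by (elim disjE) simp_all
  moreover have no: "p v \<notin> inside K" if "v \<in> V" "K \<subseteq> drawing_image V E p g" "compact K" for v K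
    using F_outside[OF that(2,3)] F(3) that(1) by blast
  have sub: "?P \<subseteq> drawing_image V E p g" "?Q \<subseteq> drawing_image V E p g" "?R \<subseteq> drawing_image V E p g"
    using pim_subset E1[of "[a, b]"] E1[of "[a, c, b]"] E1[of "[a, d, b]"] by auto
  have pd': "p d \<notin> ?Q \<union> ?P" "p c \<notin> ?R \<union> ?P"
  proof -
    have nv: "p v \<notin> pim g xs" if "v \<in> V" "v \<notin> set xs" "set xs \<subseteq> V" "successively E xs" for v xs
    proof
      assume "p v \<in> pim g xs"
      then have "p v \<in> p ` set xs" using pim_V[OF that(4)] that(1) by blast
      then obtain w where "w \<in> set xs" "p v = p w" by blast
      then show False using p_eq[of v w] that by auto
    qed
    have "p d \<notin> ?Q" "p d \<notin> ?P" "p c \<notin> ?R" "p c \<notin> ?P"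
      by (rule nv; use Vd ne E1[of "[a, b]"] E1[of "[a, c, b]"] E1[of "[a, d, b]"] in simp)+
    then show "p d \<notin> ?Q \<union> ?P" "p c \<notin> ?R \<union> ?P" by auto
  qed
  ultimately show False
  proof (elim disjE)
    assume "?S - {p c, p d} \<subseteq> inside (?Q \<union> ?P)"
    then have "closure (?S - {p c, p d}) \<subseteq> inside (?Q \<union> ?P) \<union> (?Q \<union> ?P)"
      using closure_mono[of "?S - {p c, p d}" "inside (?Q \<union> ?P)"] closure_inside_subset[OF cl(1)] by auto
    then have "p d \<in> inside (?Q \<union> ?P) \<union> (?Q \<union> ?P)" using clS by blast
    moreover have "p d \<notin> inside (?Q \<union> ?P)" by (rule no) (use Vd sub cmp in \<open>auto intro: compact_Un\<close>)
    ultimately show False using pd' by blast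
  next
    assume "?S - {p c, p d} \<subseteq> inside (?R \<union> ?P)"
    then have "closure (?S - {p c, p d}) \<subseteq> inside (?R \<union> ?P) \<union> (?R \<union> ?P)"
      using closure_mono[of "?S - {p c, p d}" "inside (?R \<union> ?P)"] closure_inside_subset[OF cl(2)] by auto
    then have "p c \<in> inside (?R \<union> ?P) \<union> (?R \<union> ?P)" using clS by blast
    moreover have "p c \<notin> inside (?R \<union> ?P)" by (rule no) (use Vd sub cmp in \<open>auto intro: compact_Un\<close>)
    ultimately show False using pd' by blast
  qed
qed

end

section \<open>The curvature law\<close>

definition lip :: "'a set \<Rightarrow> ('a \<Rightarrow> 'a \<Rightarrow> bool) \<Rightarrow> ('a \<Rightarrow> real) \<Rightarrow> bool" where
  "lip V E f \<longleftrightarrow> (\<forall>u\<in>V. \<forall>v\<in>V. f u - f v \<le> real (gdist E u v))"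

definition nbavg :: "('a \<Rightarrow> 'a \<Rightarrow> bool) \<Rightarrow> ('a \<Rightarrow> real) \<Rightarrow> 'a \<Rightarrow> real" where
  "nbavg E f x = (\<Sum>v\<in>nbhd E x. f v) / real (deg E x)"

definition cost :: "'a set \<Rightarrow> ('a \<Rightarrow> 'a \<Rightarrow> bool) \<Rightarrow> ('a \<times> 'a \<Rightarrow> real) \<Rightarrow> real" where
  "cost V E A = (\<Sum>\<^sub>\<infinity>(u, v)\<in>V \<times> V. A (u, v) * real (gdist E u v))"

lemma infsum_finite_support:
  fixes f :: "'b \<Rightarrow> real"
  assumes "T \<subseteq> S" "finite T" "\<And>x. x \<in> S - T \<Longrightarrow> f x = 0"
  shows "infsum f S = sum f T"
proof -
  have "infsum f S = infsum f T" by (rule infsum_cong_neutral) (use assms in auto)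
  then show ?thesis using assms(2) by simp
qed

lemma cost_finite:
  assumes T: "T \<subseteq> V" "finite T" and z: "\<And>u v. u \<in> V \<Longrightarrow> v \<in> V \<Longrightarrow> u \<notin> T \<or> v \<notin> T \<Longrightarrow> A (u, v) = 0"
  shows "cost V E A = (\<Sum>u\<in>T. \<Sum>v\<in>T. A (u, v) * real (gdist E u v))"
proof -
  have "cost V E A = sum (\<lambda>(u, v). A (u, v) * real (gdist E u v)) (T \<times> T)"
    unfolding cost_def proof (rule infsum_finite_support)
    fix w assume "w \<in> V \<times> V - T \<times> T"
    then obtain u v where "w = (u, v)" "u \<in> V" "v \<in> V" "u \<notin> T \<or> v \<notin> T" by auto
    then show "(case w of (u, v) \<Rightarrow> A (u, v) * real (gdist E u v)) = 0" using z by simp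
  qed (use T in auto)
  then show ?thesis by (simp add: sum.cartesian_product)
qed

text \<open>One finite set carries all rows and columns of the coupling, so the infinite sums become
  finite ones that may be swapped. \<open>U\<close> is included to make room for the supports of the
  marginals or for chosen points.\<close>

lemma coupling_support:
  assumes "is_coupling V m1 m2 A" "finite U" "U \<subseteq> V"
  obtains T where "finite T" "T \<subseteq> V" "U \<subseteq> T"
    "\<And>u v. u \<in> V \<Longrightarrow> v \<in> V \<Longrightarrow> u \<notin> T \<or> v \<notin> T \<Longrightarrow> A (u, v) = 0"
    "\<And>u. u \<in> V \<Longrightarrow> m1 u = (\<Sum>v\<in>T. A (u, v))" "\<And>v. v \<in> V \<Longrightarrow> m2 v = (\<Sum>u\<in>T. A (u, v))"
proof -
  let ?S = "{z \<in> V \<times> V. A z \<noteq> 0}"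
  let ?T = "U \<union> fst ` ?S \<union> snd ` ?S"
  have fin: "finite ?T" "?T \<subseteq> V" using assms by (auto simp: is_coupling_def)
  have z: "A (u, v) = 0" if "u \<in> V" "v \<in> V" "u \<notin> ?T \<or> v \<notin> ?T" for u v
    using that by force
  show ?thesis
  proof (rule that[of ?T])
    fix u assume u: "u \<in> V"
    then have "m1 u = (\<Sum>\<^sub>\<infinity>v\<in>V. A (u, v))" "m2 u = (\<Sum>\<^sub>\<infinity>v\<in>V. A (v, u))" using assms(1) by (auto simp: is_coupling_def)
    moreover have "(\<Sum>\<^sub>\<infinity>v\<in>V. A (u, v)) = (\<Sum>v\<in>?T. A (u, v))" by (rule infsum_finite_support) (use fin z u in auto)
    moreover have "(\<Sum>\<^sub>\<infinity>v\<in>V. A (v, u)) = (\<Sum>v\<in>?T. A (v, u))" by (rule infsum_finite_support) (use fin z u in auto)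
    ultimately show "m1 u = (\<Sum>v\<in>?T. A (u, v))" "m2 u = (\<Sum>v\<in>?T. A (v, u))" by auto
  qed (use fin z in auto)
qed

lemma is_couplingI:
  assumes T: "finite T" "T \<subseteq> V"
    and z: "\<And>u v. u \<in> V \<Longrightarrow> v \<in> V \<Longrightarrow> u \<notin> T \<or> v \<notin> T \<Longrightarrow> A (u, v) = 0"
    and nn: "\<And>u v. u \<in> T \<Longrightarrow> v \<in> T \<Longrightarrow> 0 \<le> A (u, v)"
    and m: "\<And>u. u \<in> V \<Longrightarrow> (\<Sum>v\<in>T. A (u, v)) = m1 u" "\<And>v. v \<in> V \<Longrightarrow> (\<Sum>u\<in>T. A (u, v)) = m2 v"
    and le: "\<And>u. u \<in> V \<Longrightarrow> m1 u \<le> 1"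
  shows "is_coupling V m1 m2 A"
  unfolding is_coupling_def
proof (intro conjI ballI)
  fix u v assume uv: "u \<in> V" "v \<in> V"
  show "A (u, v) \<in> {0..1}"
  proof (cases "u \<in> T \<and> v \<in> T")
    case True
    then have "A (u, v) \<le> (\<Sum>v\<in>T. A (u, v))" using T nn by (intro member_le_sum) auto
    then show ?thesis using m(1)[OF uv(1)] le[OF uv(1)] nn True by auto
  next
    case False
    then show ?thesis using z[OF uv] by auto
  qed
next
  show "finite {z \<in> V \<times> V. A z \<noteq> 0}"
    by (rule finite_subset[of _ "T \<times> T"]) (use z T in auto)
next
  fix u assume u: "u \<in> V"
  have "(\<Sum>\<^sub>\<infinity>v\<in>V. A (u, v)) = (\<Sum>v\<in>T. A (u, v))" by (rule infsum_finite_support) (use T z u in auto)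
  then show "(\<Sum>\<^sub>\<infinity>v\<in>V. A (u, v)) = m1 u" using m u by simp
  have "(\<Sum>\<^sub>\<infinity>v\<in>V. A (v, u)) = (\<Sum>v\<in>T. A (v, u))" by (rule infsum_finite_support) (use T z u in auto)
  then show "(\<Sum>\<^sub>\<infinity>v\<in>V. A (v, u)) = m2 u" using m u by simp
qed

lemma cost_nonneg: "is_coupling V m1 m2 A \<Longrightarrow> 0 \<le> cost V E A"
  unfolding cost_def by (rule infsum_nonneg) (auto simp: is_coupling_def)

text \<open>The easy half of Kantorovich duality: rewrite both integrals through the marginals of
  \<open>A\<close> and compare \<open>f u - f v\<close> with the distance term by term.\<close>

lemma cost_lip:
  assumes A: "is_coupling V m1 m2 A" and f: "lip V E f" and U: "finite U" "U \<subseteq> V"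
    and supp: "\<And>u. u \<in> V - U \<Longrightarrow> m1 u = 0 \<and> m2 u = 0"
  shows "(\<Sum>u\<in>U. f u * m1 u) - (\<Sum>u\<in>U. f u * m2 u) \<le> cost V E A"
proof -
  obtain T where T: "finite T" "T \<subseteq> V" "U \<subseteq> T"
    "\<And>u v. u \<in> V \<Longrightarrow> v \<in> V \<Longrightarrow> u \<notin> T \<or> v \<notin> T \<Longrightarrow> A (u, v) = 0"
    "\<And>u. u \<in> V \<Longrightarrow> m1 u = (\<Sum>v\<in>T. A (u, v))" "\<And>v. v \<in> V \<Longrightarrow> m2 v = (\<Sum>u\<in>T. A (u, v))"
    by (rule coupling_support[OF A U]) blast
  have 1: "(\<Sum>u\<in>U. f u * m u) = (\<Sum>u\<in>T. f u * m u)" if "m \<in> {m1, m2}" for m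
    by (rule sum.mono_neutral_left) (use T that supp in auto)
  have "(\<Sum>u\<in>T. f u * m1 u) = (\<Sum>u\<in>T. \<Sum>v\<in>T. f u * A (u, v))"
    using T by (intro sum.cong) (auto simp: sum_distrib_left)
  moreover have "(\<Sum>u\<in>T. f u * m2 u) = (\<Sum>v\<in>T. \<Sum>u\<in>T. f v * A (u, v))"
    using T by (intro sum.cong) (auto simp: sum_distrib_left)
  moreover have "(\<Sum>v\<in>T. \<Sum>u\<in>T. f v * A (u, v)) = (\<Sum>u\<in>T. \<Sum>v\<in>T. f v * A (u, v))" by (rule sum.swap)
  ultimately have "(\<Sum>u\<in>T. f u * m1 u) - (\<Sum>u\<in>T. f u * m2 u) = (\<Sum>u\<in>T. \<Sum>v\<in>T. (f u - f v) * A (u, v))"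
    by (simp add: sum_subtractf left_diff_distrib)
  also have "\<dots> \<le> (\<Sum>u\<in>T. \<Sum>v\<in>T. A (u, v) * real (gdist E u v))"
  proof (intro sum_mono)
    fix u v assume uv: "u \<in> T" "v \<in> T"
    then have V: "u \<in> V" "v \<in> V" using T(2) by auto
    then have "A (u, v) \<in> {0..1}" using A unfolding is_coupling_def by blast
    then have "0 \<le> A (u, v)" "f u - f v \<le> real (gdist E u v)" using f V by (auto simp: lip_def)
    then show "(f u - f v) * A (u, v) \<le> A (u, v) * real (gdist E u v)" by (simp add: mult.commute mult_left_mono)
  qed
  also have "\<dots> = cost V E A" using cost_finite[OF T(2,1)] T(4) by simp
  finally show ?thesis using 1 by simp
qed

text \<open>Positive degrees give the lazy walks total mass 1; connectedness makes
  \<open>gdist\<close> a genuine distance.\<close>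

locale fgraph =
  fixes V :: "'a set" and E
  assumes sg: "simple_graph V E" and lf: "locally_finite V E" and cg: "connected_graph V E"
    and pos: "\<And>v. v \<in> V \<Longrightarrow> 0 < deg E v"
begin

lemma E_V: "E u v \<Longrightarrow> u \<in> V \<and> v \<in> V" using sg by (auto simp: simple_graph_def)
lemma E_ne: "E u v \<Longrightarrow> u \<noteq> v" using sg by (auto simp: simple_graph_def irreflp_def)
lemma E_sym: "E u v \<Longrightarrow> E v u" using sg by (auto simp: simple_graph_def dest: sympD)
lemma nb_fin: "u \<in> V \<Longrightarrow> finite (nbhd E u)" using lf by (auto simp: locally_finite_def)
lemma nb_V: "nbhd E u \<subseteq> V" using E_V by (auto simp: nbhd_def)
lemma nb_self: "u \<notin> nbhd E u" using E_ne by (auto simp: nbhd_def)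

lemma walk_ex: "u \<in> V \<Longrightarrow> v \<in> V \<Longrightarrow> \<exists>n. (E ^^ n) u v"
  using cg by (simp add: connected_graph_def rtranclp_power)

lemma gdist_walk: "u \<in> V \<Longrightarrow> v \<in> V \<Longrightarrow> (E ^^ gdist E u v) u v"
  unfolding gdist_def using walk_ex LeastI_ex by metis

lemma gdist_le: "(E ^^ n) u v \<Longrightarrow> gdist E u v \<le> n"
  unfolding gdist_def by (rule Least_le)

lemma gdist_triangle: "u \<in> V \<Longrightarrow> v \<in> V \<Longrightarrow> w \<in> V \<Longrightarrow> gdist E u w \<le> gdist E u v + gdist E v w"
  by (rule gdist_le) (auto simp: relpowp_add intro: gdist_walk)

lemma gdist_self [simp]: "gdist E u u = 0"
  using gdist_le[of 0 u u] by simp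

lemma gdist_0: "u \<in> V \<Longrightarrow> v \<in> V \<Longrightarrow> gdist E u v = 0 \<Longrightarrow> u = v"
  using gdist_walk[of u v] by simp

lemma gdist_1: "u \<in> V \<Longrightarrow> v \<in> V \<Longrightarrow> gdist E u v = 1 \<Longrightarrow> E u v"
  using gdist_walk[of u v] by (auto simp: OO_def)

lemma gdist_2: "u \<in> V \<Longrightarrow> v \<in> V \<Longrightarrow> gdist E u v = 2 \<Longrightarrow> \<exists>w. E u w \<and> E w v"
  using gdist_walk[of u v] by (auto simp: numeral_2_eq_2)

lemma gdist_edge: "E u v \<Longrightarrow> gdist E u v = 1"
  using gdist_le[of 1 u v] gdist_0[of u v] E_V[of u v] E_ne[of u v] by (cases "gdist E u v = 0") (auto simp: OO_def)

lemma lazy_sum: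
  assumes "x \<in> V" "finite U" "insert x (nbhd E x) \<subseteq> U"
  shows "(\<Sum>u\<in>U. f u * lazy_walk E \<alpha> x u) = \<alpha> * f x + (1 - \<alpha>) * nbavg E f x"
proof -
  have "(\<Sum>u\<in>U. f u * lazy_walk E \<alpha> x u) = (\<Sum>u\<in>insert x (nbhd E x). f u * lazy_walk E \<alpha> x u)"
    by (rule sum.mono_neutral_right) (use assms in \<open>auto simp: lazy_walk_def\<close>)
  also have "\<dots> = f x * \<alpha> + (\<Sum>u\<in>nbhd E x. f u * lazy_walk E \<alpha> x u)"
    using nb_fin[OF assms(1)] nb_self by (simp add: lazy_walk_def)
  also have "(\<Sum>u\<in>nbhd E x. f u * lazy_walk E \<alpha> x u) = (\<Sum>u\<in>nbhd E x. (1 - \<alpha>) / real (deg E x) * f u)"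
    using nb_self by (intro sum.cong) (auto simp: lazy_walk_def)
  also have "\<dots> = (1 - \<alpha>) / real (deg E x) * (\<Sum>u\<in>nbhd E x. f u)" by (rule sum_distrib_left[symmetric])
  finally show ?thesis by (simp add: nbavg_def)
qed

lemma lazy_mass:
  assumes "x \<in> V" "finite U" "insert x (nbhd E x) \<subseteq> U"
  shows "(\<Sum>u\<in>U. lazy_walk E \<alpha> x u) = 1"
  using lazy_sum[OF assms, of "\<lambda>_. 1" \<alpha>] pos[OF assms(1)] by (simp add: nbavg_def deg_def)

lemma lazy_nonneg: "0 \<le> \<alpha> \<Longrightarrow> \<alpha> \<le> 1 \<Longrightarrow> 0 \<le> lazy_walk E \<alpha> x u"
  by (auto simp: lazy_walk_def)

lemma lazy_le_1: 
  assumes "x \<in> V" "0 \<le> \<alpha>" "\<alpha> \<le> 1" shows "lazy_walk E \<alpha> x u \<le> 1"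
proof (cases "u \<in> insert x (nbhd E x)")
  case True
  then have "lazy_walk E \<alpha> x u \<le> (\<Sum>u\<in>insert x (nbhd E x). lazy_walk E \<alpha> x u)"
    using nb_fin assms lazy_nonneg by (intro member_le_sum) auto
  then show ?thesis using lazy_mass[OF assms(1)] nb_fin assms(1) by auto
qed (use assms in \<open>auto simp: lazy_walk_def\<close>)

text \<open>The product coupling. It shows that the infimum in \<open>wasserstein\<close> ranges
  over a nonempty set and so has no default value.\<close>

lemma coupling_ex:
  assumes "x \<in> V" "y \<in> V" "0 \<le> \<alpha>" "\<alpha> \<le> 1"
  shows "\<exists>A. is_coupling V (lazy_walk E \<alpha> x) (lazy_walk E \<alpha> y) A"
proof
  let ?T = "insert x (nbhd E x) \<union> insert y (nbhd E y)"
  have T: "finite ?T" "?T \<subseteq> V" using nb_fin nb_V assms by auto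
  show "is_coupling V (lazy_walk E \<alpha> x) (lazy_walk E \<alpha> y) (\<lambda>(u, v). lazy_walk E \<alpha> x u * lazy_walk E \<alpha> y v)"
  proof (rule is_couplingI[OF T])
    fix u assume "u \<in> V"
    show "(\<Sum>v\<in>?T. case (u, v) of (u, v) \<Rightarrow> lazy_walk E \<alpha> x u * lazy_walk E \<alpha> y v) = lazy_walk E \<alpha> x u"
      using lazy_mass[OF assms(2) T(1), of \<alpha>] by (simp add: subset_iff flip: sum_distrib_left)
    show "(\<Sum>v\<in>?T. case (v, u) of (u, v) \<Rightarrow> lazy_walk E \<alpha> x u * lazy_walk E \<alpha> y v) = lazy_walk E \<alpha> y u"
      using lazy_mass[OF assms(1) T(1), of \<alpha>] by (simp add: subset_iff flip: sum_distrib_right)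
  qed (use lazy_nonneg lazy_le_1 assms in \<open>auto simp: lazy_walk_def\<close>)
qed

lemma wasserstein_cost:
  "wasserstein V E m1 m2 = (INF A\<in>{A. is_coupling V m1 m2 A}. cost V E A)"
  by (simp add: wasserstein_def cost_def)

lemma wasserstein_le: "is_coupling V m1 m2 A \<Longrightarrow> wasserstein V E m1 m2 \<le> cost V E A"
  unfolding wasserstein_cost using cost_nonneg by (intro cINF_lower) (auto intro!: bdd_belowI2[of _ 0])

lemma wasserstein_ge:
  assumes "x \<in> V" "y \<in> V" "0 \<le> \<alpha>" "\<alpha> \<le> 1"
    "\<And>A. is_coupling V (lazy_walk E \<alpha> x) (lazy_walk E \<alpha> y) A \<Longrightarrow> b \<le> cost V E A"
  shows "b \<le> wasserstein V E (lazy_walk E \<alpha> x) (lazy_walk E \<alpha> y)"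
  unfolding wasserstein_cost using coupling_ex[OF assms(1-4)] assms(5) by (intro cINF_greatest) auto

lemma wasserstein_lip:
  assumes "x \<in> V" "y \<in> V" "0 \<le> \<alpha>" "\<alpha> \<le> 1" "lip V E f"
  shows "\<alpha> * (f x - f y) + (1 - \<alpha>) * (nbavg E f x - nbavg E f y) \<le> wasserstein V E (lazy_walk E \<alpha> x) (lazy_walk E \<alpha> y)"
proof (rule wasserstein_ge[OF assms(1-4)])
  fix A assume A: "is_coupling V (lazy_walk E \<alpha> x) (lazy_walk E \<alpha> y) A"
  let ?T = "insert x (nbhd E x) \<union> insert y (nbhd E y)"
  have T: "finite ?T" "?T \<subseteq> V" using nb_fin nb_V assms by auto
  have "(\<Sum>u\<in>?T. f u * lazy_walk E \<alpha> x u) - (\<Sum>u\<in>?T. f u * lazy_walk E \<alpha> y u) \<le> cost V E A"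
    by (rule cost_lip[OF A assms(5) T]) (auto simp: lazy_walk_def)
  then show "\<alpha> * (f x - f y) + (1 - \<alpha>) * (nbavg E f x - nbavg E f y) \<le> cost V E A"
    by (subst (asm) lazy_sum[OF assms(1) T(1)], blast, subst (asm) lazy_sum[OF assms(2) T(1)], blast) (simp add: algebra_simps)
qed

text \<open>The \<beta>-lazy walk is the mixture of the \<alpha>-lazy walk, with weight
  \<open>c\<close>, and the point mass at its start, with weight \<open>1 - c\<close>. Mixing a
  coupling with the point mass at \<open>(x, y)\<close> in the same proportion gives the
  bound.\<close>

lemma wasserstein_convex:
  assumes xy: "x \<in> V" "y \<in> V" and ab: "0 \<le> \<alpha>" "\<alpha> \<le> \<beta>" "\<beta> < 1" and c: "c = (1 - \<beta>) / (1 - \<alpha>)"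
  shows "wasserstein V E (lazy_walk E \<beta> x) (lazy_walk E \<beta> y)
    \<le> c * wasserstein V E (lazy_walk E \<alpha> x) (lazy_walk E \<alpha> y) + (1 - c) * real (gdist E x y)"
proof -
  let ?W = "wasserstein V E (lazy_walk E \<beta> x) (lazy_walk E \<beta> y)"
  have c01: "0 < c" "c \<le> 1" using ab unfolding c by (auto simp: divide_le_eq)
  have ca: "c * (1 - \<alpha>) = 1 - \<beta>" using ab c by simp
  have mix: "lazy_walk E \<beta> z u = c * lazy_walk E \<alpha> z u + (if u = z then 1 - c else 0)" for z u
    using ca by (auto simp: lazy_walk_def algebra_simps)
  have "(?W - (1 - c) * real (gdist E x y)) / c \<le> wasserstein V E (lazy_walk E \<alpha> x) (lazy_walk E \<alpha> y)"
  proof (rule wasserstein_ge)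
    fix A assume A: "is_coupling V (lazy_walk E \<alpha> x) (lazy_walk E \<alpha> y) A"
    obtain T where T: "finite T" "T \<subseteq> V" "{x, y} \<subseteq> T"
      "\<And>u v. u \<in> V \<Longrightarrow> v \<in> V \<Longrightarrow> u \<notin> T \<or> v \<notin> T \<Longrightarrow> A (u, v) = 0"
      "\<And>u. u \<in> V \<Longrightarrow> lazy_walk E \<alpha> x u = (\<Sum>v\<in>T. A (u, v))" "\<And>v. v \<in> V \<Longrightarrow> lazy_walk E \<alpha> y v = (\<Sum>u\<in>T. A (u, v))"
      using coupling_support[OF A, of "{x, y}"] xy by auto
    define B where "B z = c * A z + (if z = (x, y) then 1 - c else 0)" for z
    have sx: "(\<Sum>v\<in>T. B (u, v)) = c * (\<Sum>v\<in>T. A (u, v)) + (if u = x then 1 - c else 0)" for u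
      using T(1,3) by (cases "u = x") (auto simp: B_def sum.distrib sum_distrib_left sum.delta)
    have sy: "(\<Sum>u\<in>T. B (u, v)) = c * (\<Sum>u\<in>T. A (u, v)) + (if v = y then 1 - c else 0)" for v
      using T(1,3) by (cases "v = y") (auto simp: B_def sum.distrib sum_distrib_left sum.delta)
    have "is_coupling V (lazy_walk E \<beta> x) (lazy_walk E \<beta> y) B"
    proof (rule is_couplingI[OF T(1,2)])
      fix u assume u: "u \<in> V"
      show "(\<Sum>v\<in>T. B (u, v)) = lazy_walk E \<beta> x u" "(\<Sum>v\<in>T. B (v, u)) = lazy_walk E \<beta> y u"
        using sx sy mix T(5,6)[OF u] by simp_all
      show "lazy_walk E \<beta> x u \<le> 1" using lazy_le_1[OF xy(1)] ab by auto
    next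
      fix u v assume "u \<in> V" "v \<in> V" "u \<notin> T \<or> v \<notin> T"
      then show "B (u, v) = 0" using T(3,4) by (auto simp: B_def)
    next
      fix u v assume "u \<in> T" "v \<in> T"
      then have V: "u \<in> V" "v \<in> V" using T(2) by auto
      then have "A (u, v) \<in> {0..1}" using A unfolding is_coupling_def by blast
      then have "0 \<le> c * A (u, v)" using c01 by simp
      then show "0 \<le> B (u, v)" using c01 by (simp add: B_def)
    qed
    then have "?W \<le> cost V E B" by (rule wasserstein_le)
    also have "\<dots> = (\<Sum>u\<in>T. \<Sum>v\<in>T. B (u, v) * real (gdist E u v))"
      by (rule cost_finite[OF T(2,1)]) (use T(3,4) in \<open>auto simp: B_def\<close>)
    also have "\<dots> = (\<Sum>u\<in>T. \<Sum>v\<in>T. c * (A (u, v) * real (gdist E u v)) + (if u = x \<and> v = y then (1 - c) * real (gdist E u v) else 0))"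
      by (intro sum.cong) (auto simp: B_def algebra_simps)
    also have "\<dots> = c * (\<Sum>u\<in>T. \<Sum>v\<in>T. A (u, v) * real (gdist E u v)) + (\<Sum>u\<in>T. \<Sum>v\<in>T. if u = x \<and> v = y then (1 - c) * real (gdist E u v) else 0)"
      by (simp add: sum.distrib sum_distrib_left)
    also have "(\<Sum>u\<in>T. \<Sum>v\<in>T. if u = x \<and> v = y then (1 - c) * real (gdist E u v) else 0)
        = (\<Sum>u\<in>T. if u = x then (\<Sum>v\<in>T. if v = y then (1 - c) * real (gdist E u v) else 0) else 0)"
      by (intro sum.cong) auto
    also have "\<dots> = (1 - c) * real (gdist E x y)" using T(1,3) by (simp add: sum.delta)
    also have "(\<Sum>u\<in>T. \<Sum>v\<in>T. A (u, v) * real (gdist E u v)) = cost V E A"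
      using cost_finite[OF T(2,1)] T(4) by simp
    finally show "(?W - (1 - c) * real (gdist E x y)) / c \<le> cost V E A" using c01 by (simp add: field_simps)
  qed (use xy ab in auto)
  then show ?thesis using c01 by (simp add: field_simps)
qed

lemma kappa_quotient_mono:
  assumes xy: "x \<in> V" "y \<in> V" "x \<noteq> y" and ab: "0 \<le> \<alpha>" "\<alpha> \<le> \<beta>" "\<beta> < 1"
  shows "kappa V E \<alpha> x y / (1 - \<alpha>) \<le> kappa V E \<beta> x y / (1 - \<beta>)"
proof -
  let ?d = "real (gdist E x y)" and ?W = "\<lambda>a. wasserstein V E (lazy_walk E a x) (lazy_walk E a y)"
  define c where "c = (1 - \<beta>) / (1 - \<alpha>)"
  have d: "0 < ?d" using gdist_0 xy by fastforce
  have "?W \<beta> / ?d \<le> (c * ?W \<alpha> + (1 - c) * ?d) / ?d"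
    using wasserstein_convex[OF xy(1,2) ab c_def] d by (simp add: divide_right_mono)
  also have "\<dots> = c * (?W \<alpha> / ?d) + (1 - c)" using d by (simp add: field_simps)
  finally have "c * kappa V E \<alpha> x y \<le> kappa V E \<beta> x y" by (simp add: kappa_def algebra_simps)
  then show ?thesis using ab by (simp add: c_def field_simps)
qed

text \<open>The lazy masses at \<open>x\<close> and \<open>y\<close> contribute exactly \<alpha>
  times the distance when \<open>f\<close> drops by the full distance from \<open>x\<close> to
  \<open>y\<close>. What remains is proportional to 1 - \<alpha>, so the bound on the quotient does
  not depend on \<alpha>.\<close>

lemma kappa_quotient_le:
  assumes xy: "x \<in> V" "y \<in> V" "x \<noteq> y" and a: "0 \<le> \<alpha>" "\<alpha> < 1" and f: "lip V E f" "f x - f y = real (gdist E x y)"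
  shows "kappa V E \<alpha> x y / (1 - \<alpha>) \<le> 1 - (nbavg E f x - nbavg E f y) / real (gdist E x y)"
proof -
  let ?d = "real (gdist E x y)"
  have d: "0 < ?d" using gdist_0 xy by fastforce
  have "(\<alpha> * ?d + (1 - \<alpha>) * (nbavg E f x - nbavg E f y)) / ?d \<le> wasserstein V E (lazy_walk E \<alpha> x) (lazy_walk E \<alpha> y) / ?d"
    using wasserstein_lip[OF xy(1,2) a(1) _ f(1)] a f(2) d by (simp add: divide_right_mono)
  then have "kappa V E \<alpha> x y \<le> 1 - (\<alpha> * ?d + (1 - \<alpha>) * (nbavg E f x - nbavg E f y)) / ?d" by (simp add: kappa_def)
  also have "\<dots> = (1 - \<alpha>) * (1 - (nbavg E f x - nbavg E f y) / ?d)" using d by (simp add: field_simps)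
  finally show ?thesis using a by (simp add: field_simps)
qed

text \<open>A test function that exists for every pair; it makes all quotients bounded
  above.\<close>

lemma lip_gdist: "y \<in> V \<Longrightarrow> lip V E (\<lambda>u. real (gdist E u y))"
  using gdist_triangle by (auto simp: lip_def algebra_simps simp flip: of_nat_add)

text \<open>
  Monotone and bounded, the quotients converge; the junk value of \<^const>\<open>Lim\<close> never occurs.
\<close>

lemma kappa_LLY_tendsto:
  assumes xy: "x \<in> V" "y \<in> V" "x \<noteq> y"
  shows "kappa_LLY V E x y = (SUP \<alpha>\<in>{0..<1}. kappa V E \<alpha> x y / (1 - \<alpha>))" (is "_ = ?L")
    and "bdd_above ((\<lambda>\<alpha>. kappa V E \<alpha> x y / (1 - \<alpha>)) ` {0..<1})"
proof -
  let ?h = "\<lambda>\<alpha>. kappa V E \<alpha> x y / (1 - \<alpha>)"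
  show bdd: "bdd_above (?h ` {0..<1})"
    using kappa_quotient_le[OF xy _ _ lip_gdist[OF xy(2)]] by (auto intro!: bdd_aboveI2)
  have "(?h \<longlongrightarrow> ?L) (at_left 1)"
  proof (rule order_tendstoI)
    fix a assume "a < ?L"
    then obtain \<alpha> where \<alpha>: "\<alpha> \<in> {0..<1}" "a < ?h \<alpha>" using less_cSUP_iff[OF _ bdd] by auto
    show "\<forall>\<^sub>F \<beta> in at_left 1. a < ?h \<beta>"
      unfolding eventually_at_left_field
      by (rule exI[of _ \<alpha>]) (use \<alpha> kappa_quotient_mono[OF xy, of \<alpha>] in \<open>auto intro: less_le_trans\<close>)
  next
    fix a assume a: "?L < a"
    show "\<forall>\<^sub>F \<beta> in at_left 1. ?h \<beta> < a"
      unfolding eventually_at_left_field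
    proof (intro exI[of _ 0] conjI allI impI)
      fix \<beta> :: real assume "0 < \<beta>" "\<beta> < 1"
      then have "?h \<beta> \<le> ?L" by (intro cSUP_upper bdd) auto
      with a show "?h \<beta> < a" by simp
    qed simp
  qed
  then show "kappa_LLY V E x y = ?L" unfolding kappa_LLY_def by (rule tendsto_Lim[rotated]) simp
qed

lemma kappa_LLY_ge:
  assumes "x \<in> V" "y \<in> V" "x \<noteq> y" "0 \<le> \<alpha>" "\<alpha> < 1"
  shows "kappa V E \<alpha> x y / (1 - \<alpha>) \<le> kappa_LLY V E x y"
  unfolding kappa_LLY_tendsto(1)[OF assms(1-3)]
  by (rule cSUP_upper2[OF kappa_LLY_tendsto(2)[OF assms(1-3)], of \<alpha>]) (use assms in auto)

lemma kappa_LLY_le: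
  assumes "x \<in> V" "y \<in> V" "x \<noteq> y" "lip V E f" "f x - f y = real (gdist E x y)"
  shows "kappa_LLY V E x y \<le> 1 - (nbavg E f x - nbavg E f y) / real (gdist E x y)"
  unfolding kappa_LLY_tendsto(1)[OF assms(1-3)]
  by (rule cSUP_least) (use kappa_quotient_le[OF assms(1-3) _ _ assms(4,5)] in auto)

end

text \<open>
  The level of \<open>b\<close> is \<open>f b + 1\<close> for the test function \<open>f\<close> with \<open>f x = 1\<close>, \<open>f y = 0\<close>, value
  \<open>2\<close> on the private neighbours of \<open>x\<close>, value \<open>1\<close> on the common neighbours, and the least
  possible values elsewhere.
\<close>

definition level :: "('a \<Rightarrow> 'a \<Rightarrow> bool) \<Rightarrow> 'a \<Rightarrow> 'a \<Rightarrow> 'a \<Rightarrow> nat" where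
  "level E x y b =
    (if E x b \<or> (\<exists>a. E x a \<and> \<not> E y a \<and> a \<noteq> y \<and> E a b) then 2
     else if (\<exists>s. E x s \<and> E y s \<and> E s b) \<or> (\<exists>a c. E x a \<and> \<not> E y a \<and> a \<noteq> y \<and> E a c \<and> E c b) then 1
     else 0)"

context fgraph
begin

text \<open>For the test function \<open>f\<close> below, the average of \<open>f\<close> around
  \<open>x\<close> is at least \<open>2 - (2 + t) / d(x)\<close> and the average around
  \<open>y\<close> at most \<open>(2 + s) / d(y) - 1\<close>. Positive curvature forces their
  difference below 1.\<close>

lemma curvature_law:
  assumes xy: "E x y" and k: "0 < kappa_LLY V E x y"
  shows "2 * deg E x * deg E y < (2 + card (nbhd E x \<inter> nbhd E y)) * deg E y
    + (2 + (\<Sum>b\<in>nbhd E y - {x}. level E x y b)) * deg E x"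
proof -
  have V: "x \<in> V" "y \<in> V" "x \<noteq> y" using E_V E_ne xy by auto
  let ?A = "nbhd E x - nbhd E y - {y}" and ?S = "nbhd E x \<inter> nbhd E y"
  let ?P = "\<lambda>z. (\<lambda>a. 2 - real (gdist E a z)) ` ?A \<union> (\<lambda>s. 1 - real (gdist E s z)) ` insert x ?S \<union> {-1}"
  \<comment> \<open>The least 1-Lipschitz function that is at least 2 on the private neighbours of
    \<open>x\<close>, at least 1 on \<open>x\<close> and the common neighbours, and at least -1
    everywhere: a maximum of cones. The floor -1 is the least value possible next to
    \<open>y\<close>, where \<open>f\<close> vanishes.\<close>
  define f where "f z = Max (?P z)" for z
  have fin: "finite (?P z)" for z using nb_fin V by auto
  have ge: "v \<in> ?P z \<Longrightarrow> v \<le> f z" for v z unfolding f_def by (rule Max_ge[OF fin])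
  have mem: "f z \<in> ?P z" for z unfolding f_def by (rule Max_in[OF fin]) auto
  have AV: "a \<in> V" if "a \<in> ?A \<union> insert x ?S" for a using that nb_V V by auto
  have lip: "lip V E f"
    unfolding lip_def
  proof (intro ballI)
    fix u v assume uv: "u \<in> V" "v \<in> V"
    have tri: "real (gdist E a v) \<le> real (gdist E a u) + real (gdist E u v)" if "a \<in> ?A \<union> insert x ?S" for a
      using gdist_triangle[OF AV[OF that] uv] by linarith
    consider a where "a \<in> ?A" "f u = 2 - real (gdist E a u)" | s where "s \<in> insert x ?S" "f u = 1 - real (gdist E s u)" | "f u = -1"
      using mem[of u] by blast
    then show "f u - f v \<le> real (gdist E u v)"
    proof cases
      case 1
      then have "2 - real (gdist E a v) \<le> f v" by (intro ge) auto
      with 1 tri[of a] show ?thesis by auto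
    next
      case 2
      then have "1 - real (gdist E s v) \<le> f v" by (intro ge) blast
      with 2 tri[of s] show ?thesis by auto
    next
      case 3
      have "-1 \<le> f v" by (intro ge) auto
      with 3 show ?thesis by simp
    qed
  qed
  \<comment> \<open>Levels 2, 1, 0 stand for the values 1, 0, -1. Cones from private neighbours of
    \<open>x\<close> reach them at distance 1, 2, and more.\<close>
  have dA: "2 - real (gdist E a b) \<le> real (level E x y b) - 1" if a: "a \<in> ?A" and b: "E y b" for a b
  proof -
    have aV: "a \<in> V" "b \<in> V" using AV[of a] a E_V[OF b] by auto
    have aa: "E x a" "\<not> E y a" "a \<noteq> y" using a by (auto simp: nbhd_def)
    then have "gdist E a b \<noteq> 0" using gdist_0[OF aV] b by auto
    then consider "gdist E a b = 1" | "gdist E a b = 2" | "3 \<le> gdist E a b" by linarith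
    then show ?thesis
    proof cases
      case 1
      then have "E a b" using gdist_1 aV by auto
      then show ?thesis using 1 aa by (auto simp: level_def)
    next
      case 2
      then obtain c where "E a c" "E c b" using gdist_2 aV by blast
      then have "1 \<le> level E x y b" using aa by (auto simp: level_def)
      then show ?thesis using 2 by simp
    qed auto
  qed
  have dS: "1 - real (gdist E s b) \<le> real (level E x y b) - 1" if s: "s \<in> insert x ?S" and b: "E y b" "b \<noteq> x" for s b
  proof -
    have sV: "s \<in> V" "b \<in> V" using AV[of s] s E_V[OF b(1)] by auto
    consider "gdist E s b = 0" | "gdist E s b = 1" | "2 \<le> gdist E s b" by linarith
    then show ?thesis
    proof cases
      case 1
      then have "s = b" using gdist_0 sV by auto
      then have "E x b" using s b by (auto simp: nbhd_def)
      then show ?thesis using 1 by (simp add: level_def)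
    next
      case 2
      then have "E s b" using gdist_1 sV by auto
      then have "1 \<le> level E x y b" using s by (auto simp: level_def nbhd_def)
      then show ?thesis using 2 by simp
    qed auto
  qed
  have fb: "f b \<le> real (level E x y b) - 1" if "E y b" "b \<noteq> x" for b
  proof -
    consider a where "a \<in> ?A" "f b = 2 - real (gdist E a b)" | s where "s \<in> insert x ?S" "f b = 1 - real (gdist E s b)" | "f b = -1"
      using mem[of b] by blast
    then show ?thesis using dA[OF _ that(1)] dS[OF _ that] by cases (auto simp del: Diff_iff insert_iff Int_iff)
  qed
  have d2: "2 \<le> gdist E a y" if "a \<in> ?A" for a
  proof -
    have "a \<in> V" "a \<noteq> y" "\<not> E a y" using AV[of a] that E_sym[of a y] by (auto simp: nbhd_def)
    then have "gdist E a y \<noteq> 0" "gdist E a y \<noteq> 1" using gdist_0 gdist_1 V by auto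
    then show ?thesis by linarith
  qed
  have d1: "gdist E s y = 1" if "s \<in> insert x ?S" for s
  proof -
    have "E s y" using that xy E_sym by (auto simp: nbhd_def)
    then show ?thesis by (rule gdist_edge)
  qed
  have fy: "f y = 0"
  proof (rule antisym)
    show "f y \<le> 0" using mem[of y] d2 d1 by fastforce
    have "1 - real (gdist E x y) \<le> f y" by (intro ge) blast
    then show "0 \<le> f y" using d1[of x] by simp
  qed
  have fx: "f x = 1"
  proof (rule antisym)
    have "gdist E a x = 1" if "a \<in> ?A \<union> ?S" for a
    proof -
      have "E a x" using that E_sym by (auto simp: nbhd_def)
      then show ?thesis by (rule gdist_edge)
    qed
    then show "f x \<le> 1" using mem[of x] by fastforce
    have "1 - real (gdist E x x) \<le> f x" by (intro ge) blast
    then show "1 \<le> f x" by simp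
  qed
  have d: "gdist E x y = 1" using xy by (rule gdist_edge)
  have "kappa_LLY V E x y \<le> 1 - (nbavg E f x - nbavg E f y)"
    using kappa_LLY_le[OF V lip] fx fy d by simp
  then have lt: "nbavg E f x - nbavg E f y < 1" using k by simp
  let ?dx = "real (deg E x)" and ?dy = "real (deg E y)" and ?t = "real (card ?S)"
    and ?s = "real (\<Sum>b\<in>nbhd E y - {x}. level E x y b)"
  have dp: "0 < ?dx" "0 < ?dy" using pos V by auto
  have fnb: "finite (nbhd E x)" "finite (nbhd E y)" using nb_fin V by auto
  have xin: "x \<in> nbhd E y" "y \<in> nbhd E x" using xy E_sym by (auto simp: nbhd_def)
  have nx: "nbhd E x = insert y (?A \<union> ?S)" using xin by auto
  have yn: "y \<notin> ?A \<union> ?S" using nb_self by auto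
  have "card (nbhd E x) = Suc (card (?A \<union> ?S))" by (subst nx) (use fnb yn in auto)
  also have "card (?A \<union> ?S) = card ?A + card ?S" by (rule card_Un_disjoint) (use fnb in auto)
  finally have cA: "real (card ?A) = ?dx - 1 - ?t" by (simp add: deg_def)
  \<comment> \<open>Around \<open>x\<close> the neighbour \<open>y\<close> counts 0, private
    neighbours count at least 2 and common ones at least 1.\<close>
  have "2 * real (card ?A) + ?t \<le> (\<Sum>v\<in>?A. f v) + (\<Sum>v\<in>?S. f v)"
  proof (rule add_mono)
    have "(\<Sum>v\<in>?A. 2) \<le> (\<Sum>v\<in>?A. f v)"
    proof (rule sum_mono)
      fix a assume a: "a \<in> ?A"
      then have "2 - real (gdist E a a) \<le> f a" by (intro ge) blast
      then show "2 \<le> f a" by simp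
    qed
    then show "2 * real (card ?A) \<le> (\<Sum>v\<in>?A. f v)" by simp
    have "(\<Sum>v\<in>?S. 1) \<le> (\<Sum>v\<in>?S. f v)"
    proof (rule sum_mono)
      fix a assume a: "a \<in> ?S"
      then have "1 - real (gdist E a a) \<le> f a" by (intro ge) blast
      then show "1 \<le> f a" by simp
    qed
    then show "?t \<le> (\<Sum>v\<in>?S. f v)" by simp
  qed
  also have "\<dots> = (\<Sum>v\<in>?A \<union> ?S. f v)" by (rule sum.union_disjoint[symmetric]) (use fnb in auto)
  also have "\<dots> = (\<Sum>v\<in>insert y (?A \<union> ?S). f v)" using fnb yn fy by (subst sum.insert) auto
  also have "\<dots> = nbavg E f x * ?dx" using nx dp by (simp add: nbavg_def)
  finally have 1: "2 * (?dx - 1 - ?t) + ?t \<le> nbavg E f x * ?dx" using cA by simp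
  have "nbavg E f y * ?dy = (\<Sum>v\<in>nbhd E y. f v)" using dp by (simp add: nbavg_def)
  also have "\<dots> = f x + (\<Sum>v\<in>nbhd E y - {x}. f v)" using fnb xin by (intro sum.remove) auto
  also have "\<dots> \<le> 1 + (\<Sum>v\<in>nbhd E y - {x}. real (level E x y v) - 1)"
    using fx fb by (intro add_mono sum_mono) (auto simp: nbhd_def)
  also have "\<dots> = 1 + ?s - (?dy - 1)"
  proof -
    have "card (nbhd E y) = Suc (card (nbhd E y - {x}))" using fnb xin by (metis card_Suc_Diff1)
    then show ?thesis by (simp add: sum_subtractf deg_def)
  qed
  finally have 2: "nbavg E f y * ?dy \<le> 2 + ?s - ?dy" by simp
  have "2 - (2 + ?t) / ?dx \<le> nbavg E f x" using 1 dp by (simp add: field_simps)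
  moreover have "nbavg E f y \<le> (2 + ?s) / ?dy - 1" using 2 dp by (simp add: field_simps)
  ultimately have "2 < (2 + ?t) / ?dx + (2 + ?s) / ?dy" using lt by linarith
  then have "2 * ?dx * ?dy < (2 + ?t) * ?dy + (2 + ?s) * ?dx" using dp by (simp add: field_simps)
  then have "real (2 * deg E x * deg E y) < real ((2 + card ?S) * deg E y + (2 + (\<Sum>b\<in>nbhd E y - {x}. level E x y b)) * deg E x)"
    by (simp add: algebra_simps)
  then show ?thesis unfolding of_nat_less_iff .
qed

end

section \<open>Lobes\<close>

text \<open>After division by the degrees the left side becomes
  \<open>(2 + t) / dx + (2 + s) / dy\<close>, which is monotone in each of its four arguments. So a
  violation for the known bounds is a violation for the true values.\<close>

lemma law_violated_mono:
  fixes d e T S dx dy t s :: nat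
  assumes "(2 + T) * e + (2 + S) * d \<le> 2 * d * e" "0 < d" "0 < e" "d \<le> dx" "e \<le> dy" "t \<le> T" "s \<le> S"
  shows "(2 + t) * dy + (2 + s) * dx \<le> 2 * dx * dy"
proof -
  have p: "0 < real dx" "0 < real dy" "0 < real d" "0 < real e" using assms by auto
  have "real ((2 + T) * e + (2 + S) * d) \<le> real (2 * d * e)" using assms(1) by (simp only: of_nat_le_iff)
  then have "(2 + real T) / real d + (2 + real S) / real e \<le> 2" using p by (simp add: field_simps)
  moreover have "(2 + real t) / real dx \<le> (2 + real T) / real d"
    by (rule frac_le) (use assms p in auto)
  moreover have "(2 + real s) / real dy \<le> (2 + real S) / real e"
    by (rule frac_le) (use assms p in auto)
  ultimately have "(2 + real t) / real dx + (2 + real s) / real dy \<le> 2" by linarith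
  then have "real ((2 + t) * dy + (2 + s) * dx) \<le> real (2 * dx * dy)" using p by (simp add: field_simps)
  then show ?thesis by (simp only: of_nat_le_iff)
qed

text \<open>The combinatorial core. Outerplanarity enters the upper bound only through
  \<open>theta\<close> and \<open>K4\<close>, curvature only through \<open>law\<close>.\<close>

locale posgraph = fgraph +
  assumes md: "v \<in> V \<Longrightarrow> 2 \<le> deg E v"
    and theta: "a \<noteq> b \<Longrightarrow> conn E D1 \<Longrightarrow> conn E D2 \<Longrightarrow> conn E D3 \<Longrightarrow>
      D1 \<inter> D2 = {} \<Longrightarrow> D1 \<inter> D3 = {} \<Longrightarrow> D2 \<inter> D3 = {} \<Longrightarrow>
      att E a D1 \<Longrightarrow> att E a D2 \<Longrightarrow> att E a D3 \<Longrightarrow> att E b D1 \<Longrightarrow> att E b D2 \<Longrightarrow> att E b D3 \<Longrightarrow>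
      a \<notin> D1 \<union> D2 \<union> D3 \<Longrightarrow> b \<notin> D1 \<union> D2 \<union> D3 \<Longrightarrow> False"
    and K4: "E a b \<Longrightarrow> E a c \<Longrightarrow> E a d \<Longrightarrow> E b c \<Longrightarrow> E b d \<Longrightarrow> E c d \<Longrightarrow> False"
    and law: "E x y \<Longrightarrow> 2 * deg E x * deg E y < (2 + card (nbhd E x \<inter> nbhd E y)) * deg E y
      + (2 + (\<Sum>b\<in>nbhd E y - {x}. level E x y b)) * deg E x"
begin

lemma symE: "symp E" using E_sym by (auto simp: symp_def)
lemma irr [simp]: "\<not> E u u" using E_ne by blast

lemma att_insert [simp]: "att E c (insert p D) \<longleftrightarrow> E c p \<or> att E c D" by (auto simp: att_def)
lemma att_empty [simp]: "\<not> att E c {}" by (auto simp: att_def)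

lemma attI: "E c p \<Longrightarrow> p \<in> D \<Longrightarrow> att E c D" by (auto simp: att_def)

lemma conn_list_set: "successively E xs \<Longrightarrow> xs \<noteq> [] \<Longrightarrow> conn E (set xs)"
  using conn_set_list[OF symE] .

subsection \<open>Theta graphs and separations\<close>

text \<open>The two arcs of the cycle between \<open>a\<close> and \<open>b\<close>, each with an
  inner vertex, and \<open>D\<close> form a theta graph. Hence a connected set off a cycle touches
  it in at most two vertices, and two such vertices are consecutive on it whenever the cycle has
  length at least four.\<close>

lemma cycle_theta:
  assumes c: "distinct (A @ a # M @ b # C)" "successively E (A @ a # M @ b # C)"
    "E (last (A @ a # M @ b # C)) (hd (A @ a # M @ b # C))"
    and ne: "M \<noteq> []" "A \<noteq> [] \<or> C \<noteq> []"
    and D: "conn E D" "D \<inter> set (A @ a # M @ b # C) = {}" "att E a D" "att E b D"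
  shows False
proof (rule theta[of a b "set M" "set (C @ A)" D])
  have s: "successively E A" "successively E M" "successively E C" "E a (hd M)" "E (last M) b"
    "A \<noteq> [] \<Longrightarrow> E (last A) a" "C \<noteq> [] \<Longrightarrow> E b (hd C)"
    using c(2) ne(1) by (auto simp: successively_append_iff successively_Cons)
  show "conn E (set M)" using conn_list_set s ne by blast
  have w: "E (last C) (hd A)" if "A \<noteq> []" "C \<noteq> []" using c(3) that by simp
  show "conn E (set (C @ A))"
    by (rule conn_list_set) (use s w ne in \<open>auto simp: successively_append_iff\<close>)
  show "att E a (set M)" using s ne by (auto intro: attI)
  show "att E b (set M)" using s(5) ne by (auto intro: attI[OF E_sym])
  show "att E a (set (C @ A))"
  proof (cases "A = []")
    case True
    then show ?thesis using c(3) ne by (auto intro!: attI[OF E_sym, of "last C"])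
  next
    case False
    then show ?thesis using s(6) by (auto intro!: attI[OF E_sym, of "last A"])
  qed
  show "att E b (set (C @ A))"
  proof (cases "C = []")
    case True
    then show ?thesis using c(3) ne by (auto intro!: attI[of _ "hd A"])
  next
    case False
    then show ?thesis using s(7) by (auto intro!: attI[of _ "hd C"])
  qed
qed (use c D in auto)

text \<open>A connected set that touches all corners of a triangle yields a \<open>K\<^sub>4\<close>
  minor. If a single vertex of \<open>D\<close> is the hub and adjacent to all three corners, this
  is a \<open>K\<^sub>4\<close> subgraph; every other shape contains a theta graph. The path
  \<open>xs\<close> through \<open>D\<close> from \<open>u\<close> to \<open>v\<close> locates the
  hub.\<close>

lemma triangle_tripod:
  assumes t: "E u v" "E u w" "E v w" and D: "conn E D" "u \<notin> D" "v \<notin> D" "w \<notin> D"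
    and a: "att E u D" "att E v D" "att E w D"
  shows False
proof -
  have ne: "u \<noteq> v" "u \<noteq> w" "v \<noteq> w" using t E_ne by blast+
  obtain p q where pq: "p \<in> D" "E u p" "q \<in> D" "E v q" using a by (auto simp: att_def)
  obtain xs where xs: "xs \<noteq> []" "hd xs = p" "last xs = q" "successively E xs" "distinct xs" "set xs \<subseteq> D"
    using conn_path[OF D(1) pq(1,3)] .
  have cu: "conn E (insert u (set ys)) \<and> att E d (insert u (set ys))" if "xs = ys @ d # zs" for ys d zs
  proof (cases "ys = []")
    case True
    then show ?thesis using that xs pq E_sym by (auto intro: attI)
  next
    case False
    then have "successively E (u # ys)" using that xs pq by (auto simp: successively_Cons successively_append_iff)
    moreover have "E d (last ys)" using False that xs E_sym by (auto simp: successively_append_iff)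
    ultimately show ?thesis using conn_list_set[of "u # ys"] False by (auto intro!: attI[of d "last ys"])
  qed
  have cv: "conn E (insert v (set zs)) \<and> att E d (insert v (set zs))" if "xs = ys @ d # zs" for ys d zs
  proof (cases "zs = []")
    case True
    then show ?thesis using that xs pq E_sym by (auto intro: attI)
  next
    case False
    then have "successively E (zs @ [v])" using that xs pq E_sym by (auto simp: successively_Cons successively_append_iff)
    moreover have "E d (hd zs)" using False that xs by (auto simp: successively_Cons successively_append_iff)
    ultimately show ?thesis using conn_list_set[of "zs @ [v]"] False by (auto intro!: attI[of d "hd zs"])
  qed
  show False
  proof (cases "\<exists>d\<in>set xs. E w d")
    case True
    then obtain d ys zs where d: "E w d" "xs = ys @ d # zs" by (auto dest: split_list)
    show False
    proof (cases "zs = []")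
      case False
      show False
      proof (rule theta[of d v "set zs" "{w}" "insert u (set ys)"])
        show "conn E (set zs)" using xs d False by (intro conn_list_set) (auto simp: successively_append_iff successively_Cons)
        show "att E d (set zs)" using xs d False by (auto intro!: attI[of d "hd zs"] simp: successively_append_iff successively_Cons)
        show "att E v (set zs)" using xs d False pq by (auto intro!: attI[of v q])
      qed (use cu[OF d(2)] d t ne D xs E_sym in \<open>auto intro: attI\<close>)
    next
      case zs: True
      show False
      proof (cases "ys = []")
        case True
        \<comment> \<open>The path is the single vertex \<open>d\<close>, adjacent to all three
          corners.\<close>
        then have "E u d" "E v d" using d zs xs pq by auto
        then show False using K4[of u v w d] t d by blast
      next
        case False
        show False
        proof (rule theta[of d u "set ys" "{w}" "{v}"])
          show "conn E (set ys)" using xs d False by (intro conn_list_set) (auto simp: successively_append_iff)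
          show "att E d (set ys)" using xs d False E_sym by (auto intro!: attI[of d "last ys"] simp: successively_append_iff)
          show "att E u (set ys)" using xs d False pq by (auto intro!: attI[of u p])
          show "att E d {v}" using xs d zs pq E_sym by (auto intro: attI)
        qed (use d t ne D xs E_sym in \<open>auto intro: attI\<close>)
      qed
    qed
  next
    case False
    \<comment> \<open>No vertex of the path is adjacent to \<open>w\<close>, so \<open>w\<close>
      reaches the path through a further component \<open>?K\<close>, which serves as the third arm
      between \<open>w\<close> and the vertex \<open>m\<close> where it meets the path.\<close>
    obtain e where e: "e \<in> D" "E w e" using a by (auto simp: att_def)
    let ?K = "gcomp E (D - set xs) e"
    have eD: "e \<in> D - set xs" using e False by auto
    obtain m where m: "m \<in> set xs" "att E m ?K" using gcomp_att[OF D(1) xs(6) _ eD symE] xs(1) by auto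
    obtain ys zs where s: "xs = ys @ m # zs" using m split_list by meson
    have Ks: "?K \<subseteq> D - set xs" by (rule gcomp_subset[OF eD])
    have mD: "m \<in> D" using m xs by auto
    show False
    proof (rule theta[of w m "insert u (set ys)" "insert v (set zs)" ?K])
      show "conn E ?K" by (rule gcomp_conn[OF symE eD])
      show "att E w ?K" using e gcomp_self[of e E "D - set xs"] by (auto intro: attI)
      show "insert u (set ys) \<inter> insert v (set zs) = {}" using s xs ne D by auto
      show "insert u (set ys) \<inter> ?K = {}" "insert v (set zs) \<inter> ?K = {}" using s Ks D by auto
      show "w \<notin> insert u (set ys) \<union> insert v (set zs) \<union> ?K" using s Ks D xs ne by auto
      show "m \<notin> insert u (set ys) \<union> insert v (set zs) \<union> ?K" using s Ks D xs mD by auto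
      show "att E w (insert u (set ys))" "att E w (insert v (set zs))" using t E_sym by (auto intro: attI)
    qed (use cu[OF s] cv[OF s] m mD D in auto)
  qed
qed

text \<open>The choice \<open>x = y\<close> is allowed and says that \<open>X\<close> hangs at one
  cut vertex.\<close>

definition sep :: "'a \<Rightarrow> 'a \<Rightarrow> 'a set \<Rightarrow> bool" where
  "sep x y X \<longleftrightarrow> X \<subseteq> V \<and> x \<notin> X \<and> y \<notin> X \<and> (\<forall>p\<in>X. \<forall>q. E p q \<longrightarrow> q \<in> X \<or> q = x \<or> q = y)"

text \<open>All that lies behind one side of the edge \<open>xy\<close>. The degree clause rules out
  the bare cycle, where a face of length five is possible; \<open>no_long_face\<close> rests on
  it.\<close>

definition lobe :: "'a \<Rightarrow> 'a \<Rightarrow> 'a set \<Rightarrow> bool" where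
  "lobe x y X \<longleftrightarrow> E x y \<and> sep x y X \<and> (X = {} \<or> conn E X \<and> att E x X \<and> att E y X \<and> 3 \<le> deg E x)"

text \<open>A union of branches hanging at \<open>u\<close>. The last clause guarantees that
  \<open>u\<close> has degree at least three as soon as one of the hanging blocks has a nonempty
  lobe, as \<open>lobe\<close> demands.\<close>

definition pend :: "'a \<Rightarrow> 'a set \<Rightarrow> bool" where
  "pend u Z \<longleftrightarrow> u \<in> V \<and> sep u u Z \<and> (Z = {} \<or> 3 \<le> deg E u \<or> (\<exists>q. E u q \<and> q \<notin> Z))"

lemma sep_sym: "sep x y X \<Longrightarrow> sep y x X"
  by (auto simp: sep_def)

lemma sepD: "sep x y X \<Longrightarrow> p \<in> X \<Longrightarrow> E p q \<Longrightarrow> q \<in> X \<or> q = x \<or> q = y"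
  by (auto simp: sep_def)

lemma sepD': "sep x y X \<Longrightarrow> p \<in> X \<Longrightarrow> E q p \<Longrightarrow> q \<in> X \<or> q = x \<or> q = y"
  using E_sym by (auto simp: sep_def)

lemma sep_notin: "sep x y X \<Longrightarrow> x \<notin> X \<and> y \<notin> X"
  by (auto simp: sep_def)

lemma deg_ge:
  assumes "v \<in> V" "S \<subseteq> nbhd E v" shows "card S \<le> deg E v"
  using assms nb_fin by (auto simp: deg_def intro: card_mono)

lemma deg_3: "E c p \<Longrightarrow> E c q \<Longrightarrow> E c r \<Longrightarrow> p \<noteq> q \<Longrightarrow> p \<noteq> r \<Longrightarrow> q \<noteq> r \<Longrightarrow> 3 \<le> deg E c"
  using deg_ge[of c "{p, q, r}"] E_V[of c p] by (auto simp: nbhd_def)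

text \<open>The part of \<open>X\<close> behind the side \<open>cc'\<close> of a face whose new
  vertices form \<open>M\<close>.\<close>

definition reg :: "'a set \<Rightarrow> 'a set \<Rightarrow> 'a \<Rightarrow> 'a \<Rightarrow> 'a set" where
  "reg X M c c' = {p \<in> X - M. att E c (gcomp E (X - M) p) \<and> att E c' (gcomp E (X - M) p)}"

text \<open>The part of \<open>X\<close> that hangs at the face vertex \<open>c\<close> alone;
  \<open>B\<close> is the whole boundary of the face.\<close>

definition pen :: "'a set \<Rightarrow> 'a set \<Rightarrow> 'a set \<Rightarrow> 'a \<Rightarrow> 'a set" where
  "pen X M B c = {p \<in> X - M. \<forall>m\<in>B. att E m (gcomp E (X - M) p) \<longrightarrow> m = c}"

lemma reg_sub: "reg X M c c' \<subseteq> X - M" by (auto simp: reg_def)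
lemma pen_sub: "pen X M B c \<subseteq> X - M" by (auto simp: pen_def)

text \<open>Pieces of \<open>X - M\<close> inherit a two-vertex boundary once their attachments are known.\<close>

lemma piece_sep:
  assumes X: "sep x y X" and M: "M \<subseteq> X" and S: "S \<subseteq> X - M"
    and cl: "\<And>p. p \<in> S \<Longrightarrow> gcomp E (X - M) p \<subseteq> S"
    and b: "\<And>p m. p \<in> S \<Longrightarrow> m \<in> M \<union> {x, y} \<Longrightarrow> att E m (gcomp E (X - M) p) \<Longrightarrow> m = c \<or> m = c'"
    and cc: "c \<in> M \<union> {x, y}" "c' \<in> M \<union> {x, y}"
  shows "sep c c' S"
  unfolding sep_def
proof (intro conjI ballI allI impI)
  show "S \<subseteq> V" using S X by (auto simp: sep_def)
  show "c \<notin> S" "c' \<notin> S" using cc S X by (auto simp: sep_def)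
  fix p q assume p: "p \<in> S" and e: "E p q"
  have "q \<in> X \<or> q = x \<or> q = y" using sepD[OF X _ e] p S by auto
  then consider "q \<in> X - M" | "q \<in> M \<union> {x, y}" by auto
  then show "q \<in> S \<or> q = c \<or> q = c'"
  proof cases
    case 1
    then have "q \<in> gcomp E (X - M) p" using gcomp_closed[of p "X - M" p E q] gcomp_self[of p E "X - M"] p S e by auto
    then show ?thesis using cl[OF p] by auto
  next
    case 2
    have "att E q (gcomp E (X - M) p)" using gcomp_self[of p E "X - M"] e by (auto intro: attI[OF E_sym])
    then show ?thesis using b[OF p 2] by auto
  qed
qed

lemma gcomp_sub_reg: "p \<in> reg X M c c' \<Longrightarrow> gcomp E (X - M) p \<subseteq> reg X M c c'"
proof
  fix q assume p: "p \<in> reg X M c c'" and q: "q \<in> gcomp E (X - M) p"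
  then have "gcomp E (X - M) q = gcomp E (X - M) p" "q \<in> X - M"
    using gcomp_eq[OF symE _ q] gcomp_subset[of p "X - M" E] by (auto simp: reg_def)
  then show "q \<in> reg X M c c'" using p by (auto simp: reg_def)
qed

lemma gcomp_sub_pen: "p \<in> pen X M B c \<Longrightarrow> gcomp E (X - M) p \<subseteq> pen X M B c"
proof
  fix q assume p: "p \<in> pen X M B c" and q: "q \<in> gcomp E (X - M) p"
  then have "gcomp E (X - M) q = gcomp E (X - M) p" "q \<in> X - M"
    using gcomp_eq[OF symE _ q] gcomp_subset[of p "X - M" E] by (auto simp: pen_def)
  then show "q \<in> pen X M B c" using p by (auto simp: pen_def)
qed

text \<open>Two different components attached to both \<open>c\<close> and \<open>c'\<close> would
  form a theta graph with \<open>R\<close>, the rest of the boundary of the face. So the region is a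
  single component, and a neighbour of \<open>c\<close> in it, one in \<open>R\<close> and
  \<open>c'\<close> give \<open>c\<close> degree three.\<close>

lemma reg_lobe:
  assumes X: "sep x y X" and M: "M \<subseteq> X"
    and b: "\<And>p m. p \<in> reg X M c c' \<Longrightarrow> m \<in> M \<union> {x, y} \<Longrightarrow> att E m (gcomp E (X - M) p) \<Longrightarrow> m = c \<or> m = c'"
    and cc: "c \<in> M \<union> {x, y}" "c' \<in> M \<union> {x, y}" "E c c'"
    and R: "conn E R" "R \<inter> (X - M) = {}" "c \<notin> R" "c' \<notin> R" "att E c R" "att E c' R"
  shows "lobe c c' (reg X M c c')"
proof -
  let ?S = "reg X M c c'" and ?K = "\<lambda>p. gcomp E (X - M) p"
  have sp: "sep c c' ?S" by (rule piece_sep[OF X M reg_sub gcomp_sub_reg b cc(1,2)])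
  have "conn E ?S \<and> att E c ?S \<and> att E c' ?S \<and> 3 \<le> deg E c" if ne: "?S \<noteq> {}"
  proof -
    obtain p where p: "p \<in> ?S" using ne by blast
    have pX: "p \<in> X - M" using p reg_sub by blast
    have "?S \<subseteq> ?K p"
    proof
      fix q assume q: "q \<in> ?S"
      have qX: "q \<in> X - M" using q reg_sub by blast
      show "q \<in> ?K p"
      proof (rule ccontr)
        assume "q \<notin> ?K p"
        then have "?K p \<noteq> ?K q" using gcomp_self[of q E "X - M"] by auto
        note dis = gcomp_disj[OF symE pX qX this]
        show False
        proof (rule theta[of c c' "?K p" "?K q" R])
          show "?K p \<inter> R = {}" "?K q \<inter> R = {}" using gcomp_subset[OF pX, of E] gcomp_subset[OF qX, of E] R by auto
          show "c \<notin> ?K p \<union> ?K q \<union> R" "c' \<notin> ?K p \<union> ?K q \<union> R"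
            using gcomp_subset[OF pX, of E] gcomp_subset[OF qX, of E] R cc(1,2) X by (auto simp: sep_def)
        qed (use p q pX qX dis R cc E_ne[OF cc(3)] gcomp_conn[OF symE] in \<open>auto simp: reg_def\<close>)
      qed
    qed
    then have eq: "?S = ?K p" using gcomp_sub_reg[OF p] by auto
    have a: "att E c ?S" "att E c' ?S" using p eq by (auto simp: reg_def)
    obtain q where q: "q \<in> ?S" "E c q" using a by (auto simp: att_def)
    obtain r where r: "r \<in> R" "E c r" using R(5) by (auto simp: att_def)
    have "3 \<le> deg E c"
      by (rule deg_3[OF cc(3) q(2) r(2)]) (use q r R sp reg_sub[of X M c c'] in \<open>auto simp: sep_def\<close>)
    then show ?thesis using a eq gcomp_conn[OF symE pX] by simp
  qed
  then show ?thesis using sp cc(3) by (auto simp: lobe_def)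
qed

lemma pen_pend:
  assumes X: "sep x y X" and M: "M \<subseteq> X" and c: "c \<in> M \<union> {x, y}" and q: "E c q" "q \<notin> X - M"
  shows "pend c (pen X M (M \<union> {x, y}) c)"
proof -
  have "sep c c (pen X M (M \<union> {x, y}) c)"
    by (rule piece_sep[OF X M pen_sub gcomp_sub_pen _ c c]) (auto simp: pen_def)
  then show ?thesis using q pen_sub[of X M _ c] E_V[OF q(1)] by (auto simp: pend_def)
qed

subsection \<open>Decomposition of a lobe along its inner face\<close>

text \<open>Every component of \<open>X - {w}\<close> touches \<open>w\<close>, since
  \<open>X\<close> is connected. By \<open>triangle_tripod\<close> it cannot touch both
  \<open>x\<close> and \<open>y\<close>, so it lies behind \<open>xw\<close>, behind
  \<open>wy\<close>, or hangs at \<open>w\<close>.\<close>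

lemma lobe_triangle:
  assumes L: "lobe x y X" and w: "w \<in> X" "E x w" "E w y"
  obtains Xa Z Xb where "lobe x w Xa" "pend w Z" "lobe w y Xb" "X = insert w (Xa \<union> Z \<union> Xb)"
    "w \<notin> Xa" "w \<notin> Z" "w \<notin> Xb" "Xa \<inter> Z = {}" "Xa \<inter> Xb = {}" "Z \<inter> Xb = {}"
proof -
  let ?K = "gcomp E (X - {w})" and ?B = "{w} \<union> {x, y}"
  have X: "sep x y X" "conn E X" "E x y" using L w by (auto simp: lobe_def)
  have ne: "w \<noteq> x" "w \<noteq> y" "x \<noteq> y" using X w sep_notin E_ne by blast+
  have w': "E w x" "E y w" "E y x" using w X E_sym by blast+
  have aw: "att E w (?K p)" if "p \<in> X - {w}" for p
    using gcomp_att[OF X(2) _ _ that symE] w by auto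
  have nxy: False if "p \<in> X - {w}" "att E x (?K p)" "att E y (?K p)" for p
  proof (rule triangle_tripod[OF X(3) w(2) E_sym[OF w(3)], of "?K p"])
    show "conn E (?K p)" by (rule gcomp_conn[OF symE that(1)])
  qed (use that aw[OF that(1)] gcomp_subset[OF that(1), of E] sep_notin[OF X(1)] in auto)
  let ?Xa = "reg X {w} x w" and ?Xb = "reg X {w} w y" and ?Z = "pen X {w} ?B w"
  show thesis
  proof (rule that[of ?Xa ?Z ?Xb])
    show "lobe x w ?Xa"
      by (rule reg_lobe[OF X(1), of "{w}" x w "{y}"])
        (use w w' X ne nxy sep_notin[OF X(1)] in \<open>auto simp: reg_def\<close>)
    show "lobe w y ?Xb"
      by (rule reg_lobe[OF X(1), of "{w}" w y "{x}"])
        (use w w' X ne nxy sep_notin[OF X(1)] in \<open>auto simp: reg_def\<close>)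
    show "pend w ?Z" by (rule pen_pend[OF X(1), of _ _ y]) (use w sep_notin[OF X(1)] in auto)
    show "X = insert w (?Xa \<union> ?Z \<union> ?Xb)" using w aw by (auto simp: reg_def pen_def)
    show "?Xa \<inter> ?Xb = {}" using nxy by (auto simp: reg_def)
    show "?Xa \<inter> ?Z = {}" "?Z \<inter> ?Xb = {}" using ne by (auto simp: reg_def pen_def)
  qed (auto simp: reg_def pen_def)
qed

text \<open>A component that touches two opposite corners of the face \<open>x w v y\<close> would
  complete a theta graph whose other arms are the remaining two corners. What is left are the three
  sides other than \<open>xy\<close> and the slots at \<open>w\<close> and \<open>v\<close>; the
  side \<open>xy\<close> is excluded since every component touches \<open>w\<close> or
  \<open>v\<close>.\<close>

lemma lobe_square:
  assumes L: "lobe x y X" and w: "w \<in> X" "v \<in> X" "E x w" "E w v" "E v y"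
    and n: "\<not> E x v" "\<not> E w y"
  obtains Xa Z Xb Z' Xc where "lobe x w Xa" "pend w Z" "lobe w v Xb" "pend v Z'" "lobe v y Xc"
    "X = insert w (insert v (Xa \<union> Z \<union> Xb \<union> Z' \<union> Xc))"
    "{w, v} \<inter> (Xa \<union> Z \<union> Xb \<union> Z' \<union> Xc) = {}"
    "Xa \<inter> Z = {}" "Xa \<inter> Xb = {}" "Xa \<inter> Z' = {}" "Xa \<inter> Xc = {}" "Z \<inter> Xb = {}" "Z \<inter> Z' = {}" "Z \<inter> Xc = {}"
    "Xb \<inter> Z' = {}" "Xb \<inter> Xc = {}" "Z' \<inter> Xc = {}"
proof -
  let ?M = "{w, v}"
  let ?K = "gcomp E (X - ?M)" and ?B = "?M \<union> {x, y}"
  have X: "sep x y X" "conn E X" "E x y" using L w by (auto simp: lobe_def)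
  have w': "E w x" "E v w" "E y v" "E y x" using w X E_sym by blast+
  have ne: "w \<noteq> x" "w \<noteq> y" "x \<noteq> y" "v \<noteq> x" "v \<noteq> y" "v \<noteq> w" using X w sep_notin E_ne by blast+
  have K: "conn E (?K p)" "?K p \<subseteq> X - ?M" "w \<notin> ?K p" "v \<notin> ?K p" "x \<notin> ?K p" "y \<notin> ?K p" if "p \<in> X - ?M" for p
    using gcomp_conn[OF symE that] gcomp_subset[OF that, of E] sep_notin[OF X(1)] by auto
  have aw: "att E w (?K p) \<or> att E v (?K p)" if "p \<in> X - ?M" for p
    using gcomp_att[OF X(2) _ _ that symE] w by auto
  have xv: False if "p \<in> X - ?M" "att E x (?K p)" "att E v (?K p)" for p
    by (rule theta[of x v "{w}" "{y}" "?K p"]) (use that K[OF that(1)] w w' X ne in auto)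
  have wy: False if "p \<in> X - ?M" "att E w (?K p)" "att E y (?K p)" for p
    by (rule theta[of w y "{v}" "{x}" "?K p"]) (use that K[OF that(1)] w w' X ne in auto)
  have xy: False if "p \<in> X - ?M" "att E x (?K p)" "att E y (?K p)" for p
    using aw[OF that(1)] xv[OF that(1,2)] wy[OF that(1) _ that(3)] by blast
  let ?Xa = "reg X ?M x w" and ?Xb = "reg X ?M w v" and ?Xc = "reg X ?M v y" and ?Z = "pen X ?M ?B w" and ?Z' = "pen X ?M ?B v"
  show thesis
  proof (rule that[of ?Xa ?Z ?Xb ?Z' ?Xc])
    show "lobe x w ?Xa"
      by (rule reg_lobe[OF X(1), of ?M x w "{v, y}"])
        (use w w' X ne xv wy xy sep_notin[OF X(1)] conn_pair[OF symE w(5)] in \<open>auto simp: reg_def\<close>)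
    show "lobe w v ?Xb"
      by (rule reg_lobe[OF X(1), of ?M w v "{x, y}"])
        (use w w' X ne xv wy xy sep_notin[OF X(1)] conn_pair[OF symE X(3)] in \<open>auto simp: reg_def\<close>)
    show "lobe v y ?Xc"
      by (rule reg_lobe[OF X(1), of ?M v y "{x, w}"])
        (use w w' X ne xv wy xy sep_notin[OF X(1)] conn_pair[OF symE w(3)] in \<open>auto simp: reg_def\<close>)
    show "pend w ?Z" by (rule pen_pend[OF X(1), of _ _ x]) (use w E_sym sep_notin[OF X(1)] in auto)
    show "pend v ?Z'" by (rule pen_pend[OF X(1), of _ _ y]) (use w sep_notin[OF X(1)] in auto)
    show "X = insert w (insert v (?Xa \<union> ?Z \<union> ?Xb \<union> ?Z' \<union> ?Xc))"
    proof
      show "X \<subseteq> insert w (insert v (?Xa \<union> ?Z \<union> ?Xb \<union> ?Z' \<union> ?Xc))"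
      proof
        fix p assume "p \<in> X"
        show "p \<in> insert w (insert v (?Xa \<union> ?Z \<union> ?Xb \<union> ?Z' \<union> ?Xc))"
        proof (cases "p \<in> ?M")
          case False
          with \<open>p \<in> X\<close> have p: "p \<in> X - ?M" by auto
          show ?thesis using aw[OF p] xv[OF p] wy[OF p] xy[OF p] p by (auto simp: reg_def pen_def)
        qed auto
      qed
    qed (use w in \<open>auto simp: reg_def pen_def\<close>)
    show "{w, v} \<inter> (?Xa \<union> ?Z \<union> ?Xb \<union> ?Z' \<union> ?Xc) = {}" by (auto simp: reg_def pen_def)
    show "?Xa \<inter> ?Z = {}" "?Z \<inter> ?Xb = {}" "?Z \<inter> ?Xc = {}" "?Xa \<inter> ?Z' = {}" "?Xb \<inter> ?Z' = {}" "?Z' \<inter> ?Xc = {}" "?Z \<inter> ?Z' = {}"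
      using ne aw by (auto simp: reg_def pen_def)
    show "?Xa \<inter> ?Xb = {}" "?Xa \<inter> ?Xc = {}" "?Xb \<inter> ?Xc = {}" using xv wy xy by (auto simp: reg_def)
  qed
qed

subsection \<open>Levels across a separation\<close>

lemma level_le: "level E x y b \<le> 2" by (simp add: level_def)

text \<open>Every walk from a neighbour of \<open>x\<close> into \<open>S\<close> passes through
  \<open>y\<close> or \<open>r\<close>. Those through \<open>y\<close> do not count, so level 1 is
  all that is possible, and only directly behind an \<open>r\<close> of level 2.\<close>

lemma level_beyond:
  assumes S: "sep y r S" and x: "x \<notin> S" "x \<noteq> r" "x \<noteq> y" and r: "E y r" and b: "b \<in> S"
  shows "level E x y b \<le> of_bool (E r b \<and> level E x y r = 2)"
proof -
  have nx: "\<not> E x p" if "p \<in> S" for p using sepD'[OF S that] x by blast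
  have n2: "\<not> (E x a \<and> \<not> E y a \<and> a \<noteq> y \<and> E a b)" for a
    using sepD'[OF S b, of a] nx r by blast
  have r2: "E r b \<and> level E x y r = 2" if "E x s" "E y s" "E s b" for s
    using sepD'[OF S b that(3)] nx that by (auto simp: level_def)
  have r3: "E r b \<and> level E x y r = 2" if "E x a" "\<not> E y a" "a \<noteq> y" "E a c" "E c b" for a c
    using sepD'[OF S b that(5)]
  proof (elim disjE)
    assume "c \<in> S"
    then show ?thesis using sepD'[OF S _ that(4)] nx that r by blast
  next
    assume "c = y" then show ?thesis using that E_sym by blast
  next
    assume c: "c = r" then show ?thesis using that by (auto simp: level_def)
  qed
  show ?thesis
  proof (cases "E r b \<and> level E x y r = 2")
    case True
    then show ?thesis using nx[OF b] n2 by (simp add: level_def)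
  next
    case False
    then show ?thesis using nx[OF b] n2 r2 r3 unfolding level_def by auto
  qed
qed

text \<open>Behind the cut vertex \<open>y\<close> nothing is reached except through
  \<open>y\<close> itself.\<close>

lemma level_pend:
  assumes S: "sep y y S" and x: "x \<notin> S" "x \<noteq> y" and b: "b \<in> S"
  shows "level E x y b = 0"
proof -
  have nx: "\<not> E x p" if "p \<in> S" for p using sepD'[OF S that] x by blast
  have n2: "\<not> (E x a \<and> \<not> E y a \<and> a \<noteq> y \<and> E a b)" "\<not> (E x a \<and> E y a \<and> E a b)" for a
    using sepD'[OF S b, of a] nx by auto
  moreover have "\<not> (E x a \<and> \<not> E y a \<and> a \<noteq> y \<and> E a c \<and> E c b)" for a c
    using sepD'[OF S b, of c] sepD'[OF S, of c a] nx E_sym by blast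
  ultimately show ?thesis using nx[OF b] unfolding level_def by auto
qed

definition tcount :: "'a \<Rightarrow> 'a \<Rightarrow> 'a set \<Rightarrow> nat" where
  "tcount x y Y = card (nbhd E x \<inter> nbhd E y \<inter> Y)"

definition score :: "'a \<Rightarrow> 'a \<Rightarrow> 'a set \<Rightarrow> nat" where
  "score x y Y = (\<Sum>b\<in>nbhd E y \<inter> Y. level E x y b)"

lemma tcount_comm: "tcount x y Y = tcount y x Y" by (simp add: tcount_def Int_commute)

lemma tcount_empty [simp]: "tcount x y {} = 0" and score_empty [simp]: "score x y {} = 0"
  by (auto simp: tcount_def score_def)

text \<open>When \<open>r\<close> is the next neighbour of \<open>y\<close> around the face, it
  contributes at most 2. Behind it only common neighbours of \<open>y\<close> and \<open>r\<close>
  contribute, 1 each and only if \<open>r\<close> has level 2.\<close>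

lemma score_next:
  assumes xy: "E x y" and S: "sep y r S" and x: "x \<notin> S" "x \<noteq> r" and r: "E y r"
    and Y: "nbhd E y \<inter> Y \<subseteq> insert r S"
  shows "score x y Y \<le> 2 + tcount y r S" and "level E x y r \<le> 1 \<Longrightarrow> score x y Y \<le> 1"
proof -
  have fin: "finite (nbhd E y \<inter> Y)" "finite (nbhd E y \<inter> S)" "finite (nbhd E y)" using nb_fin E_V[OF xy] by auto
  have rS: "r \<notin> S" using sep_notin[OF S] by auto
  have b: "level E x y b \<le> of_bool (E r b \<and> level E x y r = 2)" if "b \<in> S" for b
    using level_beyond[OF S x E_ne[OF xy] r that] .
  have "score x y Y \<le> (\<Sum>b\<in>insert r (nbhd E y \<inter> S). level E x y b)"
    unfolding score_def by (rule sum_mono2) (use fin Y in auto)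
  also have "\<dots> = level E x y r + (\<Sum>b\<in>nbhd E y \<inter> S. level E x y b)" using fin rS by simp
  also have "(\<Sum>b\<in>nbhd E y \<inter> S. level E x y b) \<le> (\<Sum>b\<in>nbhd E y \<inter> S. of_bool (E r b \<and> level E x y r = 2))"
    by (rule sum_mono) (use b in auto)
  finally have 1: "score x y Y \<le> level E x y r + (\<Sum>b\<in>nbhd E y \<inter> S. of_bool (E r b \<and> level E x y r = 2))" by simp
  have "(\<Sum>b\<in>nbhd E y \<inter> S. of_bool (E r b \<and> level E x y r = 2)) \<le> (\<Sum>b\<in>nbhd E y \<inter> S. of_bool (E r b) :: nat)"
    by (rule sum_mono) auto
  also have "\<dots> = card (nbhd E y \<inter> S \<inter> {b. E r b})" using fin by (simp add: sum.If_cases of_bool_def)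
  also have "nbhd E y \<inter> S \<inter> {b. E r b} = nbhd E y \<inter> nbhd E r \<inter> S" by (auto simp: nbhd_def)
  finally show "score x y Y \<le> 2 + tcount y r S" using 1 level_le[of x y r] by (simp add: tcount_def)
  show "score x y Y \<le> 1" if "level E x y r \<le> 1" using 1 that by simp
qed

lemma tcount_le_1: "(\<And>z. z \<in> Y \<Longrightarrow> E x z \<Longrightarrow> E y z \<Longrightarrow> z = w) \<Longrightarrow> tcount x y Y \<le> 1"
  unfolding tcount_def using card_mono[of "{w}" "nbhd E x \<inter> nbhd E y \<inter> Y"] by (auto simp: nbhd_def)

lemma tcount_0: "(\<And>z. z \<in> Y \<Longrightarrow> E x z \<Longrightarrow> E y z \<Longrightarrow> False) \<Longrightarrow> tcount x y Y = 0"
  unfolding tcount_def by (subst card_eq_0_iff) (auto simp: nbhd_def)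

text \<open>The instance of \<open>score_next\<close> where \<open>w\<close> comes next at
  \<open>y\<close>: separation leaves \<open>y\<close> no neighbours in \<open>X\<close> beyond
  \<open>w\<close> and \<open>Xb\<close>.\<close>

lemma triangle_score:
  assumes xy: "E x y" and sX: "sep x y X" and a: "sep x w Xa" "sep w w Z" "sep w y Xb"
    and w: "E x w" "E w y" and X: "X = insert w (Xa \<union> Z \<union> Xb)"
  shows "score x y X \<le> 2 + tcount w y Xb" "tcount x y X \<le> 1"
proof -
  have ny: "\<not> E y b" if "b \<in> Xa \<union> Z" for b
    using that sepD'[OF a(1), of b y] sepD'[OF a(2), of b y] sep_notin[OF sX] E_ne[OF xy] E_ne[OF w(2)] X by blast
  have nx: "\<not> E x b" if "b \<in> Xb" for b
    using that sepD'[OF a(3), of b x] sep_notin[OF sX] E_ne[OF xy] E_ne[OF w(1)] X by blast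
  have "score x y X \<le> 2 + tcount y w Xb"
    by (rule score_next(1)[OF xy sep_sym[OF a(3)]])
      (use nx ny X E_sym[OF w(2)] E_ne[OF w(1)] sep_notin[OF sX] in \<open>auto simp: nbhd_def\<close>)
  then show "score x y X \<le> 2 + tcount w y Xb" by (simp add: tcount_comm)
  show "tcount x y X \<le> 1" by (rule tcount_le_1[of _ _ _ w]) (use nx ny X in auto)
qed

lemma square_score:
  assumes xy: "E x y" and sX: "sep x y X" and a: "sep x w Xa" "sep w w Z" "sep w v Xb" "sep v v Z'" "sep v y Xc"
    and w: "E x w" "E w v" "E v y" "\<not> E x v" "\<not> E w y" and X: "X = insert w (insert v (Xa \<union> Z \<union> Xb \<union> Z' \<union> Xc))"
  shows "score x y X \<le> 2 + tcount v y Xc" "tcount x y X = 0"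
proof -
  have nXy: "x \<notin> X" "y \<notin> X" using sep_notin[OF sX] by auto
  have ny: "\<not> E y b" if "b \<in> Xa \<union> Z \<union> Xb \<union> Z'" for b
    using that sepD'[OF a(1), of b y] sepD'[OF a(2), of b y] sepD'[OF a(3), of b y] sepD'[OF a(4), of b y] nXy X E_ne[OF xy] by blast
  have nx: "\<not> E x b" if "b \<in> Xc" for b
    using that sepD'[OF a(5), of b x] nXy E_ne[OF xy] X by blast
  have wy: "\<not> E y w" using w E_sym by blast
  have xv: "x \<noteq> v" using nXy X by blast
  have "score x y X \<le> 2 + tcount y v Xc"
    by (rule score_next(1)[OF xy sep_sym[OF a(5)]])
      (use nx ny X E_sym[OF w(3)] wy xv nXy in \<open>auto simp: nbhd_def\<close>)
  then show "score x y X \<le> 2 + tcount v y Xc" by (simp add: tcount_comm)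
  show "tcount x y X = 0" by (rule tcount_0) (use nx ny wy w X in auto)
qed

text \<open>With no triangle and no square at \<open>xy\<close>, a neighbour of \<open>y\<close> in
  \<open>X\<close> has level at most 1, reached by a walk \<open>x a c b\<close>. Only one
  \<open>b\<close> is reached in this way, by the theta argument along the cycle
  \<open>x a c b y\<close>.\<close>

lemma long_score:
  assumes xy: "E x y" and X: "sep x y X" "conn E X"
    and long: "\<forall>z\<in>X. \<not> (E x z \<and> E z y)" "\<forall>a\<in>X. \<forall>b\<in>X. \<not> (E x a \<and> E a b \<and> E b y)"
  shows "score x y X \<le> 1" "tcount x y X = 0"
proof -
  have n1: "False" if "z \<in> X" "E x z" "E z y" for z using long that by blast
  have n2: "False" if "a \<in> X" "b \<in> X" "E x a" "E a b" "E b y" for a b using long that by blast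
  define P where "P b \<longleftrightarrow> (\<exists>a c. a \<in> X \<and> c \<in> X \<and> E x a \<and> E a c \<and> E c b)" for b
  have nXy: "x \<notin> X" "y \<notin> X" "x \<noteq> y" using sep_notin[OF X(1)] E_ne[OF xy] by auto
  have lev: "level E x y b \<le> of_bool (P b)" if b: "b \<in> X" "E y b" for b
  proof -
    have yb: "E b y" using b E_sym by blast
    have bx: "\<not> E x b" using n1[OF b(1) _ yb] by blast
    have in1: "a \<in> X" if "E a b" "a \<noteq> y" for a using sepD'[OF X(1) b(1) that(1)] that bx by auto
    have 1: "\<not> (E x a \<and> \<not> E y a \<and> a \<noteq> y \<and> E a b)" for a using in1[of a] n2[OF _ b(1) _ _ yb] by blast
    have 2: "\<not> (E x s \<and> E y s \<and> E s b)" for s using in1[of s] n1[of s] E_sym E_ne[of y s] by blast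
    have 3: "P b" if "E x a" "\<not> E y a" "a \<noteq> y" "E a c" "E c b" for a c
    proof -
      have "c \<noteq> y" using that E_sym by blast
      then have "c \<in> X" using in1 that by blast
      then have "a \<in> X" using sepD'[OF X(1) _ that(4)] that by auto
      then show ?thesis using \<open>c \<in> X\<close> that by (auto simp: P_def)
    qed
    show ?thesis using bx 1 2 3 unfolding level_def by auto
  qed
  \<comment> \<open>Let \<open>?K\<close> be the component of \<open>b'\<close> off the cycle
    \<open>x a c b y\<close>. It touches \<open>y\<close>, hence by \<open>cycle_theta\<close>
    neither \<open>a\<close> nor \<open>c\<close>; being attached to the path \<open>a c b\<close>
    it touches \<open>b\<close>, hence not \<open>x\<close>. But the walk from \<open>b'\<close>
    over \<open>c'\<close> to \<open>a'\<close> stays in \<open>?K\<close>, and \<open>a'\<close> is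
    adjacent to \<open>x\<close>.\<close>
  have uniq: "b = b'" if b: "b \<in> X" "E y b" "P b" and b': "b' \<in> X" "E y b'" "P b'" for b b'
  proof (rule ccontr)
    assume ne: "b \<noteq> b'"
    obtain a c where ac: "a \<in> X" "c \<in> X" "E x a" "E a c" "E c b" using b by (auto simp: P_def)
    obtain a' c' where ac': "a' \<in> X" "c' \<in> X" "E x a'" "E a' c'" "E c' b'" using b' by (auto simp: P_def)
    have ys: "E b y" "E b' y" "E b' c'" "E c' a'" using b b' ac' E_sym by blast+
    have d: "a \<noteq> c" "c \<noteq> b" "a \<noteq> b" using ac n1[OF ac(1)] ys by auto
    let ?M = "{a, c, b}"
    have b'M: "b' \<in> X - ?M" using b' n1[OF b'(1) _ ys(2)] n2[OF ac(1) b'(1) ac(3) _ ys(2)] ac ne by auto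
    let ?K = "gcomp E (X - ?M) b'"
    have K: "conn E ?K" "?K \<subseteq> X - ?M" using gcomp_conn[OF symE b'M] gcomp_subset[OF b'M] by auto
    have bK: "b' \<in> ?K" by (rule gcomp_self)
    have Ky: "att E y ?K" using b'(2) bK by (rule attI)
    have dis: "?K \<inter> set [x, a, c, b, y] = {}" using K nXy by auto
    have cyc: "distinct [x, a, c, b, y]" "successively E [x, a, c, b, y]" "E y x" using d nXy ac b ys xy E_sym by auto
    have na: "\<not> att E a ?K" using cycle_theta[of "[x]" a "[c, b]" y "[]" ?K] cyc dis K Ky by auto
    have nc: "\<not> att E c ?K" using cycle_theta[of "[x, a]" c "[b]" y "[]" ?K] cyc dis K Ky by auto
    have "\<exists>m\<in>?M. att E m ?K" by (rule gcomp_att[OF X(2) _ _ b'M symE]) (use ac b in auto)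
    then have Kb: "att E b ?K" using na nc by auto
    have nx: "\<not> att E x ?K" using cycle_theta[of "[]" x "[a, c]" b "[y]" ?K] cyc dis K Kb by auto
    have c'M: "c' \<notin> ?M"
      using n2[OF ac(1) b'(1) ac(3) _ ys(2)] n2[OF ac'(1) b(1) ac'(3) _ ys(1)] ac' nc attI[OF _ bK, of c] by auto
    have c'K: "c' \<in> ?K" using gcomp_closed[OF b'M bK _ ys(3)] c'M ac' by auto
    have "a' \<notin> ?M" using na nc attI[OF ac'(4) c'K] n1[OF b(1) _ ys(1)] ac' by auto
    then have "a' \<in> ?K" using gcomp_closed[OF b'M c'K _ ys(4)] ac' by auto
    then show False using nx ac' attI by blast
  qed
  have fin: "finite (nbhd E y \<inter> X)" using nb_fin E_V[OF xy] by auto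
  have "score x y X \<le> (\<Sum>b\<in>nbhd E y \<inter> X. of_bool (P b))"
    unfolding score_def by (rule sum_mono) (use lev in \<open>auto simp: nbhd_def\<close>)
  also have "\<dots> = card (nbhd E y \<inter> X \<inter> {b. P b})" using fin by (simp add: sum.If_cases of_bool_def)
  also have "\<dots> \<le> 1" using uniq fin by (intro card_le_Suc0_iff_eq[THEN iffD2, unfolded One_nat_def[symmetric]]) (auto simp: nbhd_def)
  finally show "score x y X \<le> 1" .
  show "tcount x y X = 0" by (rule tcount_0) (use n1 E_sym in blast)
qed

lemma lobe_cases:
  assumes "lobe x y X" "X \<noteq> {}"
  obtains (triangle) w where "w \<in> X" "E x w" "E w y"
  | (square) w v where "w \<in> X" "v \<in> X" "E x w" "E w v" "E v y" "\<not> E x v" "\<not> E w y"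
  | (long) "\<forall>z\<in>X. \<not> (E x z \<and> E z y)" "\<forall>a\<in>X. \<forall>b\<in>X. \<not> (E x a \<and> E a b \<and> E b y)"
  by blast

text \<open>Bounds for a lobe about which nothing is known: 2 for the next vertex of the inner face
  plus at most 1 for a common neighbour behind it.\<close>

lemma lobe_score:
  assumes L: "lobe x y X"
  shows "score x y X \<le> 3 \<and> score y x X \<le> 3 \<and> tcount x y X \<le> 1"
proof -
  have tc: "tcount x' y' X' \<le> 1" if L': "lobe x' y' X'" for x' y' X'
  proof (cases "X' = {}")
    case False
    have sp: "E x' y'" "sep x' y' X'" "conn E X'" using L' False by (auto simp: lobe_def)
    from L' False show ?thesis
    proof (cases rule: lobe_cases)
      case (triangle w)
      from lobe_triangle[OF L' triangle] obtain Xa Z Xb where d: "lobe x' w Xa" "pend w Z" "lobe w y' Xb" "X' = insert w (Xa \<union> Z \<union> Xb)" by blast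
      show ?thesis by (rule triangle_score(2)[OF sp(1,2) _ _ _ triangle(2,3) d(4)]) (use d in \<open>auto simp: lobe_def pend_def\<close>)
    next
      case (square w v)
      from lobe_square[OF L' square] obtain Xa Z Xb Z' Xc where d: "lobe x' w Xa" "pend w Z" "lobe w v Xb" "pend v Z'" "lobe v y' Xc"
        "X' = insert w (insert v (Xa \<union> Z \<union> Xb \<union> Z' \<union> Xc))" by metis
      have "tcount x' y' X' = 0"
        by (rule square_score(2)[OF sp(1,2) _ _ _ _ _ square(3-7) d(6)]) (use d in \<open>auto simp: lobe_def pend_def\<close>)
      then show ?thesis by simp
    next
      case long
      show ?thesis using long_score(2)[OF sp long] by simp
    qed
  qed simp
  show ?thesis
  proof (cases "X = {}")
    case False
    have sp: "E x y" "sep x y X" "conn E X" using L False by (auto simp: lobe_def)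
    note sp' = E_sym[OF sp(1)] sep_sym[OF sp(2)]
    from L False show ?thesis
    proof (cases rule: lobe_cases)
      case (triangle w)
      from lobe_triangle[OF L triangle] obtain Xa Z Xb where d: "lobe x w Xa" "pend w Z" "lobe w y Xb" "X = insert w (Xa \<union> Z \<union> Xb)" by blast
      have s: "sep x w Xa" "sep w w Z" "sep w y Xb" using d by (auto simp: lobe_def pend_def)
      have "X = insert w (Xb \<union> Z \<union> Xa)" using d by auto
      note 1 = triangle_score[OF sp(1,2) s triangle(2,3) d(4)]
        and 2 = triangle_score[OF sp' sep_sym[OF s(3)] s(2) sep_sym[OF s(1)] E_sym[OF triangle(3)] E_sym[OF triangle(2)] this]
      have "tcount w x Xa \<le> 1" using tc[OF d(1)] by (simp add: tcount_comm)
      then show ?thesis using 1 2 tc[OF d(3)] by linarith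
    next
      case (square w v)
      from lobe_square[OF L square] obtain Xa Z Xb Z' Xc where d: "lobe x w Xa" "pend w Z" "lobe w v Xb" "pend v Z'" "lobe v y Xc"
        "X = insert w (insert v (Xa \<union> Z \<union> Xb \<union> Z' \<union> Xc))" by metis
      have s: "sep x w Xa" "sep w w Z" "sep w v Xb" "sep v v Z'" "sep v y Xc" using d by (auto simp: lobe_def pend_def)
      have X': "X = insert v (insert w (Xc \<union> Z' \<union> Xb \<union> Z \<union> Xa))" using d by auto
      have n: "\<not> E y w" "\<not> E v x" using square E_sym by blast+
      note 1 = square_score[OF sp(1,2) s square(3-7) d(6)]
        and 2 = square_score[OF sp' sep_sym[OF s(5)] s(4) sep_sym[OF s(3)] s(2) sep_sym[OF s(1)] E_sym[OF square(5)] E_sym[OF square(4)] E_sym[OF square(3)] n X']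
      have "tcount w x Xa \<le> 1" using tc[OF d(1)] by (simp add: tcount_comm)
      then show ?thesis using 1 2 tc[OF d(5)] by linarith
    next
      case long
      note l = long_score[OF sp long]
      have "score y x X \<le> 1" by (rule long_score(1)[OF sp' sp(3)]) (use long E_sym in blast)+
      with l show ?thesis by linarith
    qed
  qed simp
qed

lemma law_bound:
  assumes "E x y" "d \<le> deg E x" "e \<le> deg E y" "card (nbhd E x \<inter> nbhd E y) \<le> T" "score x y (- {x}) \<le> S"
    "0 < d" "0 < e" "(2 + T) * e + (2 + S) * d \<le> 2 * d * e"
  shows False
proof -
  have "score x y (- {x}) = (\<Sum>b\<in>nbhd E y - {x}. level E x y b)" by (simp add: score_def Diff_eq)
  then show False using law[OF assms(1)] law_violated_mono[OF assms(8,6,7,2,3,4,5)] by simp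
qed

lemma score_split:
  assumes "y \<in> V" "nbhd E y \<inter> Y \<subseteq> Y1 \<union> Y2" shows "score x y Y \<le> score x y Y1 + score x y Y2"
proof -
  have "score x y Y \<le> (\<Sum>b\<in>(nbhd E y \<inter> Y1) \<union> (nbhd E y \<inter> Y2). level E x y b)"
    unfolding score_def by (rule sum_mono2) (use assms nb_fin in auto)
  also have "\<dots> \<le> score x y Y1 + score x y Y2"
    unfolding score_def using nb_fin[OF assms(1)] by (simp add: sum_Un_nat)
  finally show ?thesis .
qed

subsection \<open>No long faces\<close>

text \<open>A path through \<open>X\<close> of minimal length has no shortcuts; the last three
  clauses spell this out for a shortcut at \<open>x\<close>, at \<open>y\<close>, and between two
  inner vertices.\<close>

lemma shortest_path:
  assumes X: "sep x y X" "conn E X" "att E x X" "att E y X"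
  obtains ws where "ws \<noteq> []" "set ws \<subseteq> X" "distinct ws" "successively E ws" "E x (hd ws)" "E (last ws) y"
    "\<forall>A b C. ws = A @ b # C \<longrightarrow> E x b \<longrightarrow> A = []"
    "\<forall>A b C. ws = A @ b # C \<longrightarrow> E b y \<longrightarrow> C = []"
    "\<forall>A a M b C. ws = A @ a # M @ b # C \<longrightarrow> E a b \<longrightarrow> M = []"
proof -
  define P where "P us \<longleftrightarrow> us \<noteq> [] \<and> set us \<subseteq> X \<and> distinct us \<and> successively E us \<and> E x (hd us) \<and> E (last us) y" for us
  obtain p q where "p \<in> X" "E x p" "q \<in> X" "E y q" using X by (auto simp: att_def)
  then obtain us where "P us" using conn_path[OF X(2), of p q] E_sym unfolding P_def by metis
  then obtain ws where ws: "P ws" "\<And>us. P us \<Longrightarrow> length ws \<le> length us"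
    using ex_has_least_nat[of P us length] by blast
  show thesis
  proof (rule that[of ws])
    show "\<forall>A b C. ws = A @ b # C \<longrightarrow> E x b \<longrightarrow> A = []"
    proof (intro allI impI)
      fix A b C assume s: "ws = A @ b # C" "E x b"
      have "P (b # C)" using ws(1) s(2) unfolding P_def s(1) by (auto simp: successively_append_iff)
      from ws(2)[OF this] s show "A = []" by simp
    qed
    show "\<forall>A b C. ws = A @ b # C \<longrightarrow> E b y \<longrightarrow> C = []"
    proof (intro allI impI)
      fix A b C assume s: "ws = A @ b # C" "E b y"
      have "successively E (A @ [b])" using ws(1) unfolding P_def s(1) by (auto simp: successively_append_iff)
      then have "P (A @ [b])" using ws(1) s(2) unfolding P_def s(1) by (cases A) auto
      from ws(2)[OF this] s show "C = []" by simp
    qed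
    show "\<forall>A a M b C. ws = A @ a # M @ b # C \<longrightarrow> E a b \<longrightarrow> M = []"
    proof (intro allI impI)
      fix A a M b C assume s: "ws = A @ a # M @ b # C" "E a b"
      have "successively E (A @ a # b # C)" using ws(1) s(2) unfolding P_def s(1)
        by (auto simp: successively_append_iff successively_Cons)
      then have "P (A @ a # b # C)" using ws(1) s(2) unfolding P_def s(1) by (cases A) auto
      from ws(2)[OF this] s show "M = []" by simp
    qed
  qed (use ws in \<open>auto simp: P_def\<close>)
qed

text \<open>The shortest path \<open>ws\<close> closes with \<open>xy\<close> to a face of length at
  least five, and the law is tested on its edges \<open>x w1\<close>, \<open>w1 w2\<close> and
  \<open>w2 w3\<close>. An empty lobe behind one of them makes its bounds too small for degree
  three; if all three lobes are nonempty, the degrees of \<open>w1\<close> and \<open>w2\<close> are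
  too large for the edge \<open>w1 w2\<close>.\<close>

lemma no_long_face:
  assumes L: "lobe x y X" "X \<noteq> {}"
    and long: "\<forall>z\<in>X. \<not> (E x z \<and> E z y)" "\<forall>a\<in>X. \<forall>b\<in>X. \<not> (E x a \<and> E a b \<and> E b y)"
  shows False
proof -
  have n1: "False" if "z \<in> X" "E x z" "E z y" for z using long that by blast
  have n2: "False" if "a \<in> X" "b \<in> X" "E x a" "E a b" "E b y" for a b using long that by blast
  have X: "sep x y X" "conn E X" "att E x X" "att E y X" "E x y" "3 \<le> deg E x" using L by (auto simp: lobe_def)
  have nXy: "x \<notin> X" "y \<notin> X" "x \<noteq> y" using sep_notin[OF X(1)] E_ne[OF X(5)] by auto
  obtain ws where ws: "ws \<noteq> []" "set ws \<subseteq> X" "distinct ws" "successively E ws" "E x (hd ws)" "E (last ws) y"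
    and m1: "\<forall>A b C. ws = A @ b # C \<longrightarrow> E x b \<longrightarrow> A = []"
    and m2: "\<forall>A b C. ws = A @ b # C \<longrightarrow> E b y \<longrightarrow> C = []"
    and m3: "\<forall>A a M b C. ws = A @ a # M @ b # C \<longrightarrow> E a b \<longrightarrow> M = []"
    using shortest_path[OF X(1-4)] .
  note i1 = m1[rule_format] and i2 = m2[rule_format] and i3 = m3[rule_format]
  obtain w1 w2 w3 rs where W: "ws = w1 # w2 # w3 # rs"
  proof -
    obtain w1 zs where 1: "ws = w1 # zs" using ws(1) by (cases ws) auto
    then obtain w2 us where 2: "zs = w2 # us" using n1[of w1] ws by (cases zs) auto
    then obtain w3 rs where "us = w3 # rs" using n2[of w1 w2] ws 1 by (cases us) auto
    then show thesis using that 1 2 by blast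
  qed
  have w: "w1 \<in> X" "w2 \<in> X" "w3 \<in> X" "E x w1" "E w1 w2" "E w2 w3" "w1 \<noteq> w2" "w1 \<noteq> w3" "w2 \<noteq> w3"
    using ws W by (auto simp: successively_Cons)
  have w': "E w1 x" "E w2 w1" "E w3 w2" "E y x" using w X E_sym by blast+
  have ne: "w1 \<noteq> x" "w2 \<noteq> x" "w3 \<noteq> x" "w1 \<noteq> y" "w2 \<noteq> y" "w3 \<noteq> y" using w nXy by blast+
  let ?M = "set ws"
  let ?K = "\<lambda>p. gcomp E (X - ?M) p"
  have cyc: "distinct (x # ws @ [y])" "successively E (x # ws @ [y])" "E (last (x # ws @ [y])) (hd (x # ws @ [y]))"
    using ws nXy w' by (auto simp: successively_Cons successively_append_iff)
  have K: "conn E (?K p)" "?K p \<inter> set (x # ws @ [y]) = {}" if "p \<in> X - ?M" for p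
    using gcomp_conn[OF symE that] gcomp_subset[OF that, of E] nXy by auto
  have aK: "att E c (?K p)" if "E c p" for c p using attI[OF that gcomp_self] .
  \<comment> \<open>By \<open>cycle_theta\<close> along the face, a component attached to one of
    \<open>x\<close>, \<open>w1\<close>, \<open>w2\<close> does not reach a later vertex of the face
    beyond the next one; \<open>Tx\<close> leaves out \<open>y\<close>, which is consecutive to
    \<open>x\<close>.\<close>
  have Tx: False if h: "p \<in> X - ?M" "att E x (?K p)" "c \<in> set (w2 # w3 # rs)" "att E c (?K p)" for p c
  proof -
    obtain B C where s: "w2 # w3 # rs = B @ c # C" using h(3) split_list by meson
    have "x # ws @ [y] = [] @ x # (w1 # B) @ c # (C @ [y])" using s W by simp
    then show False using cycle_theta[of "[]" x "w1 # B" c "C @ [y]" "?K p"] cyc K[OF h(1)] h by auto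
  qed
  have T1: False if h: "p \<in> X - ?M" "att E w1 (?K p)" "c \<in> insert y (set (w3 # rs))" "att E c (?K p)" for p c
  proof -
    obtain B C where s: "w3 # rs @ [y] = B @ c # C" using h(3) split_list[of c "w3 # rs @ [y]"] by auto
    have "x # ws @ [y] = [x] @ w1 # (w2 # B) @ c # C" using s W by simp
    then show False using cycle_theta[of "[x]" w1 "w2 # B" c C "?K p"] cyc K[OF h(1)] h by auto
  qed
  have T2: False if h: "p \<in> X - ?M" "att E w2 (?K p)" "c \<in> insert y (set rs)" "att E c (?K p)" for p c
  proof -
    obtain B C where s: "rs @ [y] = B @ c # C" using h(3) split_list[of c "rs @ [y]"] by auto
    have "x # ws @ [y] = [x, w1] @ w2 # (w3 # B) @ c # C" using s W by simp
    then show False using cycle_theta[of "[x, w1]" w2 "w3 # B" c C "?K p"] cyc K[OF h(1)] h by auto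
  qed
  have Ix: "b = w1" if h: "E x b" "b \<in> ?M" for b
  proof -
    obtain A C where s: "ws = A @ b # C" using h(2) split_list by meson
    then show ?thesis using i1[OF s h(1)] W by simp
  qed
  have Iy: "b \<noteq> w1" "b \<noteq> w2" if "E b y" for b
    using i2[of "[]" w1] i2[of "[w1]" w2] that W by auto
  have I1: "b = w2" if "E w1 b" "b \<in> ?M" for b
  proof (rule ccontr)
    assume "b \<noteq> w2"
    moreover have "b \<noteq> w1" using that(1) by auto
    ultimately have "b \<in> set (w3 # rs)" using that W by auto
    then obtain B C where "w3 # rs = B @ b # C" using split_list by meson
    then have "ws = [] @ w1 # (w2 # B) @ b # C" using W by simp
    then show False using i3[OF _ that(1)] by blast
  qed
  have I2: "b = w1 \<or> b = w3" if "E w2 b" "b \<in> ?M" for b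
  proof (rule ccontr)
    assume "\<not> (b = w1 \<or> b = w3)"
    moreover have "b \<noteq> w2" using that(1) by auto
    ultimately have "b \<in> set rs" using that W by auto
    then obtain B C where "rs = B @ b # C" using split_list by meson
    then have "ws = [w1] @ w2 # (w3 # B) @ b # C" using W by simp
    then show False using i3[OF _ that(1)] by blast
  qed
  have wM: "w1 \<in> ?M" "w2 \<in> ?M" "w3 \<in> ?M" using W by auto
  have nadj0: "\<not> E x w2" "\<not> E x w3" using Ix wM w by metis+
  have nadj1: "\<not> E w1 w3" using I1 wM w by metis
  have nadj2: "\<not> E w1 y" "\<not> E w2 y" using Iy by blast+
  have nadj: "\<not> E x w2" "\<not> E w2 x" "\<not> E w1 w3" "\<not> E w3 w1" "\<not> E w1 y" "\<not> E y w1" "\<not> E w2 y" "\<not> E y w2" "\<not> E x w3" "\<not> E w3 x"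
    using nadj0 nadj1 nadj2 E_sym by blast+
  have N1: "b = x \<or> b = w2 \<or> b \<in> X - ?M" if "E w1 b" for b
    using sepD[OF X(1) w(1) that] I1[OF that] nadj that by auto
  have N2: "b = w1 \<or> b = w3 \<or> b \<in> X - ?M" if "E w2 b" for b
    using sepD[OF X(1) w(2) that] I2[OF that] nadj that by auto
  \<comment> \<open>The parts of \<open>X\<close> behind the first three sides \<open>x w1\<close>,
    \<open>w1 w2\<close>, \<open>w2 w3\<close> of the face.\<close>
  define A0 where "A0 = reg X ?M x w1"
  define A1 where "A1 = reg X ?M w1 w2"
  define A2 where "A2 = reg X ?M w2 w3"
  have A: "A0 \<subseteq> X - ?M" "A1 \<subseteq> X - ?M" "A2 \<subseteq> X - ?M" unfolding A0_def A1_def A2_def by (rule reg_sub)+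
  have lobe1: "lobe w1 w2 A1"
    unfolding A1_def
  proof (rule reg_lobe[OF X(1) ws(2), of w1 w2 "set (w3 # rs @ [y, x])"])
    fix p m assume p: "p \<in> reg X ?M w1 w2" and m: "m \<in> ?M \<union> {x, y}" "att E m (?K p)"
    then have "p \<in> X - ?M" "att E w1 (?K p)" "att E w2 (?K p)" by (auto simp: reg_def)
    then show "m = w1 \<or> m = w2" using T1[of p m] Tx[of p w2] m W by auto
  next
    have "successively E (w3 # rs)" "E (last (w3 # rs)) y" using ws(4,6) W by simp_all
    then have "successively E ((w3 # rs) @ [y, x])" using w' unfolding successively_append_iff by simp
    then have "successively E (w3 # rs @ [y, x])" by simp
    then show "conn E (set (w3 # rs @ [y, x]))" by (rule conn_list_set) simp
  qed (use w w' W ws nXy in \<open>auto\<close>)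
  have V: "x \<in> V" "w1 \<in> V" "w2 \<in> V" "w3 \<in> V" using E_V w by blast+
  have c0: "\<exists>p\<in>A0. E w1 p" if h: "A0 \<noteq> {}"
  proof -
    obtain p where p: "p \<in> A0" using h by blast
    then have "att E w1 (?K p)" by (simp add: A0_def reg_def)
    then show ?thesis using gcomp_sub_reg[of p X ?M x w1] p by (auto simp: att_def A0_def)
  qed
  have c2: "\<exists>p\<in>A2. E w2 p" if h: "A2 \<noteq> {}"
  proof -
    obtain p where p: "p \<in> A2" using h by blast
    then have "att E w2 (?K p)" by (simp add: A2_def reg_def)
    then show ?thesis using gcomp_sub_reg[of p X ?M w2 w3] p by (auto simp: att_def A2_def)
  qed
  have dis: "A0 \<inter> A1 = {}" "A1 \<inter> A2 = {}"
    using Tx[of _ w2] T1[of _ w3] W by (auto simp: A0_def A1_def A2_def reg_def)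
  \<comment> \<open>With nothing behind \<open>x w1\<close>, the vertex next to \<open>w1\<close>
    around \<open>x\<close> is \<open>y\<close>. Its level is at most 1 because no neighbour of
    \<open>w1\<close> other than \<open>x\<close> is adjacent to \<open>y\<close>.\<close>
  have e0: "score w1 x (- {w1}) \<le> 1 \<and> card (nbhd E w1 \<inter> nbhd E x) = 0" if "A0 = {}"
  proof
    have Nx: "b = w1" if "E x b" "b \<in> X" for b
    proof (rule ccontr)
      assume "b \<noteq> w1"
      then have b: "b \<in> X - ?M" using Ix[OF that(1)] that by auto
      obtain m where "m \<in> ?M" "att E m (?K b)" using gcomp_att[OF X(2) ws(2) _ b symE] ws by auto
      then show False using Tx[OF b aK[OF that(1)], of m] aK[OF that(1)] b \<open>A0 = {}\<close> W by (auto simp: A0_def reg_def)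
    qed
    have lv: "level E w1 x y \<le> 1"
    proof -
      have "\<not> E a y" if "E w1 a" "a \<noteq> x" for a
        using N1[OF that(1)] that nadj T1[of a y] aK[OF that(1)] aK[of y a] E_sym by blast
      then show ?thesis using nadj by (auto simp: level_def)
    qed
    show "score w1 x (- {w1}) \<le> 1"
    proof (rule score_next(2)[OF w'(1) _ _ _ X(5) _ lv, of "V - X - {x, y}"])
      show "sep x y (V - X - {x, y})" using sepD'[OF X(1)] E_V by (auto simp: sep_def)
      show "nbhd E x \<inter> - {w1} \<subseteq> insert y (V - X - {x, y})" using Nx E_V by (auto simp: nbhd_def)
    qed (use w nadj ne in auto)
    have "nbhd E w1 \<inter> nbhd E x = {}"
    proof (rule equals0I)
      fix g assume "g \<in> nbhd E w1 \<inter> nbhd E x"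
      then have g: "E w1 g" "E x g" by (auto simp: nbhd_def)
      then show False using N1[of g] Nx[of g] nadj w(7) by auto
    qed
    then show "card (nbhd E w1 \<inter> nbhd E x) = 0" by simp
  qed
  \<comment> \<open>Seen from one neighbour \<open>p\<close> of \<open>w2\<close> on the face, the
    other one, \<open>r\<close>, has level at most 1: no vertex but \<open>w2\<close> is adjacent to
    both \<open>w1\<close> and \<open>w3\<close>. So the far side adds at most 1.\<close>
  have q2: "score p w2 Y \<le> 1"
    if p: "(p = w1 \<and> r = w3) \<or> (p = w3 \<and> r = w1)"
      and Y: "\<And>b. b \<in> Y \<Longrightarrow> b \<in> X - ?M \<Longrightarrow> E w2 b \<Longrightarrow> \<not> att E p (?K b)" "p \<notin> Y" for p r Y
  proof -
    let ?Q = "{b \<in> X - ?M. att E w2 (?K b) \<and> \<not> att E p (?K b)}"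
    have lv: "level E p w2 r \<le> 1"
    proof -
      have "\<not> E a r" if a: "E p a" "\<not> E w2 a" "a \<noteq> w2" for a
      proof
        assume ar: "E a r"
        have "E w1 a" "E w3 a" using p a ar E_sym by blast+
        then show False using N1[of a] a nadj T1[of a w3] aK[of w1 a] aK[of w3 a] by auto
      qed
      then show ?thesis using nadj p by (auto simp: level_def)
    qed
    have clK: "?K b \<subseteq> ?Q" if "b \<in> ?Q" for b
    proof
      fix q assume q: "q \<in> ?K b"
      have "?K q = ?K b" "q \<in> X - ?M" using gcomp_eq[OF symE _ q] gcomp_subset[of b "X - ?M" E] q that by auto
      then show "q \<in> ?Q" using that by simp
    qed
    show ?thesis
    proof (rule score_next(2)[of p w2 r ?Q Y, OF _ _ _ _ _ _ lv])
      show "sep w2 r ?Q"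
      proof (rule piece_sep[OF X(1) ws(2) _ clK])
        fix b m assume "b \<in> ?Q" "m \<in> ?M \<union> {x, y}" "att E m (?K b)"
        then show "m = w2 \<or> m = r" using Tx[of b w2] T2[of b m] p W by auto
      qed (use p W in auto)
      show "nbhd E w2 \<inter> Y \<subseteq> insert r ?Q"
      proof
        fix b assume b: "b \<in> nbhd E w2 \<inter> Y"
        then have "E w2 b" by (simp add: nbhd_def)
        then show "b \<in> insert r ?Q" using N2[of b] aK[of w2 b] Y(1)[of b] Y(2) b p by auto
      qed
    qed (use p w w' W nadj in auto)
  qed
  have e1: "score w2 w1 (- {w2}) \<le> 1" if "A1 = {}"
  proof -
    let ?Q = "{b \<in> X - ?M. att E w1 (?K b)}"
    have lv: "level E w2 w1 x \<le> 1"
    proof -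
      have "\<not> E a x" if a: "E w2 a" "\<not> E w1 a" "a \<noteq> w1" for a
        using N2[OF a(1)] a nadj Tx[of a w2] aK[of w2 a] aK[of x a] E_sym W by auto
      then show ?thesis using nadj by (auto simp: level_def)
    qed
    have clK: "?K b \<subseteq> ?Q" if "b \<in> ?Q" for b
    proof
      fix q assume q: "q \<in> ?K b"
      have "?K q = ?K b" "q \<in> X - ?M" using gcomp_eq[OF symE _ q] gcomp_subset[of b "X - ?M" E] q that by auto
      then show "q \<in> ?Q" using that by simp
    qed
    show ?thesis
    proof (rule score_next(2)[OF w'(2) _ _ _ w'(1) _ lv, of ?Q])
      show "sep w1 x ?Q"
      proof (rule piece_sep[OF X(1) ws(2) _ clK])
        fix b m assume b: "b \<in> ?Q" "m \<in> ?M \<union> {x, y}" "att E m (?K b)"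
        have "\<not> att E w2 (?K b)" using b that by (auto simp: A1_def reg_def)
        then show "m = w1 \<or> m = x" using T1[of b m] b W by auto
      qed (use W in auto)
      show "nbhd E w1 \<inter> - {w2} \<subseteq> insert x ?Q" using N1 aK by (auto simp: nbhd_def)
    qed (use ne W in auto)
  qed
  have e2: "score w3 w2 (- {w3}) \<le> 1 \<and> card (nbhd E w3 \<inter> nbhd E w2) = 0" if "A2 = {}"
  proof
    have n: "\<not> att E w3 (?K b)" if "b \<in> X - ?M" "E w2 b" for b
      using aK[OF that(2)] that \<open>A2 = {}\<close> by (auto simp: A2_def reg_def)
    show "score w3 w2 (- {w3}) \<le> 1" by (rule q2[of _ w1]) (use n in auto)
    have "nbhd E w3 \<inter> nbhd E w2 = {}"
    proof (rule equals0I)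
      fix g assume "g \<in> nbhd E w3 \<inter> nbhd E w2"
      then have g: "E w3 g" "E w2 g" by (auto simp: nbhd_def)
      then show False using N2[of g] n[of g] aK[of w3 g] nadj by auto
    qed
    then show "card (nbhd E w3 \<inter> nbhd E w2) = 0" by simp
  qed
  have t1: "card (nbhd E w1 \<inter> nbhd E w2) \<le> tcount w1 w2 A1"
  proof -
    have "nbhd E w1 \<inter> nbhd E w2 \<subseteq> A1"
    proof
      fix g assume "g \<in> nbhd E w1 \<inter> nbhd E w2"
      then have g: "E w1 g" "E w2 g" by (auto simp: nbhd_def)
      then show "g \<in> A1" using N1[of g] nadj aK[of w1 g] aK[of w2 g] by (auto simp: A1_def reg_def)
    qed
    then show ?thesis using nb_fin[OF V(2)] unfolding tcount_def by (intro card_mono) auto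
  qed
  have s1: "score w1 w2 (- {w1}) \<le> score w1 w2 A1 + 1"
  proof -
    have "score w1 w2 (- {w1}) \<le> score w1 w2 A1 + score w1 w2 (- insert w1 A1)" by (rule score_split[OF V(3)]) auto
    also have "score w1 w2 (- insert w1 A1) \<le> 1"
      by (rule q2[of _ w3]) (use aK in \<open>auto simp: A1_def reg_def\<close>)
    finally show ?thesis by simp
  qed
  have d1: "2 \<le> deg E w1" "2 \<le> deg E w2" "2 \<le> deg E w3" using md V by auto
  show False
  proof (cases "A1 = {}")
    case True
    have t: "card (nbhd E w2 \<inter> nbhd E w1) \<le> 0" using t1 True by (simp add: Int_commute)
    \<comment> \<open>For degrees 2 and 3 with \<open>t = 0\<close> and \<open>s = 1\<close> the law
      fails by equality: 2/2 + 3/3 = 2. The same equality excludes the edge \<open>w1 x\<close>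
      below, as \<open>x\<close> has degree at least three.\<close>
    have "\<not> 3 \<le> deg E w1" using law_bound[OF w'(2) d1(2) _ t e1[OF True]] by auto
    have "A0 = {}"
    proof (rule ccontr)
      assume "A0 \<noteq> {}"
      then obtain r where r: "r \<in> A0" "E w1 r" using c0 by blast
      have "x \<noteq> r" "w2 \<noteq> r" using r(1) A(1) nXy(1) wM by blast+
      then show False using deg_3[OF w'(1) w(5) r(2)] ne \<open>\<not> 3 \<le> deg E w1\<close> by auto
    qed
    then show False using law_bound[OF w'(1) d1(1) X(6), of 0 1] e0 by auto
  next
    case False
    then obtain p q where p: "p \<in> A1" "E w1 p" and q: "q \<in> A1" "E w2 q"
      using lobe1 by (auto simp: lobe_def att_def)
    have pq: "p \<noteq> x" "p \<noteq> w2" "q \<noteq> w1" "q \<noteq> w3" using p q A(2) nXy W by auto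
    have d3: "3 \<le> deg E w1" "3 \<le> deg E w2"
      using deg_3[OF w'(1) w(5) p(2)] deg_3[OF w'(2) w(6) q(2)] pq ne w by auto
    have n0: "A0 \<noteq> {}"
    proof
      assume "A0 = {}"
      from e0[OF this] show False using law_bound[OF w'(1) d3(1) X(6), of 0 1] by auto
    qed
    have n2: "A2 \<noteq> {}"
    proof
      assume "A2 = {}"
      from e2[OF this] show False using law_bound[OF w'(3) d1(3) d3(2), of 0 1] by auto
    qed
    obtain p0 where p0: "p0 \<in> A0" "E w1 p0" using c0[OF n0] by blast
    obtain p2 where p2: "p2 \<in> A2" "E w2 p2" using c2[OF n2] by blast
    have "card {x, w2, p, p0} \<le> deg E w1"
      by (rule deg_ge) (use V p p0 w w' in \<open>auto simp: nbhd_def\<close>)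
    moreover have "card {x, w2, p, p0} = 4"
      using p p0 A dis nXy W ne by (auto simp: card_insert_if)
    ultimately have d4: "4 \<le> deg E w1" by simp
    let ?m = "card (nbhd E w2 \<inter> A1)"
    have fin: "finite (nbhd E w2 \<inter> A1)" using nb_fin V by auto
    have "card ({w1, w3, p2} \<union> (nbhd E w2 \<inter> A1)) \<le> deg E w2"
      by (rule deg_ge) (use V p2 w w' in \<open>auto simp: nbhd_def\<close>)
    moreover have "card ({w1, w3, p2} \<union> (nbhd E w2 \<inter> A1)) = 3 + ?m"
    proof -
      have "card ({w1, w3, p2} \<union> (nbhd E w2 \<inter> A1)) = card {w1, w3, p2} + ?m"
        by (rule card_Un_disjoint) (use fin p2 A dis W in auto)
      moreover have "card {w1, w3, p2} = 3" using p2 A W w by (auto simp: card_insert_if)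
      ultimately show ?thesis by simp
    qed
    ultimately have dm: "3 + ?m \<le> deg E w2" by simp
    have m1: "1 \<le> ?m" using q fin by (auto simp: nbhd_def Suc_le_eq card_gt_0_iff)
    have o: "score w1 w2 A1 \<le> 3" "card (nbhd E w1 \<inter> nbhd E w2) \<le> 1" using lobe_score[OF lobe1] t1 by auto
    have "score w1 w2 A1 \<le> (\<Sum>b\<in>nbhd E w2 \<inter> A1. 2)" unfolding score_def by (rule sum_mono) (rule level_le)
    then have o2: "score w1 w2 A1 \<le> 2 * ?m" by simp
    \<comment> \<open>If \<open>?m = 1\<close>, both degrees are at least 4 and 3/4 + 5/4 = 2.
      Otherwise \<open>w2\<close> has degree at least 5 and 3/4 + 6/5 < 2.\<close>
    show False
    proof (cases "?m = 1")
      case True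
      then show False using law_bound[OF w(5) d4 _ o(2), of 4 3] s1 o2 dm by auto
    next
      case False
      then show False using law_bound[OF w(5) d4 _ o(2), of 5 4] s1 o m1 dm by auto
    qed
  qed
qed

end

section \<open>A search over lobe trees\<close>

text \<open>
  A lobe of an edge \<open>xy\<close> is what hangs behind it on one side: a tree records the inner face next to
  the edge, triangle or square, with the lobes of its other sides and, in the slots at its new
  vertices, the further blocks that hang there. \<open>Any_lobe\<close> and \<open>Any_slot\<close> are still undetermined,
  \<open>No_lobe\<close> and \<open>No_slot\<close> are empty.
\<close>

datatype lobe_tree = Any_lobe | No_lobe | Tri lobe_tree slot_tree lobe_tree
  | Quad lobe_tree slot_tree lobe_tree slot_tree lobe_tree
and slot_tree = Any_slot | No_slot | Block lobe_tree slot_tree slot_tree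

text \<open>\<open>dl\<close>, \<open>dr\<close> and \<open>ds\<close> are the numbers of neighbours
  that the tree already guarantees: in the lobe for its left end \<open>x\<close> and its right end
  \<open>y\<close>, and in the slot for its root.\<close>

fun dl :: "lobe_tree \<Rightarrow> nat" where
  "dl Any_lobe = 0" | "dl No_lobe = 0" | "dl (Tri a s b) = Suc (dl a)" | "dl (Quad a s b r c) = Suc (dl a)"

fun dr :: "lobe_tree \<Rightarrow> nat" where
  "dr Any_lobe = 0" | "dr No_lobe = 0" | "dr (Tri a s b) = Suc (dr b)" | "dr (Quad a s b r c) = Suc (dr c)"

fun ds :: "slot_tree \<Rightarrow> nat" where
  "ds Any_slot = 0" | "ds No_slot = 0" | "ds (Block l s r) = Suc (dl l + ds r)"

text \<open>Upper bound for the common neighbours of \<open>x\<close> and \<open>y\<close> in the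
  lobe; an undetermined lobe may contain one.\<close>

fun tau :: "lobe_tree \<Rightarrow> nat" where
  "tau Any_lobe = 1" | "tau No_lobe = 0" | "tau (Tri a s b) = 1" | "tau (Quad a s b r c) = 0"

definition viol1 :: "nat \<Rightarrow> nat \<Rightarrow> nat \<Rightarrow> nat \<Rightarrow> bool" where
  "viol1 d e t s \<longleftrightarrow> (2 + t) * e + (2 + s) * d \<le> 2 * d * e"

definition m2 :: "nat \<Rightarrow> nat" where "m2 n = (if n < 2 then 2 else n)"

text \<open>The law is not symmetric in the two ends, so it is tested in both directions;
  \<open>l\<close> and \<open>r\<close> bound the level sums around the left and the right end.
  \<open>m2\<close> feeds in the minimum degree.\<close>

definition viol :: "nat \<Rightarrow> nat \<Rightarrow> nat \<Rightarrow> nat \<Rightarrow> nat \<Rightarrow> bool" where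
  "viol d e t l r \<longleftrightarrow> viol1 (m2 d) (m2 e) t r \<or> viol1 (m2 e) (m2 d) t l"

text \<open>An undetermined lobe counts as bad only if both possibilities violate the law: empty, or
  nonempty with one more neighbour at each end and the maximal contributions of
  \<open>lobe_score\<close>.\<close>

fun ebad :: "lobe_tree \<Rightarrow> nat \<Rightarrow> nat \<Rightarrow> nat \<Rightarrow> nat \<Rightarrow> nat \<Rightarrow> bool" where
  "ebad Any_lobe d e t l r = (viol d e t l r \<and> viol (Suc d) (Suc e) (Suc t) (l + 3) (r + 3))"
| "ebad No_lobe d e t l r = viol d e t l r"
| "ebad (Tri a s b) d e t l r = viol d e (Suc t) (l + (2 + tau a)) (r + (2 + tau b))"
| "ebad (Quad a s b q c) d e t l r = viol d e t (l + (2 + tau a)) (r + (2 + tau c))"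

text \<open>\<open>M\<close> caps all degrees, \<open>d\<close> and \<open>e\<close> bound the
  degrees of the ends from below, and \<open>t\<close>, \<open>l\<close>, \<open>r\<close> bound
  what lies on the far side of the edge. For a side of the face this far side is the face itself:
  one common neighbour in a triangle, none in a square. Around each end the next vertex adds at most
  2 and the common neighbours behind it add \<open>t\<close> or \<open>tau\<close>. The edge that
  opens a \<open>Block\<close> has nothing on its far side.\<close>

fun bad_l :: "lobe_tree \<Rightarrow> nat \<Rightarrow> nat \<Rightarrow> nat \<Rightarrow> nat \<Rightarrow> nat \<Rightarrow> nat \<Rightarrow> bool"
and bad_s :: "slot_tree \<Rightarrow> nat \<Rightarrow> nat \<Rightarrow> bool" where
  "bad_l Any_lobe M d e t l r = ebad Any_lobe d e t l r"
| "bad_l No_lobe M d e t l r = ebad No_lobe d e t l r"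
| "bad_l (Tri a s b) M d e t l r = (ebad (Tri a s b) d e t l r \<or>
    (let f = 2 + dr a + dl b + ds s in
      bad_l a M d f 1 (2 + t) (2 + tau b) \<or> bad_l b M f e 1 (2 + tau a) (2 + t) \<or> bad_s s M f))"
| "bad_l (Quad a s b q c) M d e t l r = (ebad (Quad a s b q c) d e t l r \<or>
    (let f = 2 + dr a + dl b + ds s; g = 2 + dr b + dl c + ds q in
      bad_l a M d f 0 (2 + t) (2 + tau b) \<or> bad_l b M f g 0 (2 + tau a) (2 + tau c) \<or>
      bad_l c M g e 0 (2 + tau b) (2 + t) \<or> bad_s s M f \<or> bad_s q M g))"
| "bad_s Any_slot M d = (M < d)"
| "bad_s No_slot M d = (M < d)"
| "bad_s (Block l s r) M d = (M < d \<or>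
    (let f = 1 + dr l + ds s in bad_l l M d f 0 0 0 \<or> bad_s s M f \<or> bad_s r M d))"

fun size_l :: "lobe_tree \<Rightarrow> nat" and size_s :: "slot_tree \<Rightarrow> nat" where
  "size_l Any_lobe = 0" | "size_l No_lobe = 0"
| "size_l (Tri a s b) = Suc (size_l a + size_s s + size_l b)"
| "size_l (Quad a s b r c) = Suc (Suc (size_l a + size_s s + size_l b + size_s r + size_l c))"
| "size_s Any_slot = 0" | "size_s No_slot = 0"
| "size_s (Block l s r) = Suc (size_l l + size_s s + size_s r)"

fun closed_l :: "lobe_tree \<Rightarrow> bool" and closed_s :: "slot_tree \<Rightarrow> bool" where
  "closed_l Any_lobe = False" | "closed_l No_lobe = True"
| "closed_l (Tri a s b) = (closed_l a \<and> closed_s s \<and> closed_l b)"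
| "closed_l (Quad a s b r c) = (closed_l a \<and> closed_s s \<and> closed_l b \<and> closed_s r \<and> closed_l c)"
| "closed_s Any_slot = False" | "closed_s No_slot = True"
| "closed_s (Block l s r) = (closed_l l \<and> closed_s s \<and> closed_s r)"

text \<open>Expands only the lobe next to the left end. Iterated from the root of a slot, this fixes
  all neighbours of the root, and its degree, before anything else is opened.\<close>

fun fan_l :: "lobe_tree \<Rightarrow> lobe_tree list" where
  "fan_l Any_lobe = [No_lobe, Tri Any_lobe Any_slot Any_lobe, Quad Any_lobe Any_slot Any_lobe Any_slot Any_lobe]"
| "fan_l No_lobe = []"
| "fan_l (Tri a s b) = map (\<lambda>y. Tri y s b) (fan_l a)"
| "fan_l (Quad a s b r c) = map (\<lambda>y. Quad y s b r c) (fan_l a)"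

fun fan_s :: "slot_tree \<Rightarrow> slot_tree list" where
  "fan_s Any_slot = [No_slot, Block Any_lobe Any_slot Any_slot]"
| "fan_s No_slot = []"
| "fan_s (Block l s r) = (case fan_l l of [] \<Rightarrow> map (\<lambda>y. Block l s y) (fan_s r) | x # xs \<Rightarrow> map (\<lambda>y. Block y s r) (x # xs))"

text \<open>Expands the first open node at depth exactly \<open>n\<close>; \<open>refine\<close>
  tries increasing depths, so shallow nodes, which bear on the degrees near the root, are opened
  first.\<close>

fun ref_l :: "nat \<Rightarrow> lobe_tree \<Rightarrow> lobe_tree list" and ref_s :: "nat \<Rightarrow> slot_tree \<Rightarrow> slot_tree list" where
  "ref_l n Any_lobe = (case n of 0 \<Rightarrow> [No_lobe, Tri Any_lobe Any_slot Any_lobe, Quad Any_lobe Any_slot Any_lobe Any_slot Any_lobe] | Suc m \<Rightarrow> [])"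
| "ref_l n No_lobe = []"
| "ref_l n (Tri a s b) = (case n of 0 \<Rightarrow> [] | Suc m \<Rightarrow>
    (case ref_l m a of x # xs \<Rightarrow> map (\<lambda>y. Tri y s b) (x # xs) | [] \<Rightarrow>
    (case ref_s m s of x # xs \<Rightarrow> map (\<lambda>y. Tri a y b) (x # xs) | [] \<Rightarrow> map (\<lambda>y. Tri a s y) (ref_l m b))))"
| "ref_l n (Quad a s b r c) = (case n of 0 \<Rightarrow> [] | Suc m \<Rightarrow>
    (case ref_l m a of x # xs \<Rightarrow> map (\<lambda>y. Quad y s b r c) (x # xs) | [] \<Rightarrow>
    (case ref_s m s of x # xs \<Rightarrow> map (\<lambda>y. Quad a y b r c) (x # xs) | [] \<Rightarrow>
    (case ref_l m b of x # xs \<Rightarrow> map (\<lambda>y. Quad a s y r c) (x # xs) | [] \<Rightarrow>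
    (case ref_s m r of x # xs \<Rightarrow> map (\<lambda>y. Quad a s b y c) (x # xs) | [] \<Rightarrow> map (\<lambda>y. Quad a s b r y) (ref_l m c))))))"
| "ref_s n Any_slot = (case n of 0 \<Rightarrow> [No_slot, Block Any_lobe Any_slot Any_slot] | Suc m \<Rightarrow> [])"
| "ref_s n No_slot = []"
| "ref_s n (Block l s r) = (case n of 0 \<Rightarrow> [] | Suc m \<Rightarrow>
    (case ref_l m l of x # xs \<Rightarrow> map (\<lambda>y. Block y s r) (x # xs) | [] \<Rightarrow>
    (case ref_s m s of x # xs \<Rightarrow> map (\<lambda>y. Block l y r) (x # xs) | [] \<Rightarrow> map (\<lambda>y. Block l s y) (ref_s m r))))"

fun refine :: "nat \<Rightarrow> nat \<Rightarrow> slot_tree \<Rightarrow> slot_tree list" where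
  "refine 0 n S = []"
| "refine (Suc k) n S = (case ref_s n S of [] \<Rightarrow> refine k (Suc n) S | x # xs \<Rightarrow> x # xs)"

text \<open>The first argument is fuel. While neighbours of the root are open, degrees are capped by
  9; afterwards the degree of the root is known and, as the maximum, caps all the others. The limit
  12 on the depth is safe, since a tree with an open node is not closed and makes the search fail.
  The size 9 leaves out the root.\<close>

fun search :: "nat \<Rightarrow> slot_tree \<Rightarrow> bool" where
  "search 0 S = False"
| "search (Suc k) S = (case fan_s S of
    [] \<Rightarrow> bad_s S (m2 (ds S)) (ds S) \<or>
      (case refine 12 0 S of [] \<Rightarrow> closed_s S \<and> size_s S \<le> 9 | x # xs \<Rightarrow> list_all (search k) (x # xs))
  | x # xs \<Rightarrow> bad_s S 9 (ds S) \<or> list_all (search k) (x # xs))"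

text \<open>The whole case analysis, evaluated in the kernel; 60 is enough fuel for the longest
  chain of expansions.\<close>

lemma search_succeeds: "search 60 Any_slot"
  by code_simp

section \<open>Unfolding a graph into trees\<close>

context posgraph
begin

text \<open>A walk from \<open>Z\<close> to \<open>u\<close> exists by connectedness, and it can
  leave \<open>Z\<close> only by a step into \<open>u\<close>.\<close>

lemma pend_neighbour:
  assumes "pend u Z" "Z \<noteq> {}" obtains v where "v \<in> Z" "E u v"
proof -
  obtain p where p: "p \<in> Z" using assms by blast
  have s: "sep u u Z" "u \<in> V" "u \<notin> Z" using assms sep_notin by (auto simp: pend_def)
  have "E\<^sup>*\<^sup>* p u" using cg p s by (auto simp: connected_graph_def sep_def)
  moreover have "y \<in> Z \<or> (\<exists>v\<in>Z. E u v)" if "E\<^sup>*\<^sup>* p y" for y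
    using that
  proof (induction rule: rtranclp_induct)
    case base
    show ?case using p by simp
  next
    case (step y z)
    show ?case
    proof (cases "y \<in> Z")
      case True
      then show ?thesis using sepD[OF s(1) True step.hyps(2)] E_sym[OF step.hyps(2)] by auto
    qed (use step.IH in simp)
  qed
  ultimately show thesis using that s(3) by blast
qed

text \<open>
  The edge \<open>uv\<close> bounding the largest possible lobe is an outer edge of its block, so a single
  lobe describes the block.
\<close>

lemma pend_block:
  assumes P: "pend u Z" "Z \<noteq> {}"
  obtains v X Zv Zr where "E u v" "lobe u v X" "pend v Zv" "pend u Zr" "Z = insert v (X \<union> Zv \<union> Zr)"
    "v \<notin> X" "v \<notin> Zv" "v \<notin> Zr" "X \<inter> Zv = {}" "X \<inter> Zr = {}" "Zv \<inter> Zr = {}"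
proof -
  have s: "sep u u Z" "u \<in> V" "u \<notin> Z" using P sep_notin by (auto simp: pend_def)
  let ?K = "\<lambda>v p. gcomp E (Z - {v}) p"
  define cand where "cand = (\<lambda>(v, L). v \<in> Z \<and> E u v \<and> (L = {} \<or> (\<exists>p\<in>Z - {v}. L = ?K v p \<and> att E u L \<and> att E v L)))"
  have fin: "finite (nbhd E u)" using nb_fin s by blast
  obtain v0 where "v0 \<in> Z" "E u v0" using pend_neighbour[OF P] .
  then have "cand (v0, {})" by (auto simp: cand_def)
  \<comment> \<open>Candidates are compared by the number of neighbours of \<open>u\<close> they
    contain: \<open>L\<close> itself may be infinite, but the degree of \<open>u\<close> is
    finite.\<close>
  moreover have "card (snd wM \<inter> nbhd E u) < Suc (card (nbhd E u))" for wM :: "'a \<times> 'a set"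
    using card_mono[OF fin, of "snd wM \<inter> nbhd E u"] by (simp add: le_imp_less_Suc)
  ultimately obtain vL where vL: "cand vL" "\<And>wM. cand wM \<Longrightarrow> card (snd wM \<inter> nbhd E u) \<le> card (snd vL \<inter> nbhd E u)"
    using ex_has_greatest_nat[of cand "(v0, {})" "\<lambda>wM. card (snd wM \<inter> nbhd E u)" "Suc (card (nbhd E u))"] by blast
  obtain v L where vL_eq: "vL = (v, L)" by force
  have v: "v \<in> Z" "E u v" "L = {} \<or> (\<exists>p\<in>Z - {v}. L = ?K v p \<and> att E u L \<and> att E v L)"
    using vL(1) vL_eq by (auto simp: cand_def)
  have LZ: "L \<subseteq> Z - {v}" using v(3) gcomp_subset[of _ "Z - {v}" E] by (elim disjE bexE conjE) simp_all
  \<comment> \<open>If a second component touched both \<open>u\<close> and \<open>v\<close>, moving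
    from \<open>v\<close> to a neighbour \<open>w\<close> of \<open>u\<close> inside it would give a
    candidate containing \<open>v\<close> and all of \<open>L\<close>, which is strictly
    larger.\<close>
  have uniq: "?K v p = L" if p: "p \<in> Z - {v}" "att E u (?K v p)" "att E v (?K v p)" for p
  proof (rule ccontr)
    assume ne: "?K v p \<noteq> L"
    have dis: "?K v p \<inter> L = {}" using v(3) ne gcomp_disj[OF symE p(1)] by (elim disjE bexE conjE) simp_all
    obtain w where w: "w \<in> ?K v p" "E u w" using p(2) by (auto simp: att_def)
    have wZ: "w \<in> Z" "w \<noteq> v" "w \<notin> L" using w gcomp_subset[OF p(1), of E] dis by auto
    have vZw: "v \<in> Z - {w}" using v wZ by auto
    have "insert v L \<subseteq> ?K w v"
    proof (cases "L = {}")
      case True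
      then show ?thesis using gcomp_self by auto
    next
      case False
      then obtain q where q: "q \<in> L" "E v q" "conn E L" using v(3) gcomp_conn[OF symE] by (auto simp: att_def)
      have "conn E (insert v L)" using conn_insert[OF symE q(3) q(1) E_sym[OF q(2)]] .
      then show ?thesis using conn_subset_gcomp[of E "insert v L" "Z - {w}" v] LZ v wZ by auto
    qed
    moreover have "att E w (?K w v)"
    proof -
      obtain q where q: "q \<in> ?K v p" "E v q" using p(3) by (auto simp: att_def)
      have c: "conn E (insert v (?K v p))" by (rule conn_insert[OF symE gcomp_conn[OF symE p(1)] q(1) E_sym[OF q(2)]])
      have "w \<notin> ?K w v" using gcomp_subset[OF vZw, of E] by auto
      then obtain a b where ab: "a \<in> ?K w v" "b \<in> insert v (?K v p)" "b \<notin> ?K w v" "E a b"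
        using conn_escape[OF c, of v "?K w v"] gcomp_self[of v E "Z - {w}"] w by blast
      have "b \<in> Z" using ab(2) v gcomp_subset[OF p(1), of E] by auto
      then have "b = w" using gcomp_closed[OF vZw ab(1) _ ab(4)] ab(3) by auto
      then show ?thesis using ab E_sym by (auto simp: att_def)
    qed
    moreover have "att E u (?K w v)" using v gcomp_self[of v E "Z - {w}"] by (auto simp: att_def)
    ultimately have "cand (w, ?K w v)" using wZ w vZw by (auto simp: cand_def)
    from vL(2)[OF this] have "card (?K w v \<inter> nbhd E u) \<le> card (L \<inter> nbhd E u)" using vL_eq by simp
    moreover have "card (insert v (L \<inter> nbhd E u)) \<le> card (?K w v \<inter> nbhd E u)"
      by (rule card_mono) (use fin \<open>insert v L \<subseteq> ?K w v\<close> v in \<open>auto simp: nbhd_def\<close>)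
    moreover have "card (insert v (L \<inter> nbhd E u)) = Suc (card (L \<inter> nbhd E u))" using fin LZ by (subst card_insert_disjoint) auto
    ultimately show False by linarith
  qed
  have vM: "{v} \<subseteq> Z" using v by auto
  let ?X = "reg Z {v} u v"
  let ?Zv = "{p \<in> Z - {v}. att E v (?K v p) \<and> \<not> att E u (?K v p)}" and ?Zr = "{p \<in> Z - {v}. \<not> att E v (?K v p)}"
  have KQ: "?K v q = ?K v p" "q \<in> Z - {v}" if "p \<in> Z - {v}" "q \<in> ?K v p" for p q
    using gcomp_eq[OF symE that] gcomp_subset[OF that(1), of E] that by auto
  have sX: "sep u v ?X" by (rule piece_sep[OF s(1) vM reg_sub gcomp_sub_reg]) auto
  have "sep v v ?Zv"
  proof (rule piece_sep[OF s(1) vM])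
    fix p assume p: "p \<in> ?Zv"
    show "?K v p \<subseteq> ?Zv"
    proof
      fix q assume q: "q \<in> ?K v p"
      have "?K v q = ?K v p" "q \<in> Z - {v}" using KQ[OF _ q] p by simp_all
      then show "q \<in> ?Zv" using p by simp
    qed
  qed auto
  then have pv: "pend v ?Zv" using v s E_sym[OF v(2)] E_V[OF v(2)] by (auto simp: pend_def)
  have "sep u u ?Zr"
  proof (rule piece_sep[OF s(1) vM])
    fix p assume p: "p \<in> ?Zr"
    show "?K v p \<subseteq> ?Zr"
    proof
      fix q assume q: "q \<in> ?K v p"
      have "?K v q = ?K v p" "q \<in> Z - {v}" using KQ[OF _ q] p by simp_all
      then show "q \<in> ?Zr" using p by simp
    qed
  qed auto
  then have pu: "pend u ?Zr" using v s by (auto simp: pend_def)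
  have lb: "lobe u v ?X"
  proof (cases "?X = {}")
    case True
    then show ?thesis using v sX by (simp add: lobe_def)
  next
    case False
    then obtain p where p: "p \<in> ?X" by blast
    then have pZ: "p \<in> Z - {v}" "att E u (?K v p)" "att E v (?K v p)" by (auto simp: reg_def)
    have "?X = ?K v p"
    proof
      show "?X \<subseteq> ?K v p"
      proof
        fix q assume "q \<in> ?X"
        then have "?K v q = L" using uniq by (auto simp: reg_def)
        then show "q \<in> ?K v p" using uniq[OF pZ] gcomp_self[of q E "Z - {v}"] by simp
      qed
    qed (rule gcomp_sub_reg[OF p])
    then have X: "conn E ?X" "att E u ?X" "att E v ?X" using gcomp_conn[OF symE pZ(1)] pZ by auto
    obtain q where q: "q \<in> ?X" "E u q" using X(2) by (auto simp: att_def)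
    have "3 \<le> deg E u"
    proof (cases "3 \<le> deg E u")
      case False
      then obtain r where r: "E u r" "r \<notin> Z" using P by (auto simp: pend_def)
      then show ?thesis using deg_3[OF v(2) q(2) r(1)] q v reg_sub[of Z "{v}" u v] by auto
    qed
    then show ?thesis using sX X v by (simp add: lobe_def)
  qed
  show thesis
    by (rule that[OF v(2) lb pv pu]) (use v in \<open>auto simp: reg_def\<close>)
qed

definition tparts :: "'a \<Rightarrow> 'a \<Rightarrow> 'a set \<Rightarrow> 'a \<Rightarrow> 'a set \<Rightarrow> 'a set \<Rightarrow> 'a set \<Rightarrow> bool" where
  "tparts x y X w Xa Z Xb \<longleftrightarrow> E x w \<and> E w y \<and> X = insert w (Xa \<union> Z \<union> Xb) \<and>
    w \<notin> Xa \<and> w \<notin> Z \<and> w \<notin> Xb \<and> Xa \<inter> Z = {} \<and> Xa \<inter> Xb = {} \<and> Z \<inter> Xb = {}"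

definition qparts :: "'a \<Rightarrow> 'a \<Rightarrow> 'a set \<Rightarrow> 'a \<Rightarrow> 'a \<Rightarrow> 'a set \<Rightarrow> 'a set \<Rightarrow> 'a set \<Rightarrow> 'a set \<Rightarrow> 'a set \<Rightarrow> bool" where
  "qparts x y X w v Xa Z Xb Z' Xc \<longleftrightarrow> E x w \<and> E w v \<and> E v y \<and> \<not> E x v \<and> \<not> E w y \<and>
    X = insert w (insert v (Xa \<union> Z \<union> Xb \<union> Z' \<union> Xc)) \<and> {w, v} \<inter> (Xa \<union> Z \<union> Xb \<union> Z' \<union> Xc) = {} \<and>
    Xa \<inter> Z = {} \<and> Xa \<inter> Xb = {} \<and> Xa \<inter> Z' = {} \<and> Xa \<inter> Xc = {} \<and> Z \<inter> Xb = {} \<and> Z \<inter> Z' = {} \<and> Z \<inter> Xc = {} \<and>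
    Xb \<inter> Z' = {} \<and> Xb \<inter> Xc = {} \<and> Z' \<inter> Xc = {}"

definition bparts :: "'a \<Rightarrow> 'a set \<Rightarrow> 'a \<Rightarrow> 'a set \<Rightarrow> 'a set \<Rightarrow> 'a set \<Rightarrow> bool" where
  "bparts u Z v X Zv Zr \<longleftrightarrow> E u v \<and> Z = insert v (X \<union> Zv \<union> Zr) \<and>
    v \<notin> X \<and> v \<notin> Zv \<and> v \<notin> Zr \<and> X \<inter> Zv = {} \<and> X \<inter> Zr = {} \<and> Zv \<inter> Zr = {}"

text \<open>Every case keeps \<open>lobe\<close> or \<open>pend\<close> of the whole piece next to
  its decomposition, so a matched tree may be opened further at any place.\<close>

fun fits :: "lobe_tree \<Rightarrow> 'a \<Rightarrow> 'a \<Rightarrow> 'a set \<Rightarrow> bool" and fits_s :: "slot_tree \<Rightarrow> 'a \<Rightarrow> 'a set \<Rightarrow> bool" where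
  "fits Any_lobe x y X = lobe x y X"
| "fits No_lobe x y X = (lobe x y X \<and> X = {})"
| "fits (Tri a s b) x y X = (lobe x y X \<and> (\<exists>w Xa Z Xb. tparts x y X w Xa Z Xb \<and>
    fits a x w Xa \<and> fits_s s w Z \<and> fits b w y Xb))"
| "fits (Quad a s b r c) x y X = (lobe x y X \<and> (\<exists>w v Xa Z Xb Z' Xc. qparts x y X w v Xa Z Xb Z' Xc \<and>
    fits a x w Xa \<and> fits_s s w Z \<and> fits b w v Xb \<and> fits_s r v Z' \<and> fits c v y Xc))"
| "fits_s Any_slot u Z = pend u Z"
| "fits_s No_slot u Z = (pend u Z \<and> Z = {})"
| "fits_s (Block l s r) u Z = (pend u Z \<and> (\<exists>v X Zv Zr. bparts u Z v X Zv Zr \<and>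
    fits l u v X \<and> fits_s s v Zv \<and> fits_s r u Zr))"

lemma fits_lobe: "fits L x y X \<Longrightarrow> lobe x y X" by (cases L) auto
lemma fits_pend: "fits_s S u Z \<Longrightarrow> pend u Z" by (cases S) auto

lemma fits_TI: "lobe x y X \<Longrightarrow> tparts x y X w Xa Z Xb \<Longrightarrow> fits a x w Xa \<Longrightarrow> fits_s s w Z \<Longrightarrow> fits b w y Xb \<Longrightarrow>
    fits (Tri a s b) x y X"
  unfolding fits.simps by blast

lemma fits_QI: "lobe x y X \<Longrightarrow> qparts x y X w v Xa Z Xb Z' Xc \<Longrightarrow> fits a x w Xa \<Longrightarrow> fits_s s w Z \<Longrightarrow> fits b w v Xb \<Longrightarrow>
    fits_s r v Z' \<Longrightarrow> fits c v y Xc \<Longrightarrow> fits (Quad a s b r c) x y X"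
  unfolding fits.simps by blast

lemma fits_BI: "pend u Z \<Longrightarrow> bparts u Z v X Zv Zr \<Longrightarrow> fits l u v X \<Longrightarrow> fits_s s v Zv \<Longrightarrow> fits_s r u Zr \<Longrightarrow>
    fits_s (Block l s r) u Z"
  unfolding fits_s.simps by blast

text \<open>The three patterns are exhaustive because \<open>no_long_face\<close> leaves only
  triangles and squares.\<close>

lemma open_lobe:
  assumes L: "lobe x y X"
  shows "\<exists>L'\<in>{No_lobe, Tri Any_lobe Any_slot Any_lobe, Quad Any_lobe Any_slot Any_lobe Any_slot Any_lobe}. fits L' x y X"
proof (cases "X = {}")
  case True
  then show ?thesis using L by simp
next
  case False
  from L False show ?thesis
  proof (cases rule: lobe_cases)
    case (triangle w)
    from lobe_triangle[OF L triangle] obtain Xa Z Xb where d: "lobe x w Xa" "pend w Z" "lobe w y Xb" "X = insert w (Xa \<union> Z \<union> Xb)"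
      "w \<notin> Xa" "w \<notin> Z" "w \<notin> Xb" "Xa \<inter> Z = {}" "Xa \<inter> Xb = {}" "Z \<inter> Xb = {}" .
    then have "tparts x y X w Xa Z Xb" using triangle(2,3) unfolding tparts_def by (intro conjI)
    then have "fits (Tri Any_lobe Any_slot Any_lobe) x y X" by (rule fits_TI[OF L]) (use d in simp_all)
    then show ?thesis by blast
  next
    case (square w v)
    from lobe_square[OF L square] obtain Xa Z Xb Z' Xc where d: "lobe x w Xa" "pend w Z" "lobe w v Xb" "pend v Z'" "lobe v y Xc"
      "X = insert w (insert v (Xa \<union> Z \<union> Xb \<union> Z' \<union> Xc))" "{w, v} \<inter> (Xa \<union> Z \<union> Xb \<union> Z' \<union> Xc) = {}"
      "Xa \<inter> Z = {}" "Xa \<inter> Xb = {}" "Xa \<inter> Z' = {}" "Xa \<inter> Xc = {}" "Z \<inter> Xb = {}" "Z \<inter> Z' = {}" "Z \<inter> Xc = {}"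
      "Xb \<inter> Z' = {}" "Xb \<inter> Xc = {}" "Z' \<inter> Xc = {}" .
    then have "qparts x y X w v Xa Z Xb Z' Xc" using square(3-7) unfolding qparts_def by (intro conjI)
    then have "fits (Quad Any_lobe Any_slot Any_lobe Any_slot Any_lobe) x y X" by (rule fits_QI[OF L]) (use d in simp_all)
    then show ?thesis by blast
  next
    case long
    then show ?thesis using no_long_face[OF L False] by blast
  qed
qed

lemma open_slot:
  assumes "pend u Z" shows "\<exists>S'\<in>{No_slot, Block Any_lobe Any_slot Any_slot}. fits_s S' u Z"
proof (cases "Z = {}")
  case True
  then show ?thesis using assms by simp
next
  case False
  from pend_block[OF assms False] obtain v X Zv Zr where d: "E u v" "lobe u v X" "pend v Zv" "pend u Zr" "Z = insert v (X \<union> Zv \<union> Zr)"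
    "v \<notin> X" "v \<notin> Zv" "v \<notin> Zr" "X \<inter> Zv = {}" "X \<inter> Zr = {}" "Zv \<inter> Zr = {}" .
  then have "bparts u Z v X Zv Zr" unfolding bparts_def by (intro conjI)
  then have "fits_s (Block Any_lobe Any_slot Any_slot) u Z" by (rule fits_BI[OF assms]) (use d in simp_all)
  then show ?thesis by blast
qed

lemma fan_l_fits: "fits L x y X \<Longrightarrow> fan_l L \<noteq> [] \<Longrightarrow> \<exists>L'\<in>set (fan_l L). fits L' x y X"
proof (induction L arbitrary: x y X rule: fan_l.induct)
  case 1
  then show ?case using open_lobe[of x y X] by (simp del: fits.simps(2-4))
next
  case (3 a s b)
  then obtain w Xa Z Xb where f: "fits a x w Xa" "fits_s s w Z" "fits b w y Xb" "lobe x y X" "tparts x y X w Xa Z Xb" by auto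
  from "3.IH"[OF f(1)] "3.prems"(2) obtain a' where "a' \<in> set (fan_l a)" "fits a' x w Xa" by auto
  moreover from this have "fits (Tri a' s b) x y X" using fits_TI[OF f(4,5) _ f(2,3)] by blast
  ultimately show ?case by (auto simp del: fits.simps)
next
  case (4 a s b r c)
  then obtain w v Xa Z Xb Z' Xc where f: "fits a x w Xa" "fits_s s w Z" "fits b w v Xb" "fits_s r v Z'" "fits c v y Xc"
    "lobe x y X" "qparts x y X w v Xa Z Xb Z' Xc" by auto
  from "4.IH"[OF f(1)] "4.prems"(2) obtain a' where "a' \<in> set (fan_l a)" "fits a' x w Xa" by auto
  moreover from this have "fits (Quad a' s b r c) x y X" using fits_QI[OF f(6,7) _ f(2-5)] by blast
  ultimately show ?case by (auto simp del: fits.simps)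
qed simp

lemma fan_s_fits: "fits_s S u Z \<Longrightarrow> fan_s S \<noteq> [] \<Longrightarrow> \<exists>S'\<in>set (fan_s S). fits_s S' u Z"
proof (induction S arbitrary: u Z rule: fan_s.induct)
  case 1
  then show ?case using open_slot[of u Z] by (simp del: fits_s.simps(2,3))
next
  case (3 l s r)
  then obtain v X Zv Zr where f: "pend u Z" "bparts u Z v X Zv Zr" "fits l u v X" "fits_s s v Zv" "fits_s r u Zr" by auto
  show ?case
  proof (cases "fan_l l")
    case Nil
    then obtain r' where "r' \<in> set (fan_s r)" "fits_s r' u Zr" using "3.IH" "3.prems"(2) f(5) by auto
    moreover from this have "fits_s (Block l s r') u Z" using fits_BI[OF f(1-4)] by blast
    ultimately show ?thesis using Nil by (auto simp del: fits_s.simps)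
  next
    case (Cons x xs)
    then obtain l' where "l' \<in> set (fan_l l)" "fits l' u v X" using fan_l_fits[OF f(3)] by auto
    moreover from this have "fits_s (Block l' s r) u Z" using fits_BI[OF f(1,2) _ f(4,5)] by blast
    ultimately show ?thesis using Cons by (auto simp del: fits_s.simps)
  qed
qed simp

text \<open>Refinement loses no graph: whatever matches a tree matches one of its
  refinements.\<close>

lemma ref_fits:
  "fits L x y X \<Longrightarrow> ref_l n L \<noteq> [] \<Longrightarrow> \<exists>L'\<in>set (ref_l n L). fits L' x y X"
  "fits_s S u Z \<Longrightarrow> ref_s n S \<noteq> [] \<Longrightarrow> \<exists>S'\<in>set (ref_s n S). fits_s S' u Z"
proof (induction L and S arbitrary: x y X n and u Z n)
  case Any_lobe
  then show ?case using open_lobe[of x y X] by (auto simp del: fits.simps(2-4) split: nat.splits)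
next
  case No_lobe
  then show ?case by simp
next
  case (Tri a s b)
  then obtain w Xa Z Xb where f: "fits a x w Xa" "fits_s s w Z" "fits b w y Xb"
    and g: "tparts x y X w Xa Z Xb" "lobe x y X" by auto
  have I: "fits (Tri a' s' b') x y X" if "fits a' x w Xa" "fits_s s' w Z" "fits b' w y Xb" for a' s' b'
    using that g unfolding fits.simps by blast
  obtain m where n: "n = Suc m" using Tri.prems(2) by (cases n) auto
  consider "ref_l m a \<noteq> []" | "ref_l m a = []" "ref_s m s \<noteq> []" | "ref_l m a = []" "ref_s m s = []" "ref_l m b \<noteq> []"
    using Tri.prems(2) n by (auto split: list.splits)
  then show ?case
  proof cases
    case 1
    from Tri.IH(1)[OF f(1) 1] obtain a' where k: "a' \<in> set (ref_l m a)" "fits a' x w Xa" by blast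
    then have "Tri a' s b \<in> set (ref_l n (Tri a s b))" using 1 n by (auto split: list.splits)
    then show ?thesis using I[OF k(2) f(2) f(3)] by blast
  next
    case 2
    from Tri.IH(2)[OF f(2) 2(2)] obtain s' where k: "s' \<in> set (ref_s m s)" "fits_s s' w Z" by blast
    then have "Tri a s' b \<in> set (ref_l n (Tri a s b))" using 2 n by (auto split: list.splits)
    then show ?thesis using I[OF f(1) k(2) f(3)] by blast
  next
    case 3
    from Tri.IH(3)[OF f(3) 3(3)] obtain b' where k: "b' \<in> set (ref_l m b)" "fits b' w y Xb" by blast
    then have "Tri a s b' \<in> set (ref_l n (Tri a s b))" using 3 n by (auto split: list.splits)
    then show ?thesis using I[OF f(1) f(2) k(2)] by blast
  qed
next
  case (Quad a s b r c)
  then obtain w v Xa Z Xb Z' Xc where f: "fits a x w Xa" "fits_s s w Z" "fits b w v Xb" "fits_s r v Z'" "fits c v y Xc"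
    and g: "qparts x y X w v Xa Z Xb Z' Xc" "lobe x y X"
    unfolding fits.simps by blast
  have I: "fits (Quad a' s' b' r' c') x y X" if "fits a' x w Xa" "fits_s s' w Z" "fits b' w v Xb" "fits_s r' v Z'" "fits c' v y Xc" for a' s' b' r' c'
    unfolding fits.simps using that g by blast
  obtain m where n: "n = Suc m" using Quad.prems(2) by (cases n) auto
  consider "ref_l m a \<noteq> []" | "ref_l m a = []" "ref_s m s \<noteq> []" | "ref_l m a = []" "ref_s m s = []" "ref_l m b \<noteq> []"
    | "ref_l m a = []" "ref_s m s = []" "ref_l m b = []" "ref_s m r \<noteq> []"
    | "ref_l m a = []" "ref_s m s = []" "ref_l m b = []" "ref_s m r = []" "ref_l m c \<noteq> []"
    using Quad.prems(2) n by (auto split: list.splits)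
  then show ?case
  proof cases
    case 1
    from Quad.IH(1)[OF f(1) 1] obtain a' where k: "a' \<in> set (ref_l m a)" "fits a' x w Xa" by blast
    then have "Quad a' s b r c \<in> set (ref_l n (Quad a s b r c))" using 1 n by (auto split: list.splits)
    then show ?thesis using I[OF k(2) f(2) f(3) f(4) f(5)] by blast
  next
    case 2
    from Quad.IH(2)[OF f(2) 2(2)] obtain s' where k: "s' \<in> set (ref_s m s)" "fits_s s' w Z" by blast
    then have "Quad a s' b r c \<in> set (ref_l n (Quad a s b r c))" using 2 n by (auto split: list.splits)
    then show ?thesis using I[OF f(1) k(2) f(3) f(4) f(5)] by blast
  next
    case 3
    from Quad.IH(3)[OF f(3) 3(3)] obtain b' where k: "b' \<in> set (ref_l m b)" "fits b' w v Xb" by blast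
    then have "Quad a s b' r c \<in> set (ref_l n (Quad a s b r c))" using 3 n by (auto split: list.splits)
    then show ?thesis using I[OF f(1) f(2) k(2) f(4) f(5)] by blast
  next
    case 4
    from Quad.IH(4)[OF f(4) 4(4)] obtain r' where k: "r' \<in> set (ref_s m r)" "fits_s r' v Z'" by blast
    then have "Quad a s b r' c \<in> set (ref_l n (Quad a s b r c))" using 4 n by (auto split: list.splits)
    then show ?thesis using I[OF f(1) f(2) f(3) k(2) f(5)] by blast
  next
    case 5
    from Quad.IH(5)[OF f(5) 5(5)] obtain c' where k: "c' \<in> set (ref_l m c)" "fits c' v y Xc" by blast
    then have "Quad a s b r c' \<in> set (ref_l n (Quad a s b r c))" using 5 n by (auto split: list.splits)
    then show ?thesis using I[OF f(1) f(2) f(3) f(4) k(2)] by blast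
  qed
next
  case Any_slot
  then show ?case using open_slot[of u Z] by (auto simp del: fits_s.simps(2,3) split: nat.splits)
next
  case No_slot
  then show ?case by simp
next
  case (Block l s r)
  then obtain v X Zv Zr where f: "fits l u v X" "fits_s s v Zv" "fits_s r u Zr"
    and g: "pend u Z" "bparts u Z v X Zv Zr" by auto
  have I: "fits_s (Block l' s' r') u Z" if "fits l' u v X" "fits_s s' v Zv" "fits_s r' u Zr" for l' s' r'
    using that g unfolding fits_s.simps by blast
  obtain m where n: "n = Suc m" using Block.prems(2) by (cases n) auto
  consider "ref_l m l \<noteq> []" | "ref_l m l = []" "ref_s m s \<noteq> []" | "ref_l m l = []" "ref_s m s = []" "ref_s m r \<noteq> []"
    using Block.prems(2) n by (auto split: list.splits)
  then show ?case
  proof cases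
    case 1
    from Block.IH(1)[OF f(1) 1] obtain l' where k: "l' \<in> set (ref_l m l)" "fits l' u v X" by blast
    then have "Block l' s r \<in> set (ref_s n (Block l s r))" using 1 n by (auto split: list.splits)
    then show ?thesis using I[OF k(2) f(2) f(3)] by blast
  next
    case 2
    from Block.IH(2)[OF f(2) 2(2)] obtain s' where k: "s' \<in> set (ref_s m s)" "fits_s s' v Zv" by blast
    then have "Block l s' r \<in> set (ref_s n (Block l s r))" using 2 n by (auto split: list.splits)
    then show ?thesis using I[OF f(1) k(2) f(3)] by blast
  next
    case 3
    from Block.IH(3)[OF f(3) 3(3)] obtain r' where k: "r' \<in> set (ref_s m r)" "fits_s r' u Zr" by blast
    then have "Block l s r' \<in> set (ref_s n (Block l s r))" using 3 n by (auto split: list.splits)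
    then show ?thesis using I[OF f(1) f(2) k(2)] by blast
  qed
qed

lemma refine_fits: "fits_s S u Z \<Longrightarrow> refine k n S \<noteq> [] \<Longrightarrow> \<exists>S'\<in>set (refine k n S). fits_s S' u Z"
proof (induction k n S rule: refine.induct)
  case (2 k n S)
  show ?case
  proof (cases "ref_s n S")
    case Nil
    then show ?thesis using 2 by simp
  next
    case (Cons x xs)
    then show ?thesis using ref_fits(2)[OF "2.prems"(1), of n] by simp
  qed
qed simp

text \<open>The source of finiteness: a tree without open nodes partitions the piece into single
  vertices.\<close>

lemma closed_size:
  "fits L x y X \<Longrightarrow> closed_l L \<Longrightarrow> finite X \<and> card X = size_l L"
  "fits_s S u Z \<Longrightarrow> closed_s S \<Longrightarrow> finite Z \<and> card Z = size_s S"
proof (induction L and S arbitrary: x y X and u Z)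
  case (Tri a s b)
  then obtain w Xa Z Xb where f: "fits a x w Xa" "fits_s s w Z" "fits b w y Xb"
    and "tparts x y X w Xa Z Xb" by auto
  then have g: "X = insert w (Xa \<union> Z \<union> Xb)"
    "w \<notin> Xa" "w \<notin> Z" "w \<notin> Xb" "Xa \<inter> Z = {}" "Xa \<inter> Xb = {}" "Z \<inter> Xb = {}" by (auto simp: tparts_def)
  have i: "finite Xa \<and> card Xa = size_l a" "finite Z \<and> card Z = size_s s" "finite Xb \<and> card Xb = size_l b"
    using Tri.IH(1)[OF f(1)] Tri.IH(2)[OF f(2)] Tri.IH(3)[OF f(3)] Tri.prems(2) by auto
  have "card X = Suc (card (Xa \<union> Z \<union> Xb))" using i g by simp
  also have "card (Xa \<union> Z \<union> Xb) = card (Xa \<union> Z) + card Xb" by (rule card_Un_disjoint) (use i g in auto)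
  also have "card (Xa \<union> Z) = card Xa + card Z" by (rule card_Un_disjoint) (use i g in auto)
  finally show ?case using i g by simp
next
  case (Quad a s b r c)
  then obtain w v Xa Z Xb Z' Xc where f: "fits a x w Xa" "fits_s s w Z" "fits b w v Xb" "fits_s r v Z'" "fits c v y Xc"
    and p: "qparts x y X w v Xa Z Xb Z' Xc" by auto
  have g: "X = insert w (insert v (Xa \<union> Z \<union> Xb \<union> Z' \<union> Xc))" "w \<noteq> v" "{w, v} \<inter> (Xa \<union> Z \<union> Xb \<union> Z' \<union> Xc) = {}"
    "Xa \<inter> Z = {}" "Xa \<inter> Xb = {}" "Xa \<inter> Z' = {}" "Xa \<inter> Xc = {}" "Z \<inter> Xb = {}" "Z \<inter> Z' = {}" "Z \<inter> Xc = {}"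
    "Xb \<inter> Z' = {}" "Xb \<inter> Xc = {}" "Z' \<inter> Xc = {}"
    using p unfolding qparts_def by (simp_all, blast)
  have i: "finite Xa \<and> card Xa = size_l a" "finite Z \<and> card Z = size_s s" "finite Xb \<and> card Xb = size_l b"
    "finite Z' \<and> card Z' = size_s r" "finite Xc \<and> card Xc = size_l c"
    using Quad.IH(1)[OF f(1)] Quad.IH(2)[OF f(2)] Quad.IH(3)[OF f(3)] Quad.IH(4)[OF f(4)] Quad.IH(5)[OF f(5)] Quad.prems(2) by auto
  have "card X = Suc (Suc (card (Xa \<union> Z \<union> Xb \<union> Z' \<union> Xc)))" using i g by simp
  also have "card (Xa \<union> Z \<union> Xb \<union> Z' \<union> Xc) = card (Xa \<union> Z \<union> Xb \<union> Z') + card Xc" by (rule card_Un_disjoint) (use i g in auto)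
  also have "card (Xa \<union> Z \<union> Xb \<union> Z') = card (Xa \<union> Z \<union> Xb) + card Z'" by (rule card_Un_disjoint) (use i g in auto)
  also have "card (Xa \<union> Z \<union> Xb) = card (Xa \<union> Z) + card Xb" by (rule card_Un_disjoint) (use i g in auto)
  also have "card (Xa \<union> Z) = card Xa + card Z" by (rule card_Un_disjoint) (use i g in auto)
  finally show ?case using i g by simp
next
  case (Block l s r)
  then obtain v X Zv Zr where f: "fits l u v X" "fits_s s v Zv" "fits_s r u Zr"
    and "bparts u Z v X Zv Zr" by auto
  then have g: "Z = insert v (X \<union> Zv \<union> Zr)"
    "v \<notin> X" "v \<notin> Zv" "v \<notin> Zr" "X \<inter> Zv = {}" "X \<inter> Zr = {}" "Zv \<inter> Zr = {}" by (auto simp: bparts_def)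
  have i: "finite X \<and> card X = size_l l" "finite Zv \<and> card Zv = size_s s" "finite Zr \<and> card Zr = size_s r"
    using Block.IH(1)[OF f(1)] Block.IH(2)[OF f(2)] Block.IH(3)[OF f(3)] Block.prems(2) by auto
  have "card Z = Suc (card (X \<union> Zv \<union> Zr))" using i g by simp
  also have "card (X \<union> Zv \<union> Zr) = card (X \<union> Zv) + card Zr" by (rule card_Un_disjoint) (use i g in auto)
  also have "card (X \<union> Zv) = card X + card Zv" by (rule card_Un_disjoint) (use i g in auto)
  finally show ?case using i g by simp
qed auto

subsection \<open>Soundness of the search\<close>

lemma tparts_sep:
  assumes p: "tparts x y X w Xa Z Xb" and l: "lobe x w Xa" "pend w Z" "lobe w y Xb"
  shows "E x w" "E w y" "X = insert w (Xa \<union> Z \<union> Xb)" "sep x w Xa" "sep w w Z" "sep w y Xb"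
  using assms by (auto simp: tparts_def lobe_def pend_def)

lemma tcount_tau: "fits L x y X \<Longrightarrow> tcount x y X \<le> tau L"
proof (cases L)
  case (Quad a s b r c)
  assume f: "fits L x y X"
  then obtain w v Xa Z Xb Z' Xc where g: "lobe x w Xa" "pend w Z" "lobe w v Xb" "pend v Z'" "lobe v y Xc"
    and p: "lobe x y X" "qparts x y X w v Xa Z Xb Z' Xc" using Quad fits_lobe fits_pend by (auto simp del: fits.simps(1,2)) blast
  have "tcount x y X = 0"
    by (rule square_score(2)[of x y X w Xa Z v Xb Z' Xc]) (use g p in \<open>auto simp: lobe_def pend_def qparts_def\<close>)
  then show ?thesis by simp
qed (use lobe_score fits_lobe in \<open>auto simp del: One_nat_def\<close>)

lemma degree_split: "y \<in> V \<Longrightarrow> card (nbhd E y - X) + card (nbhd E y \<inter> X) = deg E y"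
  using nb_fin[of y] by (simp add: deg_def card_Diff_subset_Int card_mono)

lemma nb_insert_card:
  assumes "u \<in> V" "S1 \<subseteq> nbhd E u" "S2 \<subseteq> nbhd E u" "S1 \<inter> S2 = {}" "S1 \<union> S2 \<subseteq> R"
  shows "card S1 + card S2 \<le> card (nbhd E u \<inter> R)"
proof -
  have "finite S1" "finite S2" using assms nb_fin finite_subset by blast+
  then have "card S1 + card S2 = card (S1 \<union> S2)" using assms(4) by (simp add: card_Un_disjoint)
  also have "\<dots> \<le> card (nbhd E u \<inter> R)" by (rule card_mono) (use assms nb_fin in auto)
  finally show ?thesis .
qed

lemma degree_known:
  "fits L x y X \<Longrightarrow> dl L \<le> card (nbhd E x \<inter> X) \<and> dr L \<le> card (nbhd E y \<inter> X)"
  "fits_s S u Z \<Longrightarrow> ds S \<le> card (nbhd E u \<inter> Z)"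
proof (induction L and S arbitrary: x y X and u Z)
  case (Tri a s b)
  then obtain w Xa Z Xb where f: "fits a x w Xa" "fits_s s w Z" "fits b w y Xb"
    and g: "tparts x y X w Xa Z Xb" "lobe x y X" by auto
  have V: "x \<in> V" "y \<in> V" using g E_V by (auto simp: tparts_def)
  have "card {w} + card (nbhd E x \<inter> Xa) \<le> card (nbhd E x \<inter> X)"
    by (rule nb_insert_card[OF V(1)]) (use g in \<open>auto simp: tparts_def nbhd_def\<close>)
  moreover have "card {w} + card (nbhd E y \<inter> Xb) \<le> card (nbhd E y \<inter> X)"
    by (rule nb_insert_card[OF V(2)]) (use g E_sym in \<open>auto simp: tparts_def nbhd_def\<close>)
  ultimately show ?case using Tri.IH(1)[OF f(1)] Tri.IH(3)[OF f(3)] by simp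
next
  case (Quad a s b r c)
  then obtain w v Xa Z Xb Z' Xc where f: "fits a x w Xa" "fits_s s w Z" "fits b w v Xb" "fits_s r v Z'" "fits c v y Xc"
    and g: "qparts x y X w v Xa Z Xb Z' Xc" "lobe x y X"
    unfolding fits.simps by blast
  have V: "x \<in> V" "y \<in> V" using g E_V by (auto simp: qparts_def)
  have "card {w} + card (nbhd E x \<inter> Xa) \<le> card (nbhd E x \<inter> X)"
    by (rule nb_insert_card[OF V(1)]) (use g in \<open>auto simp: qparts_def nbhd_def\<close>)
  moreover have "card {v} + card (nbhd E y \<inter> Xc) \<le> card (nbhd E y \<inter> X)"
    by (rule nb_insert_card[OF V(2)]) (use g E_sym in \<open>auto simp: qparts_def nbhd_def\<close>)
  ultimately show ?case using Quad.IH(1)[OF f(1)] Quad.IH(5)[OF f(5)] by simp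
next
  case (Block l s r)
  then obtain v X Zv Zr where f: "fits l u v X" "fits_s s v Zv" "fits_s r u Zr"
    and g: "bparts u Z v X Zv Zr" by auto
  have V: "u \<in> V" using g E_V by (auto simp: bparts_def)
  have "card (nbhd E u \<inter> X) + card (nbhd E u \<inter> Zr) \<le> card (nbhd E u \<inter> (X \<union> Zr))"
    by (rule nb_insert_card[OF V]) (use g in \<open>auto simp: bparts_def\<close>)
  moreover have "card {v} + card (nbhd E u \<inter> (X \<union> Zr)) \<le> card (nbhd E u \<inter> Z)"
    by (rule nb_insert_card[OF V]) (use g in \<open>auto simp: bparts_def nbhd_def\<close>)
  ultimately show ?case using Block.IH(1)[OF f(1)] Block.IH(3)[OF f(3)] by simp
qed auto

text \<open>
  \<open>ctx x y X t l r\<close> bounds what the edge \<open>xy\<close> meets on the far side of the lobe \<open>X\<close>: the common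
  neighbours, and the levels around \<open>x\<close> and around \<open>y\<close>.
\<close>

definition ctx :: "'a \<Rightarrow> 'a \<Rightarrow> 'a set \<Rightarrow> nat \<Rightarrow> nat \<Rightarrow> nat \<Rightarrow> bool" where
  "ctx x y X t l r \<longleftrightarrow> tcount x y (V - X - {x, y}) \<le> t \<and> score y x (V - X - {x, y}) \<le> l \<and>
    score x y (V - X - {x, y}) \<le> r"

lemma ctx_sym: "ctx x y X t l r \<Longrightarrow> ctx y x X t r l"
  by (auto simp: ctx_def tcount_comm insert_commute)

text \<open>All neighbours of the two ends lie in the lobe, on the far side, or are the ends
  themselves, so the bounds of both sides add up to bounds for the law.\<close>

lemma viol_sound:
  assumes xy: "E x y" and sX: "sep x y X" and v: "viol d e (t1 + t) (l1 + l) (r1 + r)"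
    and d: "d \<le> deg E x" "e \<le> deg E y"
    and s: "tcount x y X \<le> t1" "score y x X \<le> l1" "score x y X \<le> r1" and c: "ctx x y X t l r"
  shows False
proof -
  have V: "x \<in> V" "y \<in> V" using E_V xy by auto
  let ?C = "V - X - {x, y}"
  have m: "m2 d \<le> deg E x" "m2 e \<le> deg E y" "0 < m2 d" "0 < m2 e" using d md V by (auto simp: m2_def)
  have N: "nbhd E x \<subseteq> insert y (X \<union> ?C)" "nbhd E y \<subseteq> insert x (X \<union> ?C)" using nb_V nb_self by auto
  have "nbhd E x \<inter> nbhd E y \<subseteq> (nbhd E x \<inter> nbhd E y \<inter> X) \<union> (nbhd E x \<inter> nbhd E y \<inter> ?C)"
    using N nb_self by blast
  then have "card (nbhd E x \<inter> nbhd E y) \<le> card ((nbhd E x \<inter> nbhd E y \<inter> X) \<union> (nbhd E x \<inter> nbhd E y \<inter> ?C))"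
    using nb_fin V by (intro card_mono) auto
  also have "\<dots> \<le> tcount x y X + tcount x y ?C" unfolding tcount_def by (rule card_Un_le)
  also have "\<dots> \<le> t1 + t" using s c by (auto simp: ctx_def)
  finally have Tri: "card (nbhd E x \<inter> nbhd E y) \<le> t1 + t" .
  have 1: "score x y (- {x}) \<le> r1 + r"
  proof -
    have "nbhd E y \<inter> - {x} \<subseteq> X \<union> ?C" using N(2) by blast
    from score_split[OF V(2) this, of x] show ?thesis using s c by (simp add: ctx_def)
  qed
  have 2: "score y x (- {y}) \<le> l1 + l"
  proof -
    have "nbhd E x \<inter> - {y} \<subseteq> X \<union> ?C" using N(1) by blast
    from score_split[OF V(1) this, of y] show ?thesis using s c by (simp add: ctx_def)
  qed
  have T': "card (nbhd E y \<inter> nbhd E x) \<le> t1 + t" using Tri by (simp add: Int_commute)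
  show False
    using v law_bound[OF xy m(1,2) Tri 1 m(3,4)] law_bound[OF E_sym[OF xy] m(2,1) T' 2 m(4,3)]
    unfolding viol_def viol1_def by blast
qed

lemma ebad_sound:
  assumes f: "fits L x y X" and b: "ebad L d e t l r"
    and d: "d \<le> card (nbhd E x - X) + dl L" "e \<le> card (nbhd E y - X) + dr L" and c: "ctx x y X t l r"
  shows False
proof -
  have lb: "lobe x y X" by (rule fits_lobe[OF f])
  then have xy: "E x y" "sep x y X" by (auto simp: lobe_def)
  have V: "x \<in> V" "y \<in> V" using E_V xy by auto
  have D: "d \<le> deg E x" "e \<le> deg E y"
    using d degree_known(1)[OF f] degree_split[OF V(1), of X] degree_split[OF V(2), of X] by auto
  show False
  proof (cases L)
    case Any_lobe
    show False
    proof (cases "X = {}")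
      case True
      then show False using viol_sound[OF xy, of d e 0 t 0 l 0 r] b Any_lobe D c by auto
    next
      case False
      then have "att E x X" "att E y X" using lb by (auto simp: lobe_def)
      then have "nbhd E x \<inter> X \<noteq> {}" "nbhd E y \<inter> X \<noteq> {}" by (auto simp: att_def nbhd_def)
      then have "0 < card (nbhd E x \<inter> X)" "0 < card (nbhd E y \<inter> X)" using nb_fin V by (auto simp: card_gt_0_iff)
      then have D': "Suc d \<le> deg E x" "Suc e \<le> deg E y"
        using d Any_lobe degree_split[OF V(1), of X] degree_split[OF V(2), of X] by auto
      have "viol (Suc d) (Suc e) (1 + t) (3 + l) (3 + r)" using b Any_lobe by (simp add: add.commute)
      from viol_sound[OF xy this D'] lobe_score[OF lb] c show False by blast
    qed
  next
    case No_lobe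
    then show False using viol_sound[OF xy, of d e 0 t 0 l 0 r] f b D c by auto
  next
    case (Tri a s b')
    then obtain w Xa Z Xb where g: "fits a x w Xa" "fits_s s w Z" "fits b' w y Xb" and p: "tparts x y X w Xa Z Xb" using f by auto
    note q = tparts_sep[OF p fits_lobe[OF g(1)] fits_pend[OF g(2)] fits_lobe[OF g(3)]]
    have q': "X = insert w (Xb \<union> Z \<union> Xa)" using q(3) by auto
    have 1: "score x y X \<le> 2 + tau b'" "tcount x y X \<le> 1"
      using triangle_score[OF xy q(4,5,6,1,2,3)] tcount_tau[OF g(3)] by auto
    have 2: "score y x X \<le> 2 + tau a"
      using triangle_score(1)[OF E_sym[OF xy(1)] sep_sym[OF xy(2)] sep_sym[OF q(6)] q(5) sep_sym[OF q(4)] E_sym[OF q(2)] E_sym[OF q(1)] q']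
        tcount_tau[OF g(1)] by (simp add: tcount_comm)
    have "viol d e (1 + t) (2 + tau a + l) (2 + tau b' + r)" using b Tri by (simp add: add_ac)
    from viol_sound[OF xy this D 1(2) 2 1(1) c] show False .
  next
    case (Quad a s b' r' c')
    then obtain w v Xa Z Xb Z' Xc where g: "fits a x w Xa" "fits_s s w Z" "fits b' w v Xb" "fits_s r' v Z'" "fits c' v y Xc"
      and p: "qparts x y X w v Xa Z Xb Z' Xc" using f unfolding Quad fits.simps by blast
    have sp: "sep x w Xa" "sep w w Z" "sep w v Xb" "sep v v Z'" "sep v y Xc"
      using fits_lobe[OF g(1)] fits_pend[OF g(2)] fits_lobe[OF g(3)] fits_pend[OF g(4)] fits_lobe[OF g(5)]
      by (auto simp: lobe_def pend_def)
    have q: "E x w" "E w v" "E v y" "\<not> E x v" "\<not> E w y" "X = insert w (insert v (Xa \<union> Z \<union> Xb \<union> Z' \<union> Xc))"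
      using p by (auto simp: qparts_def)
    have q': "X = insert v (insert w (Xc \<union> Z' \<union> Xb \<union> Z \<union> Xa))" "\<not> E y w" "\<not> E v x" using q E_sym by blast+
    have 1: "score x y X \<le> 2 + tau c'" "tcount x y X \<le> 0"
      using square_score[OF xy sp q] tcount_tau[OF g(5)] by auto
    have 2: "score y x X \<le> 2 + tau a"
      using square_score(1)[OF E_sym[OF xy(1)] sep_sym[OF xy(2)] sep_sym[OF sp(5)] sp(4) sep_sym[OF sp(3)] sp(2) sep_sym[OF sp(1)]
          E_sym[OF q(3)] E_sym[OF q(2)] E_sym[OF q(1)] q'(2,3,1)]
        tcount_tau[OF g(1)] by (simp add: tcount_comm)
    have "viol d e (0 + t) (2 + tau a + l) (2 + tau c' + r)" using b Quad by (simp add: add_ac)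
    from viol_sound[OF xy this D 1(2) 2 1(1) c] show False .
  qed
qed

lemma sep_Un_pend: "sep w y Xb \<Longrightarrow> sep w w Z \<Longrightarrow> y \<notin> Z \<Longrightarrow> sep w y (Xb \<union> Z)"
  by (auto simp: sep_def)

lemma tcount_Un_pend: "sep w w Z \<Longrightarrow> y \<notin> Z \<Longrightarrow> y \<noteq> w \<Longrightarrow> tcount w y (Xb \<union> Z) = tcount w y Xb"
  unfolding tcount_def by (rule arg_cong[of _ _ card]) (auto simp: nbhd_def dest: sepD')

lemma sep_far: "sep x y X \<Longrightarrow> sep x y (V - X - {x, y})"
  using sepD' E_V unfolding sep_def by blast

end

context posgraph
begin

lemma sep_nonadj: "sep a b S \<Longrightarrow> z \<in> S \<Longrightarrow> c \<notin> S \<Longrightarrow> c \<noteq> a \<Longrightarrow> c \<noteq> b \<Longrightarrow> \<not> E c z"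
  using sepD' by blast

lemma ctx_mono: "ctx x y X t l r \<Longrightarrow> t \<le> t' \<Longrightarrow> l \<le> l' \<Longrightarrow> r \<le> r' \<Longrightarrow> ctx x y X t' l' r'"
  by (auto simp: ctx_def)

text \<open>On the far side of \<open>xw\<close>, \<open>y\<close> is the only common neighbour.
  Next to \<open>w\<close> around \<open>x\<close> comes \<open>y\<close> with the far side of
  \<open>xy\<close> behind it, and next to \<open>x\<close> around \<open>w\<close> comes
  \<open>y\<close> with \<open>Xb\<close> behind it; \<open>score_next\<close> applies to both. The
  slot \<open>Z\<close> at \<open>w\<close> adds nothing.\<close>

lemma triangle_ctx:
  assumes p: "tparts x y X w Xa Z Xb" and sX: "sep x y X" "E x y"
    and s: "sep x w Xa" "sep w w Z" "sep w y Xb" and c: "ctx x y X t l r"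
  shows "ctx x w Xa 1 (2 + t) (2 + tcount w y Xb)"
proof -
  have q: "E x w" "E w y" "X = insert w (Xa \<union> Z \<union> Xb)" "sep x w Xa" "sep w w Z" "sep w y Xb"
    using p s by (auto simp: tparts_def)
  have ne: "x \<notin> X" "y \<notin> X" "x \<noteq> y" "w \<noteq> x" "w \<noteq> y" using sep_notin[OF sX(1)] E_ne sX(2) q(1,2) by blast+
  have wX: "w \<in> X" "w \<notin> Xa" "w \<notin> Z" "w \<notin> Xb" using p by (auto simp: tparts_def)
  have sub: "Xa \<subseteq> X" "Z \<subseteq> X" "Xb \<subseteq> X" using q(3) by auto
  have nx: "\<not> E x z" if "z \<in> Z \<union> Xb" for z
    using that sep_nonadj[OF q(5), of z x] sep_nonadj[OF q(6), of z x] ne sub by blast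
  have Nw: "z \<in> X \<or> z = x \<or> z = y" if "E w z" for z using sepD[OF sX(1) wX(1) that] .
  let ?D = "V - Xa - {x, w}" and ?C = "V - X - {x, y}"
  have 1: "tcount x w ?D \<le> 1" by (rule tcount_le_1[of _ _ _ y]) (use Nw nx q(3) in blast)
  have "score w x ?D \<le> 2 + tcount x y ?C"
  proof (rule score_next(1)[OF E_sym[OF q(1)] sep_far[OF sX(1)] _ _ sX(2)])
    show "nbhd E x \<inter> ?D \<subseteq> insert y ?C" using nx q(3) by (auto simp: nbhd_def)
  qed (use wX ne in auto)
  then have 2: "score w x ?D \<le> 2 + t" using c by (simp add: ctx_def)
  have yZ: "y \<notin> Z" using sub ne by auto
  have "score x w ?D \<le> 2 + tcount w y (Xb \<union> Z)"
  proof (rule score_next(1)[OF q(1) sep_Un_pend[OF q(6,5) yZ] _ _ q(2)])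
    show "nbhd E w \<inter> ?D \<subseteq> insert y (Xb \<union> Z)" using Nw q(3) by (auto simp: nbhd_def)
  qed (use sub ne in auto)
  then have 3: "score x w ?D \<le> 2 + tcount w y Xb" using tcount_Un_pend[OF q(5) yZ] ne by simp
  show ?thesis using 1 2 3 by (simp add: ctx_def)
qed

lemma tparts_sym: "tparts x y X w Xa Z Xb \<Longrightarrow> tparts y x X w Xb Z Xa"
  using E_sym by (auto simp: tparts_def)

lemma qparts_sep:
  assumes p: "qparts x y X w v Xa Z Xb Z' Xc" and l: "lobe x w Xa" "pend w Z" "lobe w v Xb" "pend v Z'" "lobe v y Xc"
  shows "E x w" "E w v" "E v y" "\<not> E x v" "\<not> E w y" "X = insert w (insert v (Xa \<union> Z \<union> Xb \<union> Z' \<union> Xc))"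
    "sep x w Xa" "sep w w Z" "sep w v Xb" "sep v v Z'" "sep v y Xc"
    "w \<notin> Xa" "w \<notin> Z" "w \<notin> Xb" "w \<notin> Z'" "w \<notin> Xc" "v \<notin> Xa" "v \<notin> Z" "v \<notin> Xb" "v \<notin> Z'" "v \<notin> Xc"
  using assms by (auto simp: qparts_def lobe_def pend_def)

text \<open>
  The three contexts are stated for separations rather than lobes, so that the third follows from
  the first by reading the square backwards.
\<close>

lemma square_ctx:
  assumes q: "E x w" "E w v" "E v y" "\<not> E x v" "\<not> E w y" "X = insert w (insert v (Xa \<union> Z \<union> Xb \<union> Z' \<union> Xc))"
    "sep x w Xa" "sep w w Z" "sep w v Xb" "sep v v Z'" "sep v y Xc"
    "w \<notin> Xa" "w \<notin> Z" "w \<notin> Xb" "w \<notin> Z'" "w \<notin> Xc" "v \<notin> Xa" "v \<notin> Z" "v \<notin> Xb" "v \<notin> Z'" "v \<notin> Xc"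
    and sX: "sep x y X" "E x y" and c: "ctx x y X t l' r"
  shows "ctx x w Xa 0 (2 + t) (2 + tcount w v Xb)" "ctx w v Xb 0 (2 + tcount w x Xa) (2 + tcount v y Xc)"
proof -
  have ne: "x \<notin> X" "y \<notin> X" "x \<noteq> y" using sep_notin[OF sX(1)] E_ne sX(2) by blast+
  have wv: "w \<in> X" "v \<in> X" "w \<noteq> v" "w \<noteq> x" "w \<noteq> y" "v \<noteq> x" "v \<noteq> y" using q(6) ne E_ne q(2) by auto
  have sub: "Xa \<subseteq> X" "Z \<subseteq> X" "Xb \<subseteq> X" "Z' \<subseteq> X" "Xc \<subseteq> X" using q(6) by auto
  have nx: "\<not> E x z" if "z \<in> Z \<union> Xb \<union> Z' \<union> Xc" for z
    using that sep_nonadj[OF q(8), of z x] sep_nonadj[OF q(9), of z x] sep_nonadj[OF q(10), of z x] sep_nonadj[OF q(11), of z x]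
      ne sub wv by blast
  have nw: "\<not> E w z" if "z \<in> Z' \<union> Xc" for z
    using that sep_nonadj[OF q(10), of z w] sep_nonadj[OF q(11), of z w] q wv by blast
  have nv: "\<not> E v z" if "z \<in> Xa \<union> Z" for z
    using that sep_nonadj[OF q(7), of z v] sep_nonadj[OF q(8), of z v] q wv by blast
  have Nw: "z \<in> X \<or> z = x" if "E w z" for z using sepD[OF sX(1) wv(1) that] q(5) that by blast
  have Nv: "z \<in> X \<or> z = y" if "E v z" for z using sepD[OF sX(1) wv(2) that] q(4) that E_sym by blast
  let ?C = "V - X - {x, y}"
  let ?D = "V - Xa - {x, w}" 
  have 1: "tcount x w ?D = 0" by (rule tcount_0) (use Nw nx q(4,6) in blast)
  have "score w x ?D \<le> 2 + tcount x y ?C"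
  proof (rule score_next(1)[OF E_sym[OF q(1)] sep_far[OF sX(1)] _ _ sX(2)])
    show "nbhd E x \<inter> ?D \<subseteq> insert y ?C" using nx q(4,6) by (auto simp: nbhd_def)
  qed (use wv ne in auto)
  then have 2: "score w x ?D \<le> 2 + t" using c by (simp add: ctx_def)
  have "score x w ?D \<le> 2 + tcount w v (Xb \<union> Z)"
  proof (rule score_next(1)[OF q(1) sep_Un_pend[OF q(9,8,18)] _ _ q(2)])
    show "nbhd E w \<inter> ?D \<subseteq> insert v (Xb \<union> Z)" using Nw nw q(6) by (auto simp: nbhd_def)
  qed (use sub ne wv in auto)
  then have 3: "score x w ?D \<le> 2 + tcount w v Xb" using tcount_Un_pend[OF q(8,18)] wv by simp
  show "ctx x w Xa 0 (2 + t) (2 + tcount w v Xb)" using 1 2 3 by (simp add: ctx_def)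
  let ?F = "V - Xb - {w, v}"
  have 4: "tcount w v ?F = 0"
  proof (rule tcount_0)
    fix z assume z: "z \<in> ?F" "E w z" "E v z"
    then have "z \<in> X" using Nw[of z] Nv[of z] ne by blast
    then show False using z nv[of z] nw[of z] q(6) by blast
  qed
  have "score v w ?F \<le> 2 + tcount w x (Xa \<union> Z)"
  proof (rule score_next(1)[OF E_sym[OF q(2)] sep_Un_pend[OF sep_sym[OF q(7)] q(8)] _ _ E_sym[OF q(1)]])
    show "nbhd E w \<inter> ?F \<subseteq> insert x (Xa \<union> Z)" using Nw nw q(6) by (auto simp: nbhd_def)
  qed (use sub ne wv q in auto)
  moreover have "x \<notin> Z" "x \<noteq> w" using ne sub wv by blast+
  ultimately have 5: "score v w ?F \<le> 2 + tcount w x Xa" using tcount_Un_pend[OF q(8), of x Xa] by simp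
  have "score w v ?F \<le> 2 + tcount v y (Xc \<union> Z')"
  proof (rule score_next(1)[OF q(2) sep_Un_pend[OF q(11,10)] _ _ q(3)])
    show "nbhd E v \<inter> ?F \<subseteq> insert y (Xc \<union> Z')" using Nv nv q(6) by (auto simp: nbhd_def)
  qed (use sub ne wv q in auto)
  moreover have "y \<notin> Z'" "y \<noteq> v" using ne sub wv by blast+
  ultimately have 6: "score w v ?F \<le> 2 + tcount v y Xc" using tcount_Un_pend[OF q(10), of y Xc] by simp
  show "ctx w v Xb 0 (2 + tcount w x Xa) (2 + tcount v y Xc)" using 4 5 6 by (simp add: ctx_def)
qed

lemma square_ctx_right:
  assumes q: "E x w" "E w v" "E v y" "\<not> E x v" "\<not> E w y" "X = insert w (insert v (Xa \<union> Z \<union> Xb \<union> Z' \<union> Xc))"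
    "sep x w Xa" "sep w w Z" "sep w v Xb" "sep v v Z'" "sep v y Xc"
    "w \<notin> Xa" "w \<notin> Z" "w \<notin> Xb" "w \<notin> Z'" "w \<notin> Xc" "v \<notin> Xa" "v \<notin> Z" "v \<notin> Xb" "v \<notin> Z'" "v \<notin> Xc"
    and sX: "sep x y X" "E x y" and c: "ctx x y X t l' r"
  shows "ctx v y Xc 0 (2 + tcount v w Xb) (2 + t)"
proof -
  have n: "\<not> E y w" "\<not> E v x" using q E_sym by blast+
  have X': "X = insert v (insert w (Xc \<union> Z' \<union> Xb \<union> Z \<union> Xa))" using q(6) by auto
  show ?thesis
    by (rule ctx_sym, rule square_ctx(1)[OF E_sym[OF q(3)] E_sym[OF q(2)] E_sym[OF q(1)] n X'
          sep_sym[OF q(11)] q(10) sep_sym[OF q(9)] q(8) sep_sym[OF q(7)] q(21,20,19,18,17,16,15,14,13,12)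
          sep_sym[OF sX(1)] E_sym[OF sX(2)] ctx_sym[OF c]])
qed

text \<open>The block at \<open>uv\<close> lies on one side of \<open>uv\<close>; beyond it there
  are only branches hanging at \<open>u\<close> or at \<open>v\<close>, whose vertices have level 0
  by \<open>level_pend\<close>.\<close>

lemma bparts_ctx:
  assumes b: "bparts u Z v X Zv Zr" and l: "pend u Z" "lobe u v X" "pend v Zv" "pend u Zr"
  shows "ctx u v X 0 0 0"
proof -
  have q: "E u v" "Z = insert v (X \<union> Zv \<union> Zr)" "v \<notin> X" "v \<notin> Zv" "v \<notin> Zr" using b by (auto simp: bparts_def)
  have s: "sep u u Z" "sep u v X" "sep v v Zv" "sep u u Zr" using l by (auto simp: lobe_def pend_def)
  have uZ: "u \<notin> Z" "u \<noteq> v" using sep_notin[OF s(1)] E_ne[OF q(1)] by auto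
  have nu: "\<not> E u z" if "z \<in> Zv" for z using sep_nonadj[OF s(3) that, of u] uZ q(2) by blast
  have nv: "\<not> E v z" if "z \<in> Zr" for z using sep_nonadj[OF s(4) that, of v] uZ q by blast
  have Nv: "z \<in> Z \<or> z = u" if "E v z" for z using sepD[OF s(1) _ that] q(2) by blast
  let ?D = "V - X - {u, v}" and ?S = "V - X - {u, v} - Zv"
  have 1: "tcount u v ?D = 0" by (rule tcount_0) (use Nv nu nv q(2) in blast)
  \<comment> \<open>Everything outside \<open>X\<close>, \<open>Zv\<close> and the edge hangs at
    \<open>u\<close> alone, including the part of the graph outside \<open>Z\<close>.\<close>
  have sS: "sep u u ?S"
    unfolding sep_def
  proof (intro conjI ballI allI impI)
    fix p r assume p: "p \<in> ?S" and e: "E p r"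
    have "r \<notin> X" using sepD'[OF s(2) _ e] p by blast
    moreover have "r \<notin> Zv" using sepD'[OF s(3) _ e] p by blast
    moreover have "r \<noteq> v" using Nv[of p] nv[of p] p e E_sym q(2) by blast
    ultimately show "r \<in> ?S \<or> r = u \<or> r = u" using E_V[OF e] by blast
  qed (use q in auto)
  have "score v u ?D = 0"
    unfolding score_def
  proof (rule sum.neutral, rule ballI)
    fix b assume "b \<in> nbhd E u \<inter> ?D"
    then have "b \<in> ?S" using nu by (auto simp: nbhd_def)
    then show "level E v u b = 0" using level_pend[OF sS, of v] uZ by auto
  qed
  moreover have "score u v ?D = 0"
    unfolding score_def
  proof (rule sum.neutral, rule ballI)
    fix b assume "b \<in> nbhd E v \<inter> ?D"
    then have "b \<in> Zv" using Nv[of b] nv[of b] q(2) by (auto simp: nbhd_def)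
    then show "level E u v b = 0" using level_pend[OF s(3), of u] uZ q(2) by auto
  qed
  ultimately show ?thesis using 1 by (simp add: ctx_def)
qed

lemma nb_two_card:
  assumes "E u p" "E u q" "p \<noteq> q" "p \<notin> S1 \<union> S2" "q \<notin> S1 \<union> S2" "S1 \<inter> S2 = {}" "R \<inter> ({p, q} \<union> S1 \<union> S2) = {}"
  shows "2 + card (nbhd E u \<inter> S1) + card (nbhd E u \<inter> S2) \<le> card (nbhd E u - R)"
proof -
  have V: "u \<in> V" using E_V assms by blast
  have "card (nbhd E u \<inter> S1) + card (nbhd E u \<inter> S2) \<le> card (nbhd E u \<inter> (S1 \<union> S2))"
    by (rule nb_insert_card[OF V]) (use assms in auto)
  moreover have "card {p, q} + card (nbhd E u \<inter> (S1 \<union> S2)) \<le> card (nbhd E u \<inter> - R)"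
    by (rule nb_insert_card[OF V]) (use assms in \<open>auto simp: nbhd_def\<close>)
  ultimately show ?thesis using assms(3) by (simp add: Diff_eq)
qed

lemma nb_one_card:
  assumes "E u p" "p \<notin> S1 \<union> S2" "S1 \<inter> S2 = {}" "R \<inter> ({p} \<union> S1 \<union> S2) = {}"
  shows "1 + card (nbhd E u \<inter> S1) + card (nbhd E u \<inter> S2) \<le> card (nbhd E u - R)"
proof -
  have V: "u \<in> V" using E_V assms by blast
  have "card (nbhd E u \<inter> S1) + card (nbhd E u \<inter> S2) \<le> card (nbhd E u \<inter> (S1 \<union> S2))"
    by (rule nb_insert_card[OF V]) (use assms in auto)
  moreover have "card {p} + card (nbhd E u \<inter> (S1 \<union> S2)) \<le> card (nbhd E u \<inter> - R)"
    by (rule nb_insert_card[OF V]) (use assms in \<open>auto simp: nbhd_def\<close>)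
  ultimately show ?thesis by (simp add: Diff_eq)
qed

lemma nb_outer: "nbhd E u \<inter> (UNIV - S) = nbhd E u - S" by auto

text \<open>\<open>d\<close> and \<open>e\<close> count the neighbours outside the piece plus those
  guaranteed by the tree. This split lets the induction pass a bound for the full degree down to a
  part: the sibling parts then lie outside it.\<close>

lemma bad_sound:
  assumes M: "\<forall>v\<in>V. deg E v \<le> M"
  shows "fits L x y X \<Longrightarrow> bad_l L M d e t l r \<Longrightarrow> d \<le> card (nbhd E x - X) + dl L \<Longrightarrow>
      e \<le> card (nbhd E y - X) + dr L \<Longrightarrow> ctx x y X t l r \<Longrightarrow> False"
    and "fits_s S u Z \<Longrightarrow> bad_s S M d \<Longrightarrow> d \<le> card (nbhd E u - Z) + ds S \<Longrightarrow> False"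
proof (induction L and S arbitrary: x y X d e t l r and u Z d)
  case Any_lobe
  show ?case by (rule ebad_sound[OF Any_lobe.prems(1) Any_lobe.prems(2)[unfolded bad_l.simps] Any_lobe.prems(3-5)])
next
  case No_lobe
  show ?case by (rule ebad_sound[OF No_lobe.prems(1) No_lobe.prems(2)[unfolded bad_l.simps] No_lobe.prems(3-5)])
next
  case (Tri a s b)
  from Tri.prems(1) obtain w Xa Z Xb where f: "fits a x w Xa" "fits_s s w Z" "fits b w y Xb"
    and p: "tparts x y X w Xa Z Xb" and lX: "lobe x y X" by auto
  note lb = fits_lobe[OF f(1)] fits_pend[OF f(2)] fits_lobe[OF f(3)]
  have sX: "x \<notin> X" "y \<notin> X" "x \<noteq> y" "E x y" "sep x y X" using lX sep_notin E_ne by (auto simp: lobe_def)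
  have sp: "sep x w Xa" "sep w w Z" "sep w y Xb" using lb by (auto simp: lobe_def pend_def)
  have q: "E x w" "E w x" "E w y" "E y w" "X = insert w (Xa \<union> Z \<union> Xb)"
    "w \<notin> Xa" "w \<notin> Z" "w \<notin> Xb" "Xa \<inter> Z = {}" "Xa \<inter> Xb = {}" "Z \<inter> Xb = {}"
    using p E_sym by (auto simp: tparts_def)
  define f0 where "f0 = 2 + dr a + dl b + ds s"
  have k: "dr a \<le> card (nbhd E w \<inter> Xa)" "dl b \<le> card (nbhd E w \<inter> Xb)" "ds s \<le> card (nbhd E w \<inter> Z)"
    using degree_known(1)[OF f(1)] degree_known(1)[OF f(3)] degree_known(2)[OF f(2)] by auto
  have c1: "2 + card (nbhd E w \<inter> Xb) + card (nbhd E w \<inter> Z) \<le> card (nbhd E w - Xa)"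
    by (rule nb_two_card[OF q(2,3)]) (use q sX in auto)
  have c2: "2 + card (nbhd E w \<inter> Xa) + card (nbhd E w \<inter> Z) \<le> card (nbhd E w - Xb)"
    by (rule nb_two_card[OF q(2,3)]) (use q sX in auto)
  have c3: "2 + card (nbhd E w \<inter> Xa) + card (nbhd E w \<inter> Xb) \<le> card (nbhd E w - Z)"
    by (rule nb_two_card[OF q(2,3)]) (use q sX in auto)
  have c4: "1 + card (nbhd E x - X) + 0 \<le> card (nbhd E x - Xa)"
    using nb_one_card[OF q(1), of "UNIV - X" "{}" Xa] q(5,6) by (simp add: nb_outer) blast
  have c5: "1 + card (nbhd E y - X) + 0 \<le> card (nbhd E y - Xb)"
    using nb_one_card[OF q(4), of "UNIV - X" "{}" Xb] q(5,8) by (simp add: nb_outer) blast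
  have x1: "ctx x w Xa 1 (2 + t) (2 + tau b)"
    using ctx_mono[OF triangle_ctx[OF p sX(5,4) sp Tri.prems(5)], of 1 "2 + t" "2 + tau b"] tcount_tau[OF f(3)] by simp
  have x2: "ctx w y Xb 1 (2 + tau a) (2 + t)"
  proof -
    have "ctx y w Xb 1 (2 + t) (2 + tcount w x Xa)"
      by (rule triangle_ctx[OF tparts_sym[OF p] sep_sym[OF sX(5)] E_sym[OF sX(4)] sep_sym[OF sp(3)] sp(2) sep_sym[OF sp(1)] ctx_sym[OF Tri.prems(5)]])
    then show ?thesis using ctx_mono[OF ctx_sym, of y w Xb 1 "2 + t" "2 + tcount w x Xa" 1 "2 + tau a" "2 + t"] tcount_tau[OF f(1)]
      by (simp add: tcount_comm)
  qed
  have "ebad (Tri a s b) d e t l r \<or> bad_l a M d f0 1 (2 + t) (2 + tau b) \<or> bad_l b M f0 e 1 (2 + tau a) (2 + t) \<or> bad_s s M f0"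
    using Tri.prems(2) unfolding bad_l.simps Let_def f0_def .
  then show False
  proof (elim disjE)
    assume "ebad (Tri a s b) d e t l r"
    from ebad_sound[OF Tri.prems(1) this Tri.prems(3-5)] show False .
  next
    assume "bad_l a M d f0 1 (2 + t) (2 + tau b)"
    from Tri.IH(1)[OF f(1) this _ _ x1] show False using Tri.prems(3) c1 c4 k by (simp add: f0_def)
  next
    assume "bad_l b M f0 e 1 (2 + tau a) (2 + t)"
    from Tri.IH(3)[OF f(3) this _ _ x2] show False using Tri.prems(4) c2 c5 k by (simp add: f0_def)
  next
    assume "bad_s s M f0"
    from Tri.IH(2)[OF f(2) this] show False using c3 k by (simp add: f0_def)
  qed
next
  case (Quad a s b r0 c)
  from Quad.prems(1) obtain w v Xa Z Xb Z' Xc where f: "fits a x w Xa" "fits_s s w Z" "fits b w v Xb" "fits_s r0 v Z'" "fits c v y Xc"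
    and p: "qparts x y X w v Xa Z Xb Z' Xc" and lX: "lobe x y X" unfolding fits.simps by blast
  note lb = fits_lobe[OF f(1)] fits_pend[OF f(2)] fits_lobe[OF f(3)] fits_pend[OF f(4)] fits_lobe[OF f(5)]
  have sX: "x \<notin> X" "y \<notin> X" "x \<noteq> y" "sep x y X" "E x y" using lX sep_notin E_ne by (auto simp: lobe_def)
  note q = qparts_sep[OF p lb]
  note e' = E_sym[OF q(1)] E_sym[OF q(2)] E_sym[OF q(3)]
  have dj: "Xa \<inter> Z = {}" "Xa \<inter> Xb = {}" "Xa \<inter> Z' = {}" "Xa \<inter> Xc = {}" "Z \<inter> Xb = {}" "Z \<inter> Z' = {}" "Z \<inter> Xc = {}"
    "Xb \<inter> Z' = {}" "Xb \<inter> Xc = {}" "Z' \<inter> Xc = {}" using p unfolding qparts_def by simp_all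
  have o: "x \<noteq> v" "w \<noteq> y" "x \<notin> Xa" "x \<notin> Z" "x \<notin> Xb" "y \<notin> Xb" "y \<notin> Z'" "y \<notin> Xc" using sX q(6) by blast+
  define f0 where "f0 = 2 + dr a + dl b + ds s"
  define g0 where "g0 = 2 + dr b + dl c + ds r0"
  have k: "dr a \<le> card (nbhd E w \<inter> Xa)" "dl b \<le> card (nbhd E w \<inter> Xb)" "ds s \<le> card (nbhd E w \<inter> Z)"
    "dr b \<le> card (nbhd E v \<inter> Xb)" "dl c \<le> card (nbhd E v \<inter> Xc)" "ds r0 \<le> card (nbhd E v \<inter> Z')"
    using degree_known(1)[OF f(1)] degree_known(1)[OF f(3)] degree_known(2)[OF f(2)] degree_known(1)[OF f(5)] degree_known(2)[OF f(4)] by auto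
  have c1: "2 + card (nbhd E w \<inter> Xb) + card (nbhd E w \<inter> Z) \<le> card (nbhd E w - Xa)"
    by (rule nb_two_card[OF e'(1) q(2)]) (use q(12-21) o dj in auto)
  have c2: "2 + card (nbhd E w \<inter> Xa) + card (nbhd E w \<inter> Z) \<le> card (nbhd E w - Xb)"
    by (rule nb_two_card[OF e'(1) q(2)]) (use q(12-21) o dj in auto)
  have c3: "2 + card (nbhd E w \<inter> Xa) + card (nbhd E w \<inter> Xb) \<le> card (nbhd E w - Z)"
    by (rule nb_two_card[OF e'(1) q(2)]) (use q(12-21) o dj in auto)
  have c4: "2 + card (nbhd E v \<inter> Xc) + card (nbhd E v \<inter> Z') \<le> card (nbhd E v - Xb)"
    by (rule nb_two_card[OF e'(2) q(3)]) (use q(12-21) o dj in auto)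
  have c5: "2 + card (nbhd E v \<inter> Xb) + card (nbhd E v \<inter> Z') \<le> card (nbhd E v - Xc)"
    by (rule nb_two_card[OF e'(2) q(3)]) (use q(12-21) o dj in auto)
  have c6: "2 + card (nbhd E v \<inter> Xb) + card (nbhd E v \<inter> Xc) \<le> card (nbhd E v - Z')"
    by (rule nb_two_card[OF e'(2) q(3)]) (use q(12-21) o dj in auto)
  have "Xa \<inter> ({w} \<union> (UNIV - X) \<union> {}) = {}" "Xc \<inter> ({v} \<union> (UNIV - X) \<union> {}) = {}" "w \<in> X" "v \<in> X" using q(6,12,21) by blast+
  then have c7: "1 + card (nbhd E x - X) + 0 \<le> card (nbhd E x - Xa)" and c8: "1 + card (nbhd E y - X) + 0 \<le> card (nbhd E y - Xc)"
    using nb_one_card[OF q(1), of "UNIV - X" "{}" Xa] nb_one_card[OF e'(3), of "UNIV - X" "{}" Xc] by (simp_all add: nb_outer)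
  have t: "tcount w v Xb \<le> tau b" "tcount w x Xa \<le> tau a" "tcount v y Xc \<le> tau c" "tcount v w Xb \<le> tau b"
    using tcount_tau[OF f(1)] tcount_tau[OF f(3)] tcount_tau[OF f(5)] by (simp_all add: tcount_comm)
  have x1: "ctx x w Xa 0 (2 + t) (2 + tau b)" by (rule ctx_mono[OF square_ctx(1)[OF q sX(4,5) Quad.prems(5)]]) (use t in auto)
  have x2: "ctx w v Xb 0 (2 + tau a) (2 + tau c)" by (rule ctx_mono[OF square_ctx(2)[OF q sX(4,5) Quad.prems(5)]]) (use t in auto)
  have x3: "ctx v y Xc 0 (2 + tau b) (2 + t)" by (rule ctx_mono[OF square_ctx_right[OF q sX(4,5) Quad.prems(5)]]) (use t in auto)
  have "ebad (Quad a s b r0 c) d e t l r \<or> bad_l a M d f0 0 (2 + t) (2 + tau b) \<or> bad_l b M f0 g0 0 (2 + tau a) (2 + tau c) \<or>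
      bad_l c M g0 e 0 (2 + tau b) (2 + t) \<or> bad_s s M f0 \<or> bad_s r0 M g0"
    using Quad.prems(2) unfolding bad_l.simps Let_def f0_def g0_def .
  then show False
  proof (elim disjE)
    assume "ebad (Quad a s b r0 c) d e t l r"
    from ebad_sound[OF Quad.prems(1) this Quad.prems(3-5)] show False .
  next
    assume "bad_l a M d f0 0 (2 + t) (2 + tau b)"
    from Quad.IH(1)[OF f(1) this _ _ x1] show False using Quad.prems(3) c1 c7 k by (simp add: f0_def)
  next
    assume "bad_l b M f0 g0 0 (2 + tau a) (2 + tau c)"
    from Quad.IH(3)[OF f(3) this _ _ x2] show False using c2 c4 k by (simp add: f0_def g0_def)
  next
    assume "bad_l c M g0 e 0 (2 + tau b) (2 + t)"
    from Quad.IH(5)[OF f(5) this _ _ x3] show False using Quad.prems(4) c5 c8 k by (simp add: g0_def)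
  next
    assume "bad_s s M f0"
    from Quad.IH(2)[OF f(2) this] show False using c3 k by (simp add: f0_def)
  next
    assume "bad_s r0 M g0"
    from Quad.IH(4)[OF f(4) this] show False using c6 k by (simp add: g0_def)
  qed
next
  case Any_slot
  then have "d \<le> deg E u" using nb_fin by (auto simp: pend_def deg_def intro: order_trans card_mono)
  then show ?case using Any_slot M by (auto simp: pend_def)
next
  case No_slot
  then have "d \<le> deg E u" using nb_fin by (auto simp: pend_def deg_def)
  then show ?case using No_slot M by (auto simp: pend_def)
next
  case (Block l s r)
  from Block.prems(1) obtain v X Zv Zr where f: "fits l u v X" "fits_s s v Zv" "fits_s r u Zr"
    and p: "bparts u Z v X Zv Zr" and lZ: "pend u Z" by auto
  note lb = fits_lobe[OF f(1)] fits_pend[OF f(2)] fits_pend[OF f(3)]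
  have q: "E u v" "E v u" "Z = insert v (X \<union> Zv \<union> Zr)" "v \<notin> X" "v \<notin> Zv" "v \<notin> Zr" "X \<inter> Zv = {}" "X \<inter> Zr = {}" "Zv \<inter> Zr = {}"
    using p E_sym by (auto simp: bparts_def)
  have uZ: "u \<notin> Z" "u \<in> V" using lZ sep_notin by (auto simp: pend_def)
  have D: "d \<le> deg E u" using Block.prems(3) degree_known(2)[OF Block.prems(1)] degree_split[OF uZ(2), of Z] by auto
  have k: "dr l \<le> card (nbhd E v \<inter> X)" "dl l \<le> card (nbhd E u \<inter> X)" "ds s \<le> card (nbhd E v \<inter> Zv)" "ds r \<le> card (nbhd E u \<inter> Zr)"
    using degree_known(1)[OF f(1)] degree_known(2)[OF f(2)] degree_known(2)[OF f(3)] by auto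
  have e: "(UNIV - Z) \<inter> Zr = {}" "(UNIV - Z) \<inter> X = {}" "X \<inter> ({v} \<union> (UNIV - Z) \<union> Zr) = {}" "Zr \<inter> ({v} \<union> (UNIV - Z) \<union> X) = {}"
    "v \<notin> (UNIV - Z) \<union> Zr" "v \<notin> (UNIV - Z) \<union> X" using q(3-9) by blast+
  have c1: "1 + card (nbhd E u - Z) + card (nbhd E u \<inter> Zr) \<le> card (nbhd E u - X)"
    using nb_one_card[OF q(1) e(5,1,3)] by (simp add: nb_outer)
  have c2: "1 + card (nbhd E u - Z) + card (nbhd E u \<inter> X) \<le> card (nbhd E u - Zr)"
    using nb_one_card[OF q(1) e(6,2,4)] by (simp add: nb_outer)
  have c3: "1 + card (nbhd E v \<inter> Zv) + card (nbhd E v \<inter> {}) \<le> card (nbhd E v - X)"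
    by (rule nb_one_card[OF q(2)]) (use q(3-9) uZ in auto)
  have c4: "1 + card (nbhd E v \<inter> X) + card (nbhd E v \<inter> {}) \<le> card (nbhd E v - Zv)"
    by (rule nb_one_card[OF q(2)]) (use q(3-9) uZ in auto)
  define f0 where "f0 = 1 + dr l + ds s"
  have x: "ctx u v X 0 0 0" by (rule bparts_ctx[OF p lZ lb])
  have "M < d \<or> bad_l l M d f0 0 0 0 \<or> bad_s s M f0 \<or> bad_s r M d"
    using Block.prems(2) unfolding bad_s.simps Let_def f0_def .
  then show False
  proof (elim disjE)
    assume "M < d" then show False using D M uZ by auto
  next
    assume "bad_l l M d f0 0 0 0"
    from Block.IH(1)[OF f(1) this _ _ x] show False using Block.prems(3) c1 c3 k by (simp add: f0_def)
  next
    assume "bad_s s M f0"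
    from Block.IH(2)[OF f(2) this] show False using c4 k by (simp add: f0_def)
  next
    assume "bad_s r M d"
    from Block.IH(3)[OF f(3) this] show False using Block.prems(3) c2 k by simp
  qed
qed

text \<open>Once the left spine of the tree is determined, \<open>dl\<close> misses no neighbour of
  \<open>x\<close>: all of them are face vertices on that spine, as the other parts are separated
  from \<open>x\<close>.\<close>

lemma fan_closed_l: "fits L x y X \<Longrightarrow> fan_l L = [] \<Longrightarrow> card (nbhd E x \<inter> X) \<le> dl L"
proof (induction L arbitrary: x y X rule: fan_l.induct)
  case (3 a s b)
  from "3.prems"(1) obtain w Xa Z Xb where f: "fits a x w Xa" "fits_s s w Z" "fits b w y Xb"
    and p: "tparts x y X w Xa Z Xb" and lX: "lobe x y X" by auto
  note q = tparts_sep[OF p fits_lobe[OF f(1)] fits_pend[OF f(2)] fits_lobe[OF f(3)]]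
  have ne: "x \<notin> X" "x \<noteq> w" "x \<noteq> y" using lX sep_notin E_ne q(1) by (auto simp: lobe_def)
  have "nbhd E x \<inter> X \<subseteq> insert w (nbhd E x \<inter> Xa)"
    using q(3) ne sep_nonadj[OF q(5), of _ x] sep_nonadj[OF q(6), of _ x] by (auto simp: nbhd_def)
  then have "card (nbhd E x \<inter> X) \<le> card (insert w (nbhd E x \<inter> Xa))" using nb_fin E_V[OF q(1)] by (intro card_mono) auto
  also have "\<dots> \<le> Suc (card (nbhd E x \<inter> Xa))" by (rule card_insert_le_m1) auto
  also have "card (nbhd E x \<inter> Xa) \<le> dl a" using "3.IH"[OF f(1)] "3.prems"(2) by simp
  finally show ?case by simp
next
  case (4 a s b r c)
  from "4.prems"(1) obtain w v Xa Z Xb Z' Xc where f: "fits a x w Xa" "fits_s s w Z" "fits b w v Xb" "fits_s r v Z'" "fits c v y Xc"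
    and p: "qparts x y X w v Xa Z Xb Z' Xc" and lX: "lobe x y X" unfolding fits.simps by blast
  note q = qparts_sep[OF p fits_lobe[OF f(1)] fits_pend[OF f(2)] fits_lobe[OF f(3)] fits_pend[OF f(4)] fits_lobe[OF f(5)]]
  have ne: "x \<notin> X" "x \<noteq> w" "x \<noteq> y" "x \<noteq> v" using lX sep_notin E_ne q(1,6) by (auto simp: lobe_def)
  have "nbhd E x \<inter> X \<subseteq> insert w (nbhd E x \<inter> Xa)"
    using q(4,6) ne sep_nonadj[OF q(8), of _ x] sep_nonadj[OF q(9), of _ x] sep_nonadj[OF q(10), of _ x] sep_nonadj[OF q(11), of _ x]
    by (auto simp: nbhd_def)
  then have "card (nbhd E x \<inter> X) \<le> card (insert w (nbhd E x \<inter> Xa))" using nb_fin E_V[OF q(1)] by (intro card_mono) auto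
  also have "\<dots> \<le> Suc (card (nbhd E x \<inter> Xa))" by (rule card_insert_le_m1) auto
  also have "card (nbhd E x \<inter> Xa) \<le> dl a" using "4.IH"[OF f(1)] "4.prems"(2) by simp
  finally show ?case by simp
qed auto

lemma fan_closed_s: "fits_s S u Z \<Longrightarrow> fan_s S = [] \<Longrightarrow> card (nbhd E u \<inter> Z) \<le> ds S"
proof (induction S arbitrary: u Z rule: fan_s.induct)
  case (3 l s r)
  from "3.prems"(1) obtain v X Zv Zr where f: "fits l u v X" "fits_s s v Zv" "fits_s r u Zr"
    and p: "bparts u Z v X Zv Zr" and lZ: "pend u Z" by auto
  have l: "fan_l l = []" "fan_s r = []" using "3.prems"(2) by (auto split: list.splits)
  have q: "E u v" "Z = insert v (X \<union> Zv \<union> Zr)" using p by (auto simp: bparts_def)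
  have s: "sep v v Zv" "u \<notin> Z" "u \<noteq> v" using fits_pend[OF f(2)] lZ sep_notin E_ne[OF q(1)] by (auto simp: pend_def)
  have fin: "finite (nbhd E u)" using nb_fin E_V[OF q(1)] by auto
  have "nbhd E u \<inter> Z \<subseteq> insert v ((nbhd E u \<inter> X) \<union> (nbhd E u \<inter> Zr))"
    using q(2) s sep_nonadj[OF s(1), of _ u] by (auto simp: nbhd_def)
  then have "card (nbhd E u \<inter> Z) \<le> card (insert v ((nbhd E u \<inter> X) \<union> (nbhd E u \<inter> Zr)))" using fin by (intro card_mono) auto
  also have "\<dots> \<le> Suc (card ((nbhd E u \<inter> X) \<union> (nbhd E u \<inter> Zr)))" by (rule card_insert_le_m1) auto
  also have "card ((nbhd E u \<inter> X) \<union> (nbhd E u \<inter> Zr)) \<le> card (nbhd E u \<inter> X) + card (nbhd E u \<inter> Zr)" by (rule card_Un_le)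
  also have "card (nbhd E u \<inter> X) \<le> dl l" by (rule fan_closed_l[OF f(1) l(1)])
  also have "card (nbhd E u \<inter> Zr) \<le> ds r" using "3.IH"[OF l(1) f(3) l(2)] .
  finally show ?case by simp
qed auto

lemma search_sound:
  assumes u: "u \<in> V" and d9: "\<forall>v\<in>V. deg E v \<le> 9" and dm: "\<forall>v\<in>V. deg E v \<le> deg E u"
  shows "search k S \<Longrightarrow> fits_s S u (V - {u}) \<Longrightarrow> finite V \<and> card V \<le> 10"
proof (induction k S rule: search.induct)
  case (2 k S)
  have nb: "nbhd E u - (V - {u}) = {}" "nbhd E u \<inter> (V - {u}) = nbhd E u" using nb_V nb_self by auto
  have nbad: "\<not> bad_s S M (ds S)" if "\<forall>v\<in>V. deg E v \<le> M" for M
    using bad_sound(2)[OF that "2.prems"(2), of "ds S"] by auto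
  show ?case
  proof (cases "fan_s S")
    case (Cons x xs)
    then have "list_all (search k) (x # xs)" using "2.prems"(1) nbad[OF d9] by simp
    moreover obtain S' where S': "S' \<in> set (x # xs)" "fits_s S' u (V - {u})" using fan_s_fits[OF "2.prems"(2)] Cons by auto
    ultimately show ?thesis using "2.IH"(2)[OF Cons S'(1) _ S'(2)] by (auto simp: list_all_iff)
  next
    case Nil
    have "deg E u \<le> ds S" using fan_closed_s[OF "2.prems"(2) Nil] nb(2) by (simp add: deg_def)
    \<comment> \<open>\<open>u\<close> has maximum degree, so its degree, now fully known, caps all
      others.\<close>
    then have "\<forall>v\<in>V. deg E v \<le> m2 (ds S)" using dm by (fastforce simp: m2_def)
    note nbd = nbad[OF this]
    show ?thesis
    proof (cases "refine 12 0 S")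
      case (Cons x xs)
      then have "list_all (search k) (x # xs)" using "2.prems"(1) nbd Nil by simp
      moreover obtain S' where S': "S' \<in> set (x # xs)" "fits_s S' u (V - {u})"
        using refine_fits[OF "2.prems"(2), of 12 0] Cons by auto
      ultimately show ?thesis using "2.IH"(1)[OF Nil Cons S'(1) _ S'(2)] by (auto simp: list_all_iff)
    next
      case rNil: Nil
      then have "closed_s S" "size_s S \<le> 9" using "2.prems"(1) nbd Nil by auto
      then have "finite (V - {u}) \<and> card (V - {u}) \<le> 9" using closed_size(2)[OF "2.prems"(2)] by auto
      then show ?thesis using u by (auto simp: card_Diff_singleton)
    qed
  qed
qed simp

section \<open>From the search to the bound on the number of vertices\<close>

lemma pend_all: "u \<in> V \<Longrightarrow> 3 \<le> deg E u \<Longrightarrow> pend u (V - {u})"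
  using E_V by (auto simp: pend_def sep_def)

lemma deg_le_9:
  assumes u: "u \<in> V" shows "deg E u \<le> 9"
proof (rule ccontr)
  assume "\<not> deg E u \<le> 9"
  then have d: "10 \<le> deg E u" by simp
  have P: "pend u (V - {u})" using pend_all u d by simp
  have "nbhd E u \<noteq> {}" using d by (auto simp: deg_def)
  then have "V - {u} \<noteq> {}" using nb_V nb_self by blast
  from pend_block[OF P this] obtain v X Zv Zr where b: "E u v" "lobe u v X" "pend v Zv" "pend u Zr" "V - {u} = insert v (X \<union> Zv \<union> Zr)"
    "v \<notin> X" "v \<notin> Zv" "v \<notin> Zr" "X \<inter> Zv = {}" "X \<inter> Zr = {}" "Zv \<inter> Zr = {}" .
  then have "bparts u (V - {u}) v X Zv Zr" unfolding bparts_def by (intro conjI)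
  from bparts_ctx[OF this P b(2-4)] have c: "ctx u v X 0 0 0" .
  \<comment> \<open>The law fails at \<open>vu\<close> by equality: 3/2 + 5/10 = 2. The edge
    \<open>uv\<close> has its block on one side only, so the far side contributes nothing.\<close>
  have "viol 10 2 (1 + 0) (3 + 0) (3 + 0)" by (simp add: viol_def viol1_def m2_def)
  moreover have "sep u v X" using b(2) by (simp add: lobe_def)
  ultimately show False
    using viol_sound[OF b(1) _ _ d _ _ _ _ c] md[of v] E_V[OF b(1)] lobe_score[OF b(2)] by blast
qed

lemma closed_all:
  assumes "x \<in> V" "x \<in> S" "\<And>p q. p \<in> S \<Longrightarrow> E p q \<Longrightarrow> q \<in> S" shows "V \<subseteq> S"
proof
  fix v assume "v \<in> V"
  then have "E\<^sup>*\<^sup>* x v" using cg assms(1) by (auto simp: connected_graph_def)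
  then show "v \<in> S" by (induction rule: rtranclp_induct) (use assms(2,3) in auto)
qed

text \<open>A two-regular graph is a cycle, and long cycles are flat.\<close>

lemma two_regular:
  assumes d2: "\<forall>v\<in>V. deg E v \<le> 2" and x: "x \<in> V"
  shows "finite V \<and> card V \<le> 10"
proof -
  have two: "z = q \<or> z = r" if "E p q" "E p r" "q \<noteq> r" "E p z" for p q r z
  proof (rule ccontr)
    assume "\<not> ?thesis"
    then have "3 \<le> deg E p" using deg_3[of p q r z] that by auto
    then show False using d2 E_V[OF that(1)] by fastforce
  qed
  have other: "\<exists>r. E p r \<and> r \<noteq> q" if "E p q" for p q
  proof (rule ccontr)
    assume "\<not> ?thesis"
    then have "nbhd E p \<subseteq> {q}" by (auto simp: nbhd_def)
    then have "deg E p \<le> 1" using card_mono[of "{q}" "nbhd E p"] by (simp add: deg_def)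
    then show False using md[of p] E_V[OF that] by simp
  qed
  have covered: ?thesis if "x \<in> S" "finite S" "card S \<le> 10" "\<And>p q. p \<in> S \<Longrightarrow> E p q \<Longrightarrow> q \<in> S" for S
  proof -
    have "V \<subseteq> S" using closed_all[OF x that(1,4)] .
    then show ?thesis using that finite_subset card_mono[of S V] by fastforce
  qed
  have "nbhd E x \<noteq> {}" using md[OF x] by (auto simp: deg_def)
  then obtain y where y: "E x y" by (auto simp: nbhd_def)
  obtain a where a: "E x a" "a \<noteq> y" using other[OF y] by blast
  obtain b where b: "E y b" "b \<noteq> x" using other[OF E_sym[OF y]] by blast
  have xs: "z = y \<or> z = a" if "E x z" for z using two[OF y a(1) _ that] a by blast
  have ys: "z = x \<or> z = b" if "E y z" for z using two[OF E_sym[OF y] b(1) _ that] b by blast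
  have ne: "x \<noteq> y" "x \<noteq> a" "y \<noteq> b" using E_ne y a b by blast+
  show ?thesis
  proof (cases "a = b")
    case True
    have "z = x \<or> z = y" if "E a z" for z using two[of a x y z] E_sym[OF a(1)] E_sym[OF b(1)] True ne that by blast
    then show ?thesis using xs ys True by (intro covered[of "{x, y, a}"]) (auto simp: card_insert_if)
  next
    case ab: False
    have t0: "nbhd E x \<inter> nbhd E y = {}" using xs ys ne ab a E_ne by (auto simp: nbhd_def)
    have V: "x \<in> V" "y \<in> V" using E_V y by auto
    \<comment> \<open>With both degrees 2 and no triangle the law reads 2/2 + (2 + s)/2 > 2, so
      \<open>s\<close> is positive.\<close>
    have "score x y (- {x}) \<noteq> 0"
    proof
      assume "score x y (- {x}) = 0"
      then show False using law_bound[OF y, of 2 2 0 0] md[OF V(1)] md[OF V(2)] t0 by simp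
    qed
    then obtain z where z: "z \<in> nbhd E y" "z \<noteq> x" "level E x y z \<noteq> 0"
      unfolding score_def by (elim sum.not_neutral_contains_not_neutral) auto
    then have "z = b" using ys by (auto simp: nbhd_def)
    then have "level E x y b \<noteq> 0" using z by simp
    moreover have "\<not> E x b" using xs[of b] ab ne by auto
    moreover have "\<forall>s. \<not> (E x s \<and> E y s)" using t0 by (auto simp: nbhd_def)
    \<comment> \<open>A positive level of \<open>b\<close> means a walk of length one or two from
      \<open>a\<close> to \<open>b\<close>, which closes a cycle of length four or five.\<close>
    ultimately consider "E a b" | c where "E a c" "E c b"
      using xs ne by (auto simp: level_def split: if_splits)
    then show ?thesis
    proof cases
      case 1
      have h1: "z = x \<or> z = b" if "E a z" for z using two[of a x b z] E_sym[OF a(1)] 1 b that by blast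
      have h2: "z = y \<or> z = a" if "E b z" for z using two[of b y a z] E_sym[OF b(1)] E_sym[OF 1] a that by blast
      show ?thesis by (intro covered[of "{x, y, a, b}"]) (auto simp: card_insert_if dest: xs ys h1 h2)
    next
      case 2
      have cx: "c \<noteq> x" "c \<noteq> y" using 2 \<open>\<not> E x b\<close> ys[of a] ne ab E_sym by blast+
      have h1: "z = x \<or> z = c" if "E a z" for z using two[of a x c z] E_sym[OF a(1)] 2 cx that by blast
      have h2: "z = y \<or> z = c" if "E b z" for z using two[of b y c z] E_sym[OF b(1)] E_sym[OF 2(2)] cx that by blast
      have h3: "z = a \<or> z = b" if "E c z" for z using two[of c a b z] E_sym[OF 2(1)] 2(2) ab that by blast
      show ?thesis by (intro covered[of "{x, y, a, b, c}"]) (auto simp: card_insert_if dest: xs ys h1 h2 h3)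
    qed
  qed
qed

lemma vertex_bound: "finite V \<and> card V \<le> 10"
proof (cases "V = {}")
  case False
  then obtain v0 where v0: "v0 \<in> V" by blast
  have b: "\<forall>v. v \<in> V \<longrightarrow> deg E v < 10" using deg_le_9 by fastforce
  obtain u where u: "u \<in> V" "\<forall>v. v \<in> V \<longrightarrow> deg E v \<le> deg E u"
    using ex_has_greatest_nat[of "\<lambda>v. v \<in> V" v0 "deg E" 10] v0 b by blast
  show ?thesis
  proof (cases "3 \<le> deg E u")
    case True
    have "fits_s Any_slot u (V - {u})" using pend_all[OF u(1) True] by simp
    from search_sound[OF u(1) _ _ search_succeeds this] u deg_le_9 show ?thesis by blast
  next
    case False
    then have "\<forall>v\<in>V. deg E v \<le> 2" using u by fastforce
    then show ?thesis using two_regular u by blast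
  qed
qed simp

end

section \<open>The fan over a path with nine vertices\<close>

text \<open>Vertex 0 is the hub, the vertices 1 to 9 form the path.\<close>

fun fan :: "nat \<Rightarrow> nat \<Rightarrow> bool" where
  "fan i j \<longleftrightarrow> i \<noteq> j \<and> i \<le> 9 \<and> j \<le> 9 \<and> (i = 0 \<or> j = 0 \<or> Suc i = j \<or> Suc j = i)"

declare fan.simps [simp del]

lemma fan_sym: "fan i j \<Longrightarrow> fan j i"
  by (auto simp: fan.simps)

lemma fan_simple: "simple_graph {..9} fan"
  by (auto simp: simple_graph_def fan.simps symp_def irreflp_def)

lemma fan_locally_finite: "locally_finite {..9} fan"
  unfolding locally_finite_def nbhd_def by (auto simp: fan.simps intro: finite_subset[of _ "{..9}"])

lemma fan_connected: "connected_graph {..9} fan"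
proof -
  have "fan\<^sup>*\<^sup>* 0 i" "fan\<^sup>*\<^sup>* i 0" if "i \<le> 9" for i
    using that by (cases "i = 0"; auto simp: fan.simps intro!: r_into_rtranclp)+
  then show ?thesis unfolding connected_graph_def by (meson atMost_iff rtranclp_trans)
qed

definition fan_deg :: "nat \<Rightarrow> nat" where
  "fan_deg i = length (filter (fan i) [0..<10])"

lemma fan_deg: "deg fan i = fan_deg i"
proof -
  have "nbhd fan i = set (filter (fan i) [0..<10])" by (auto simp: nbhd_def fan.simps)
  then show ?thesis by (simp add: deg_def fan_deg_def distinct_card del: set_filter)
qed

definition fan_dist :: "nat \<Rightarrow> nat \<Rightarrow> nat" where
  "fan_dist u v = (if u = v then 0 else if fan u v then 1 else 2)"

text \<open>Twenty times the \<open>1/10\<close>-lazy random walk at \<open>x\<close>; the degrees 2, 3, 9 all divide 18.\<close>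

definition fan_mass :: "nat \<Rightarrow> nat \<Rightarrow> nat" where
  "fan_mass x u = (if u = x then 2 else if fan x u then 18 div fan_deg x else 0)"

text \<open>Ships as much mass as possible along each pair in the given order. No optimality is
  claimed: \<open>plan_ok\<close> checks every plan that results.\<close>

fun greedy :: "(nat \<times> nat) list \<Rightarrow> nat list \<Rightarrow> nat list \<Rightarrow> (nat \<times> nat \<times> nat) list" where
  "greedy [] m n = []"
| "greedy ((u, v) # ps) m n = (let k = min (m ! u) (n ! v) in
    if k = 0 then greedy ps m n else (u, v, k) # greedy ps (m[u := m ! u - k]) (n[v := n ! v - k]))"

text \<open>Pairs sorted by distance, so that mass common to both walks stays in place and long
  moves come last.\<close>

definition fan_pairs :: "(nat \<times> nat) list" where
  "fan_pairs = (let ps = [(u, v). v \<leftarrow> rev [0..<10], u \<leftarrow> rev [0..<10]] in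
    concat (map (\<lambda>d. filter (\<lambda>(u, v). fan_dist u v = d) ps) [0, 1, 2]))"

definition fan_plan :: "nat \<Rightarrow> nat \<Rightarrow> (nat \<times> nat \<times> nat) list" where
  "fan_plan x y = greedy fan_pairs (map (fan_mass x) [0..<10]) (map (fan_mass y) [0..<10])"

definition plan_ok :: "(nat \<times> nat \<times> nat) list \<Rightarrow> nat \<Rightarrow> nat \<Rightarrow> bool" where
  "plan_ok ps x y \<longleftrightarrow> list_all (\<lambda>(u, v, k). u < 10 \<and> v < 10) ps \<and>
    list_all (\<lambda>w. sum_list (map (\<lambda>(u, v, k). if u = w then k else 0) ps) = fan_mass x w \<and>
      sum_list (map (\<lambda>(u, v, k). if v = w then k else 0) ps) = fan_mass y w) [0..<10] \<and>
    sum_list (map (\<lambda>(u, v, k). k * fan_dist u v) ps) < 20 * fan_dist x y"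

lemma fan_check:
  "list_all (\<lambda>x. list_all (\<lambda>y. x = y \<or> plan_ok (fan_plan x y) x y) [0..<10]) [0..<10]"
  "list_all (\<lambda>x. 2 \<le> fan_deg x \<and> fan_deg x * (18 div fan_deg x) = 18) [0..<10]"
  by code_simp+

lemma fan_plan_ok: "x \<le> 9 \<Longrightarrow> y \<le> 9 \<Longrightarrow> x \<noteq> y \<Longrightarrow> plan_ok (fan_plan x y) x y"
  using fan_check(1) unfolding list_all_iff set_upt by (metis atLeastLessThan_iff le_imp_less_Suc Suc_numeral semiring_norm(5,8) numeral_plus_one zero_le)

lemma fan_deg_ok: "x \<le> 9 \<Longrightarrow> 2 \<le> fan_deg x \<and> fan_deg x * (18 div fan_deg x) = 18"
  using fan_check(2) by (auto simp: list_all_iff simp del: upt_Suc)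

interpretation fan: fgraph "{..9}" fan
proof
  show "\<And>v. v \<in> {..9} \<Longrightarrow> 0 < deg fan v" using fan_deg_ok by (fastforce simp: fan_deg)
qed (rule fan_simple fan_locally_finite fan_connected)+

lemma fan_min_degree: "2 \<le> min_degree {..9} fan"
  unfolding min_degree_def using fan_deg_ok by (intro cINF_greatest) (auto simp: fan_deg)

lemma fan_gdist:
  assumes "u \<le> 9" "v \<le> 9" shows "gdist fan u v = fan_dist u v"
proof -
  consider "u = v" | "fan u v" | "u \<noteq> v" "\<not> fan u v" by blast
  then show ?thesis
  proof cases
    case 1
    then show ?thesis by (simp add: fan_dist_def)
  next
    case 2
    then show ?thesis using fan.gdist_edge[OF 2] fan.E_ne[OF 2] by (simp add: fan_dist_def)
  next
    case 3
    have "fan u 0" "fan 0 v" using 3 assms by (auto simp: fan.simps)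
    then have "(fan ^^ 2) u v" by (auto simp: numeral_2_eq_2)
    then have "gdist fan u v \<le> 2" by (rule fan.gdist_le)
    moreover have "gdist fan u v \<noteq> 0" "gdist fan u v \<noteq> 1" using fan.gdist_0[of u v] fan.gdist_1[of u v] 3 assms by auto
    ultimately show ?thesis using 3 by (simp add: fan_dist_def)
  qed
qed

lemma fan_mass: "x \<le> 9 \<Longrightarrow> lazy_walk fan (1 / 10) x u = real (fan_mass x u) / 20"
proof -
  assume x: "x \<le> 9"
  let ?q = "18 div fan_deg x"
  have "real (fan_deg x * ?q) = 18" using fan_deg_ok[OF x] by simp
  then have "real (fan_deg x) * real ?q = 18" by (simp only: of_nat_mult)
  moreover have "0 < real (fan_deg x)" using fan_deg_ok[OF x] by simp
  ultimately have "real ?q = 18 / real (fan_deg x)" by (simp add: field_simps)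
  then show ?thesis by (auto simp: lazy_walk_def fan_mass_def nbhd_def fan_deg)
qed

text \<open>Each list entry contributes to exactly one summand, the one of its key. This turns the
  matrix sums of the coupling back into sums over the plan.\<close>

lemma sum_list_regroup:
  assumes "finite S" "\<And>p. p \<in> set ps \<Longrightarrow> h p \<in> S"
  shows "(\<Sum>v\<in>S. sum_list (map (\<lambda>p. if h p = v then f p v else 0) ps)) = sum_list (map (\<lambda>p. f p (h p) :: real) ps)"
  using assms(2)
proof (induction ps)
  case (Cons p ps)
  have "(\<Sum>v\<in>S. if h p = v then f p v else 0) = f p (h p)"
    using Cons.prems assms(1) by (simp add: sum.delta')
  then show ?case using Cons by (simp add: sum.distrib)
qed simp

text \<open>The quotients increase with the laziness, so positive curvature at the single value 1/10
  suffices. There all masses are multiples of 1/20 and the walk at the hub is uniform on the ten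
  vertices.\<close>

lemma fan_curved: "positively_LLY_curved {..9} fan"
  unfolding positively_LLY_curved_def
proof (intro ballI impI)
  fix x y :: nat assume "x \<in> {..9}" "y \<in> {..9}" and ne: "x \<noteq> y"
  then have xy: "x \<le> 9" "y \<le> 9" by auto
  define ps where "ps = fan_plan x y"
  have ok: "plan_ok ps x y" unfolding ps_def by (rule fan_plan_ok[OF xy ne])
  \<comment> \<open>The plan as a matrix; the same pair may occur several times in the list, so its
    entries are added up.\<close>
  define A where "A = (\<lambda>(u, v). sum_list (map (\<lambda>p. if fst p = u \<and> fst (snd p) = v then real (snd (snd p)) / 20 else 0) ps))"
  have bd: "a \<le> 9" "b \<le> 9" if "(a, b, k) \<in> set ps" for a b k using ok that by (auto simp: plan_ok_def list_all_iff)
  have nat_list: "sum_list (map (\<lambda>p. real (f p) * (1 / 20)) ps) = real (sum_list (map f ps)) * (1 / 20)" for f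
    by (induction ps) (auto simp: field_simps)
  have row: "(\<Sum>v\<in>{..9}. A (u, v)) = lazy_walk fan (1 / 10) x u" if "u \<le> 9" for u
  proof -
    have "(\<Sum>v\<in>{..9}. A (u, v)) = (\<Sum>v\<in>{..9}. sum_list (map (\<lambda>p. if fst (snd p) = v then (if fst p = u then real (snd (snd p)) / 20 else 0) else 0) ps))"
      unfolding A_def case_prod_conv by (intro sum.cong refl arg_cong[of _ _ sum_list] map_cong) auto
    also have "\<dots> = sum_list (map (\<lambda>p. if fst p = u then real (snd (snd p)) / 20 else 0) ps)"
      by (rule sum_list_regroup) (use bd in force)+
    also have "\<dots> = sum_list (map (\<lambda>p. real (case p of (a, b, k) \<Rightarrow> if a = u then k else 0) * (1 / 20)) ps)"
      by (intro arg_cong[of _ _ sum_list] map_cong) (auto split: prod.splits)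
    also have "\<dots> = real (sum_list (map (\<lambda>(a, b, k). if a = u then k else 0) ps)) * (1 / 20)"
      by (rule nat_list)
    also have "sum_list (map (\<lambda>(a, b, k). if a = u then k else 0) ps) = fan_mass x u"
      using ok that by (auto simp: plan_ok_def list_all_iff simp del: upt_Suc)
    finally show ?thesis unfolding fan_mass[OF xy(1)] by simp
  qed
  have col: "(\<Sum>u\<in>{..9}. A (u, v)) = lazy_walk fan (1 / 10) y v" if "v \<le> 9" for v
  proof -
    have "(\<Sum>u\<in>{..9}. A (u, v)) = (\<Sum>u\<in>{..9}. sum_list (map (\<lambda>p. if fst p = u then (if fst (snd p) = v then real (snd (snd p)) / 20 else 0) else 0) ps))"
      unfolding A_def case_prod_conv by (intro sum.cong refl arg_cong[of _ _ sum_list] map_cong) auto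
    also have "\<dots> = sum_list (map (\<lambda>p. if fst (snd p) = v then real (snd (snd p)) / 20 else 0) ps)"
      by (rule sum_list_regroup) (use bd in force)+
    also have "\<dots> = sum_list (map (\<lambda>p. real (case p of (a, b, k) \<Rightarrow> if b = v then k else 0) * (1 / 20)) ps)"
      by (intro arg_cong[of _ _ sum_list] map_cong) (auto split: prod.splits)
    also have "\<dots> = real (sum_list (map (\<lambda>(a, b, k). if b = v then k else 0) ps)) * (1 / 20)"
      by (rule nat_list)
    also have "sum_list (map (\<lambda>(a, b, k). if b = v then k else 0) ps) = fan_mass y v"
      using ok that by (auto simp: plan_ok_def list_all_iff simp del: upt_Suc)
    finally show ?thesis unfolding fan_mass[OF xy(2)] by simp
  qed
  have "is_coupling {..9} (lazy_walk fan (1 / 10) x) (lazy_walk fan (1 / 10) y) A"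
  proof (rule is_couplingI[of "{..9}"])
    fix u v :: nat
    show "0 \<le> A (u, v)" unfolding A_def by (auto intro!: sum_list_nonneg split: if_splits)
  qed (use row col fan.lazy_le_1[of x "1 / 10"] xy in auto)
  then have "wasserstein {..9} fan (lazy_walk fan (1 / 10) x) (lazy_walk fan (1 / 10) y) \<le> cost {..9} fan A"
    by (rule fan.wasserstein_le)
  also have "cost {..9} fan A = (\<Sum>u\<in>{..9}. \<Sum>v\<in>{..9}. A (u, v) * real (gdist fan u v))" by (rule cost_finite) auto
  also have "\<dots> = (\<Sum>u\<in>{..9}. \<Sum>v\<in>{..9}. A (u, v) * real (fan_dist u v))"
    by (intro sum.cong refl) (simp add: fan_gdist)
  also have "\<dots> = (\<Sum>u\<in>{..9}. \<Sum>v\<in>{..9}. sum_list (map (\<lambda>p. if fst (snd p) = v then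
      (if fst p = u then real (snd (snd p)) / 20 * real (fan_dist u v) else 0) else 0) ps))"
    unfolding A_def case_prod_conv sum_list_mult_const[symmetric]
    by (intro sum.cong refl arg_cong[of _ _ sum_list] map_cong) auto
  also have "\<dots> = (\<Sum>u\<in>{..9}. sum_list (map (\<lambda>p. if fst p = u then real (snd (snd p)) / 20 * real (fan_dist u (fst (snd p))) else 0) ps))"
    by (intro sum.cong refl sum_list_regroup) (use bd in force)+
  also have "\<dots> = sum_list (map (\<lambda>p. real (snd (snd p)) / 20 * real (fan_dist (fst p) (fst (snd p)))) ps)"
    by (rule sum_list_regroup) (use bd in force)+
  also have "\<dots> = sum_list (map (\<lambda>p. real (case p of (u, v, k) \<Rightarrow> k * fan_dist u v) * (1 / 20)) ps)"
    by (intro arg_cong[of _ _ sum_list] map_cong) (auto split: prod.splits)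
  also have "\<dots> = real (sum_list (map (\<lambda>(u, v, k). k * fan_dist u v) ps)) * (1 / 20)"
    by (rule nat_list)
  also have "\<dots> < real (20 * fan_dist x y) * (1 / 20)"
  proof -
    have "sum_list (map (\<lambda>(u, v, k). k * fan_dist u v) ps) < 20 * fan_dist x y" using ok by (simp add: plan_ok_def)
    then have "real (sum_list (map (\<lambda>(u, v, k). k * fan_dist u v) ps)) < real (20 * fan_dist x y)" by (simp only: of_nat_less_iff)
    then show ?thesis by simp
  qed
  finally have "wasserstein {..9} fan (lazy_walk fan (1 / 10) x) (lazy_walk fan (1 / 10) y) < real (gdist fan x y)"
    using xy by (simp add: fan_gdist)
  moreover have "0 < real (fan_dist x y)" using ne by (simp add: fan_dist_def)
  ultimately have "0 < kappa {..9} fan (1 / 10) x y / (1 - 1 / 10)"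
    using xy by (simp add: kappa_def fan_gdist divide_less_eq)
  also have "\<dots> \<le> kappa_LLY {..9} fan x y" by (rule fan.kappa_LLY_ge) (use xy ne in auto)
  finally show "0 < kappa_LLY {..9} fan x y" .
qed

section \<open>A straight-line drawing of the fan\<close>

definition fan_pos :: "nat \<Rightarrow> complex" where
  "fan_pos i = (if i = 0 then 0 else Complex 1 (real i))"

text \<open>For \<open>i < j\<close>, a region given by linear conditions that contains the segment
  of the edge \<open>ij\<close>. Working with these conditions replaces parametrisations in the
  crossing arguments.\<close>

definition fan_edge :: "nat \<Rightarrow> nat \<Rightarrow> complex set" where
  "fan_edge i j = (if i = 0 then {z. 0 \<le> Re z \<and> Re z \<le> 1 \<and> Im z = Re z * real j}
    else {z. Re z = 1 \<and> real i \<le> Im z \<and> Im z \<le> real j})"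

lemma fan_segment:
  assumes "fan u v" "u < v"
  shows "closed_segment (fan_pos u) (fan_pos v) \<subseteq> fan_edge u v"
proof
  fix z assume "z \<in> closed_segment (fan_pos u) (fan_pos v)"
  then obtain t where t: "0 \<le> t" "t \<le> 1" "z = (1 - t) *\<^sub>R fan_pos u + t *\<^sub>R fan_pos v"
    by (auto simp: closed_segment_def)
  show "z \<in> fan_edge u v"
  proof (cases "u = 0")
    case True
    then show ?thesis using t assms(2) by (simp add: fan_edge_def fan_pos_def)
  next
    case False
    then have "v = Suc u" using assms by (auto simp: fan.simps)
    moreover have "Re z = (1 - t) * 1 + t * 1" "Im z = (1 - t) * real u + t * real v"
      using t(3) False assms(2) by (simp_all add: fan_pos_def)
    ultimately show ?thesis using t(1,2) False by (simp add: fan_edge_def algebra_simps)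
  qed
qed

lemma fan_edge_pos:
  assumes "fan u v" "u < v" "w \<le> 9" "fan_pos w \<in> fan_edge u v"
  shows "w = u \<or> w = v"
proof (cases "u = 0")
  case True
  then show ?thesis using assms by (cases "w = 0") (auto simp: fan_edge_def fan_pos_def)
next
  case False
  then have "v = Suc u" using assms by (auto simp: fan.simps)
  then show ?thesis using assms False by (cases "w = 0") (auto simp: fan_edge_def fan_pos_def)
qed

lemma fan_edge_disjoint:
  assumes "fan u v" "u < v" "fan w x" "w < x" "(u, v) \<noteq> (w, x)" "z \<in> fan_edge u v" "z \<in> fan_edge w x"
  shows "z \<in> fan_pos ` {..9}"
proof -
  have le: "u \<le> 9" "v \<le> 9" "w \<le> 9" "x \<le> 9" using assms by (auto simp: fan.simps)
  have spoke_path: "z \<in> fan_pos ` {..9}" if "fan 0 j" "z \<in> fan_edge 0 j" "Re z = 1" for j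
  proof -
    have "z = fan_pos j" using that by (auto simp: fan_edge_def fan_pos_def fan.simps complex_eq_iff)
    then show ?thesis using that(1) by (auto simp: fan.simps)
  qed
  consider "u = 0" "w = 0" | "u = 0" "w \<noteq> 0" | "u \<noteq> 0" "w = 0" | "u \<noteq> 0" "w \<noteq> 0" by blast
  then show ?thesis
  proof cases
    case 1
    then have "v \<noteq> x" "Re z * real v = Re z * real x" using assms by (auto simp: fan_edge_def)
    then have "Re z = 0" by simp
    then have "z = fan_pos 0" using 1 assms(6) by (simp add: fan_edge_def fan_pos_def complex_eq_iff)
    then show ?thesis by blast
  next
    case 2
    then show ?thesis using spoke_path[of v] assms by (auto simp: fan_edge_def)
  next
    case 3
    then show ?thesis using spoke_path[of x] assms by (auto simp: fan_edge_def)
  next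
    case 4
    then have vx: "v = Suc u" "x = Suc w" using assms by (auto simp: fan.simps)
    have z: "Re z = 1" "real u \<le> Im z" "Im z \<le> real (Suc u)" "real w \<le> Im z" "Im z \<le> real (Suc w)"
      using 4 vx assms by (auto simp: fan_edge_def)
    have "u \<noteq> w" using vx assms(5) by auto
    moreover have "real u \<le> real (Suc w)" "real w \<le> real (Suc u)" using z by linarith+
    ultimately have "u = Suc w \<or> w = Suc u" by linarith
    then have "Im z = real u \<and> u = Suc w \<or> Im z = real w \<and> w = Suc u" using z by auto
    then have "z = fan_pos u \<or> z = fan_pos w" using 4 z(1) by (auto simp: fan_pos_def complex_eq_iff)
    then show ?thesis using le by auto
  qed
qed

lemma fan_outerplanar: "outerplanar {..9} fan"
proof -
  define g where "g u v = linepath (fan_pos u) (fan_pos v)" for u v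
  have inj: "inj_on fan_pos {..9}" by (auto simp: inj_on_def fan_pos_def complex_eq_iff split: if_splits)
  have sub: "path_image (g u v) \<subseteq> fan_edge (min u v) (max u v)" "fan (min u v) (max u v)" "min u v < max u v"
    if "fan u v" for u v
  proof -
    have ne: "u \<noteq> v" using that by (simp add: fan.simps)
    show f: "fan (min u v) (max u v)" using that by (auto simp: min_def max_def intro: fan_sym)
    show l: "min u v < max u v" using ne by auto
    have "path_image (g u v) = closed_segment (fan_pos (min u v)) (fan_pos (max u v))"
      by (auto simp: g_def min_def max_def closed_segment_commute)
    then show "path_image (g u v) \<subseteq> fan_edge (min u v) (max u v)" using fan_segment[OF f l] by simp
  qed
  have pd: "plane_drawing {..9} fan fan_pos g"
    unfolding plane_drawing_def
  proof (intro conjI allI impI)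
    fix u v assume e: "fan u v"
    have le: "u \<le> 9" "v \<le> 9" "u \<noteq> v" using e by (auto simp: fan.simps)
    have "fan_pos u \<noteq> fan_pos v" using inj le by (auto simp: inj_on_def)
    then show "arc (g u v)" unfolding g_def by (rule arc_linepath)
    show "pathstart (g u v) = fan_pos u" "pathfinish (g u v) = fan_pos v" "g v u = reversepath (g u v)"
      by (simp_all add: g_def)
    have "fan_pos w \<in> {fan_pos u, fan_pos v}" if "w \<le> 9" "fan_pos w \<in> path_image (g u v)" for w
      using fan_edge_pos[OF sub(2,3)[OF e] that(1)] sub(1)[OF e] that(2) by (auto simp: min_def max_def split: if_splits)
    moreover have "{fan_pos u, fan_pos v} \<subseteq> path_image (g u v)" by (auto simp: g_def)
    ultimately show "path_image (g u v) \<inter> fan_pos ` {..9} = {fan_pos u, fan_pos v}" using le by auto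
  next
    fix u v w x assume e: "fan u v" "fan w x" "{u, v} \<noteq> {w, x}"
    have "(min u v, max u v) \<noteq> (min w x, max w x)" using e(3) by (auto simp: min_def max_def split: if_splits)
    then show "path_image (g u v) \<inter> path_image (g w x) \<subseteq> fan_pos ` {..9}"
      using fan_edge_disjoint[OF sub(2,3)[OF e(1)] sub(2,3)[OF e(2)]] sub(1)[OF e(1)] sub(1)[OF e(2)] by blast
  qed (rule inj)
  let ?D = "drawing_image {..9} fan fan_pos g"
  \<comment> \<open>Three half-planes around the drawing, which stays in the strip with real part
    between 0 and 1 above the real axis. Their union is connected through the two lower corners and
    lies in one unbounded face.\<close>
  define H where "H = {z. Re z < 0} \<union> {z. Im z < 0} \<union> {z. 1 < Re z}"
  have D: "0 \<le> Re z \<and> Re z \<le> 1 \<and> 0 \<le> Im z" if zD: "z \<in> ?D" for z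
  proof -
    consider i where "z = fan_pos i" | u v where "fan u v" "z \<in> path_image (g u v)"
      using zD unfolding drawing_image_def by blast
    then show ?thesis
    proof cases
      case 1
      then show ?thesis by (simp add: fan_pos_def)
    next
      case 2
      then have "z \<in> fan_edge (min u v) (max u v)" using sub(1) by blast
      then show ?thesis by (auto simp: fan_edge_def split: if_splits intro: order_trans[of 0 "real (min u v)"])
    qed
  qed
  have HD: "H \<subseteq> - ?D" using D unfolding H_def by force
  have corners: "Complex (-1) (-1) \<in> {z. Re z < 0} \<inter> {z. Im z < 0}" "Complex 2 (-1) \<in> {z. Im z < 0} \<inter> {z. 1 < Re z}"
    by simp_all
  have "connected ({z. Re z < 0} \<union> {z. Im z < 0})"
    by (rule connected_Un) (use corners(1) in \<open>blast intro: convex_connected convex_halfspace_Re_lt convex_halfspace_Im_lt\<close>)+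
  then have H: "connected H" unfolding H_def
    by (rule connected_Un[OF _ convex_connected[OF convex_halfspace_Re_gt]]) (use corners(2) in blast)
  let ?F = "connected_component_set (- ?D) (Complex (-1) 0)"
  have "Complex (-1) 0 \<in> H" by (simp add: H_def)
  then have HF: "H \<subseteq> ?F" by (intro connected_component_maximal H HD)
  have F: "?F \<in> components (- ?D)" using \<open>Complex (-1) 0 \<in> H\<close> HD by (intro componentsI) auto
  have "\<not> bounded ?F"
  proof
    assume "bounded ?F"
    then obtain r where r: "\<And>z. z \<in> ?F \<Longrightarrow> norm z \<le> r" by (auto simp: bounded_iff)
    have "- 1 - \<bar>r\<bar> < 0" by linarith
    then have "Complex (- 1 - \<bar>r\<bar>) 0 \<in> H" by (simp add: H_def)
    then have "norm (Complex (- 1 - \<bar>r\<bar>) 0) \<le> r" using r HF by blast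
    then have "\<bar>- 1 - \<bar>r\<bar>\<bar> \<le> r" using abs_Re_le_cmod[of "Complex (- 1 - \<bar>r\<bar>) 0"] by simp
    then show False by simp
  qed
  moreover have "fan_pos ` {..9} \<subseteq> frontier ?F"
  proof
    fix z assume z: "z \<in> fan_pos ` {..9}"
    then have "z \<in> ?D" by (auto simp: drawing_image_def)
    then have "z \<notin> ?F" using connected_component_subset by blast
    moreover have "z \<in> closure H"
    proof -
      \<comment> \<open>The hub is approached from the left, the vertices of the path from the
        right.\<close>
      define s :: real where "s = (if z = 0 then -1 else 1)"
      have lim: "(\<lambda>n. z + complex_of_real (s * inverse (real (Suc n)))) \<longlonglongrightarrow> z + complex_of_real (s * 0)"
        by (intro tendsto_intros LIMSEQ_inverse_real_of_nat)
      have step: "z + complex_of_real (s * e) \<in> H" if "0 < e" for e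
        using z that by (auto simp: H_def s_def fan_pos_def split: if_splits)
      have "z + complex_of_real (s * inverse (real (Suc n))) \<in> H" for n by (rule step) simp
      then show ?thesis using lim by (intro iffD2[OF closure_sequential] exI conjI allI) auto
    qed
    ultimately show "z \<in> frontier ?F"
      using closure_mono[OF HF] interior_subset[of ?F] by (auto simp: frontier_def)
  qed
  ultimately show ?thesis using pd F unfolding outerplanar_def by blast
qed

lemma vertices_le_10:
  fixes V :: "'a set"
  assumes sg: "simple_graph V E" and lf: "locally_finite V E" and cg: "connected_graph V E"
    and curved: "positively_LLY_curved V E" and op: "outerplanar V E" and md: "2 \<le> min_degree V E"
  shows "finite V \<and> card V \<le> 10"
proof -
  have deg: "2 \<le> deg E v" if "v \<in> V" for v
    using md cINF_lower[of "deg E" V v] that unfolding min_degree_def by simp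
  interpret fgraph V E
    by unfold_locales (use sg lf cg in \<open>auto dest: deg\<close>)
  obtain p g F where "plane_drawing V E p g" "F \<in> components (- drawing_image V E p g)" "\<not> bounded F" "p ` V \<subseteq> frontier F"
    using op unfolding outerplanar_def by blast
  then interpret dr: drawing V E p g F
    using sg by unfold_locales
  interpret posgraph V E
  proof (unfold_locales, goal_cases)
    case 1
    then show ?case by (rule deg)
  next
    case 2
    then show ?case by (rule dr.no_theta)
  next
    case 3
    then show ?case by (rule dr.no_K4)
  next
    case (4 x y)
    then have "0 < kappa_LLY V E x y"
      using curved E_V[OF 4] E_ne[OF 4] by (auto simp: positively_LLY_curved_def)
    then show ?case by (rule curvature_law[OF 4])
  qed
  show ?thesis by (rule vertex_bound)
qed

theorem theorem6:
  "(\<forall>(V :: 'a set) E.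
      simple_graph V E \<longrightarrow> locally_finite V E \<longrightarrow> connected_graph V E \<longrightarrow>
      positively_LLY_curved V E \<longrightarrow> outerplanar V E \<longrightarrow> min_degree V E \<ge> 2 \<longrightarrow>
      finite V \<and> card V \<le> 10) \<and>
   (\<exists>(V :: nat set) E.
      simple_graph V E \<and> locally_finite V E \<and> connected_graph V E \<and>
      positively_LLY_curved V E \<and> outerplanar V E \<and> min_degree V E \<ge> 2 \<and>
      finite V \<and> card V = 10)"
proof (intro conjI allI impI)
  show "\<exists>(V :: nat set) E.
      simple_graph V E \<and> locally_finite V E \<and> connected_graph V E \<and>
      positively_LLY_curved V E \<and> outerplanar V E \<and> min_degree V E \<ge> 2 \<and>
      finite V \<and> card V = 10"
    by (intro exI[of _ "{..9}"] exI[of _ fan] conjI fan_simple fan_locally_finite fan_connected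
        fan_curved fan_outerplanar fan_min_degree) auto
qed (use vertices_le_10 in blast)+

end
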